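(* Let $\mathbf{C}$ be a locally finitely presentable category, let $S=\Sigma^*$ be the free monad on a finitary endofunctor $\Sigma$ of $\mathbf{C}$, let $T$ be a finitary constant-free monad on $\mathbf{C}$, and let $\delta\colon TS\to ST$ be a monad distributive law. Then for any structural equational system $E$ over $\delta$, with induced equational system $\tilde E$ on the composite monad $ST$, the quotient morphism $ST\to\tilde E^\star$ is admissible.
   Context: Notation: $\eta^M,\mu^M$ are unit and multiplication of a monad $M$; $ST$ is the composite monad given by $\delta$; $\eta_\Sigma\colon\Sigma\to S$ is the canonical transformation; $\emptyset$ is the initial object; $T$ is constant-free iff $\eta^T_\emptyset\colon\emptyset\to T\emptyset$ is an isomorphism; a monad morphism $\alpha$ is admissible iff $\alpha_\emptyset$ is an isomorphism. An incremental structural law $(\Theta,d)$ over $\delta$: a functor $\Theta\colon\mathbf{C}^2\to\mathbf{C}$, cocontinuous in its first argument and finitary in its second, with a natural transformation $d_{X,Y}\colon\Theta(\Sigma X,Y)\to ST(\Theta(X,STY)+X+Y)$. A structural interpretation of $(\Theta,d)$ is a natural transformation $K_X\colon\Theta(X,X)\to STX$ such that for all $X$ the composite $$\Theta(\Sigma X,X)\xrightarrow{\Theta(\eta_{\Sigma,X},\eta^S_X)}\Theta(SX,SX)\xrightarrow{K_{SX}}STSX\xrightarrow{S\delta_X}SSTX\xrightarrow{\mu^S_{TX}}STX$$ equals the composite $$\Theta(\Sigma X,X)\xrightarrow{d_{X,X}}ST(\Theta(X,STX)+X+X)\xrightarrow{ST(\Theta(\eta^{ST}_X,STX)+[\mathrm{id},\mathrm{id}])}ST(\Theta(STX,STX)+X)\xrightarrow{ST(K_{STX}+X)}ST(STSTX+X)\xrightarrow{ST[\mu^{ST}_X,\eta^{ST}_X]}STSTX\xrightarrow{\mu^{ST}_X}STX.$$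 A structural equational system over $\delta$ consists of an incremental structural law $(\Theta,d)$ over $\delta$ and a pair $L,R$ of structural interpretations of it. For a structural interpretation $K$, let $\tilde K\colon\Theta_S^*\to ST$ be the monad morphism from the free monad $\Theta_S^*$ on the endofunctor $X\mapsto\Theta(X,SX)$ induced by the natural transformation $$\Theta(X,SX)\xrightarrow{\Theta(\eta^S_X,SX)}\Theta(SX,SX)\xrightarrow{K_{SX}}STSX\xrightarrow{S\delta_X}SSTX\xrightarrow{\mu^S_{TX}}STX.$$ The induced equational system $\tilde E$ is the pair $\tilde L,\tilde R\colon\Theta_S^*\to ST$, and its quotient morphism $ST\to\tilde E^\star$ is the coequaliser of $\tilde L,\tilde R$ in the category of finitary monads on $\mathbf{C}$. *)

theory Defs
  imports "HOL-Library.Equipollence" "HOL-Library.Countable_Set"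
begin

section \<open>Categories, functors, natural transformations\<close>

record ('o, 'a) cat =
  obs :: "'o set"
  arrs :: "'a set"
  src :: "'a \<Rightarrow> 'o"
  tgt :: "'a \<Rightarrow> 'o"
  idn :: "'o \<Rightarrow> 'a"
  cmp :: "'a \<Rightarrow> 'a \<Rightarrow> 'a"  (infixr "\<cdot>\<index>" 70)

text \<open>Composition is in applicative order: in a category \<open>C\<close>, \<open>g \<cdot>\<^bsub>C\<^esub> f\<close> is ``first \<open>f\<close>, then \<open>g\<close>''.
  All operations are total HOL functions and are only constrained on \<open>obs C\<close> and \<open>arrs C\<close>;
  accordingly, families of arrows are only ever compared on \<open>obs C\<close>.\<close>

definition hom :: "('o, 'a) cat \<Rightarrow> 'o \<Rightarrow> 'o \<Rightarrow> 'a set" where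
  "hom C X Y = {f \<in> arrs C. src C f = X \<and> tgt C f = Y}"

definition category :: "('o, 'a) cat \<Rightarrow> bool" where
  "category C \<longleftrightarrow>
     (\<forall>f\<in>arrs C. src C f \<in> obs C \<and> tgt C f \<in> obs C) \<and>
     (\<forall>X\<in>obs C. idn C X \<in> hom C X X) \<and>
     (\<forall>f\<in>arrs C. \<forall>g\<in>arrs C. tgt C f = src C g \<longrightarrow> g \<cdot>\<^bsub>C\<^esub> f \<in> hom C (src C f) (tgt C g)) \<and>
     (\<forall>f\<in>arrs C. f \<cdot>\<^bsub>C\<^esub> idn C (src C f) = f \<and> idn C (tgt C f) \<cdot>\<^bsub>C\<^esub> f = f) \<and>
     (\<forall>f\<in>arrs C. \<forall>g\<in>arrs C. \<forall>h\<in>arrs C. tgt C f = src C g \<and> tgt C g = src C h \<longrightarrow>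
        (h \<cdot>\<^bsub>C\<^esub> g) \<cdot>\<^bsub>C\<^esub> f = h \<cdot>\<^bsub>C\<^esub> (g \<cdot>\<^bsub>C\<^esub> f))"

definition is_iso :: "('o, 'a) cat \<Rightarrow> 'a \<Rightarrow> bool" where
  "is_iso C f \<longleftrightarrow> f \<in> arrs C \<and>
     (\<exists>g \<in> hom C (tgt C f) (src C f). g \<cdot>\<^bsub>C\<^esub> f = idn C (src C f) \<and> f \<cdot>\<^bsub>C\<^esub> g = idn C (tgt C f))"

definition prod_cat :: "('o, 'a) cat \<Rightarrow> ('p, 'b) cat \<Rightarrow> ('o \<times> 'p, 'a \<times> 'b) cat" where
  "prod_cat C D = \<lparr>
     obs = obs C \<times> obs D,
     arrs = arrs C \<times> arrs D,
     src = map_prod (src C) (src D),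
     tgt = map_prod (tgt C) (tgt D),
     idn = map_prod (idn C) (idn D),
     cmp = (\<lambda>(g, g') (f, f'). (g \<cdot>\<^bsub>C\<^esub> f, g' \<cdot>\<^bsub>D\<^esub> f'))\<rparr>"

record ('o, 'a, 'p, 'b) ftr =
  fob :: "'o \<Rightarrow> 'p"
  far :: "'a \<Rightarrow> 'b"

definition is_functor ::
  "('o, 'a) cat \<Rightarrow> ('p, 'b) cat \<Rightarrow> ('o, 'a, 'p, 'b, 'z) ftr_scheme \<Rightarrow> bool" where
  "is_functor C D F \<longleftrightarrow>
     (\<forall>X\<in>obs C. fob F X \<in> obs D) \<and>
     (\<forall>f\<in>arrs C. far F f \<in> hom D (fob F (src C f)) (fob F (tgt C f))) \<and>
     (\<forall>X\<in>obs C. far F (idn C X) = idn D (fob F X)) \<and>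
     (\<forall>f\<in>arrs C. \<forall>g\<in>arrs C. tgt C f = src C g \<longrightarrow> far F (g \<cdot>\<^bsub>C\<^esub> f) = far F g \<cdot>\<^bsub>D\<^esub> far F f)"

definition comp_ftr ::
  "('p, 'b, 'q, 'c, 'y) ftr_scheme \<Rightarrow> ('o, 'a, 'p, 'b, 'z) ftr_scheme \<Rightarrow> ('o, 'a, 'q, 'c) ftr" where
  "comp_ftr G F = \<lparr>fob = fob G \<circ> fob F, far = far G \<circ> far F\<rparr>"

definition nat_trans ::
  "('o, 'a) cat \<Rightarrow> ('p, 'b) cat \<Rightarrow> ('o, 'a, 'p, 'b, 'y) ftr_scheme \<Rightarrow> ('o, 'a, 'p, 'b, 'z) ftr_scheme
    \<Rightarrow> ('o \<Rightarrow> 'b) \<Rightarrow> bool" where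
  "nat_trans C D F G \<alpha> \<longleftrightarrow>
     (\<forall>X\<in>obs C. \<alpha> X \<in> hom D (fob F X) (fob G X)) \<and>
     (\<forall>f\<in>arrs C. \<alpha> (tgt C f) \<cdot>\<^bsub>D\<^esub> far F f = far G f \<cdot>\<^bsub>D\<^esub> \<alpha> (src C f))"

section \<open>Colimits and locally finitely presentable categories\<close>

definition cocone ::
  "('i, 'j) cat \<Rightarrow> ('o, 'a) cat \<Rightarrow> ('i, 'j, 'o, 'a) ftr \<Rightarrow> 'o \<Rightarrow> ('i \<Rightarrow> 'a) \<Rightarrow> bool" where
  "cocone J C D A c \<longleftrightarrow> is_functor J C D \<and> A \<in> obs C \<and>
     (\<forall>i\<in>obs J. c i \<in> hom C (fob D i) A) \<and>
     (\<forall>u\<in>arrs J. c (tgt J u) \<cdot>\<^bsub>C\<^esub> far D u = c (src J u))"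

definition is_colimit ::
  "('i, 'j) cat \<Rightarrow> ('o, 'a) cat \<Rightarrow> ('i, 'j, 'o, 'a) ftr \<Rightarrow> 'o \<Rightarrow> ('i \<Rightarrow> 'a) \<Rightarrow> bool" where
  "is_colimit J C D A c \<longleftrightarrow> cocone J C D A c \<and>
     (\<forall>B e. cocone J C D B e \<longrightarrow> (\<exists>!h. h \<in> hom C A B \<and> (\<forall>i\<in>obs J. h \<cdot>\<^bsub>C\<^esub> c i = e i)))"

text \<open>Sizes are measured by a set \<open>U\<close>: ``small'' means ``of cardinality strictly below that of
  \<open>U\<close>''. Taking for \<open>U\<close> a set of uncountable inaccessible cardinality gives the usual notion
  of smallness relative to a Grothendieck universe.  Every
  small category is isomorphic to one whose objects and arrows are taken from the type of \<open>U\<close>,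
  so it suffices to consider index categories over that type.\<close>

definition small_category :: "'u set \<Rightarrow> ('u, 'u) cat \<Rightarrow> bool" where
  "small_category U J \<longleftrightarrow> category J \<and> obs J \<prec> U \<and> arrs J \<prec> U"

definition filtered :: "('i, 'j) cat \<Rightarrow> bool" where
  "filtered J \<longleftrightarrow> obs J \<noteq> {} \<and>
     (\<forall>i\<in>obs J. \<forall>j\<in>obs J. \<exists>k\<in>obs J. hom J i k \<noteq> {} \<and> hom J j k \<noteq> {}) \<and>
     (\<forall>i\<in>obs J. \<forall>j\<in>obs J. \<forall>u\<in>hom J i j. \<forall>v\<in>hom J i j.
        \<exists>k\<in>obs J. \<exists>w\<in>hom J j k. w \<cdot>\<^bsub>J\<^esub> u = w \<cdot>\<^bsub>J\<^esub> v)"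

definition cocomplete :: "'u set \<Rightarrow> ('o, 'a) cat \<Rightarrow> bool" where
  "cocomplete U C \<longleftrightarrow>
     (\<forall>(J :: ('u, 'u) cat) D. small_category U J \<and> is_functor J C D \<longrightarrow> (\<exists>A c. is_colimit J C D A c))"

definition cocontinuous ::
  "'u set \<Rightarrow> ('o, 'a) cat \<Rightarrow> ('p, 'b) cat \<Rightarrow> ('o, 'a, 'p, 'b, 'z) ftr_scheme \<Rightarrow> bool" where
  "cocontinuous U C D F \<longleftrightarrow> is_functor C D F \<and>
     (\<forall>(J :: ('u, 'u) cat) G A c. small_category U J \<and> is_colimit J C G A c \<longrightarrow>
        is_colimit J D (comp_ftr F G) (fob F A) (\<lambda>i. far F (c i)))"

definition finitary ::
  "'u set \<Rightarrow> ('o, 'a) cat \<Rightarrow> ('p, 'b) cat \<Rightarrow> ('o, 'a, 'p, 'b, 'z) ftr_scheme \<Rightarrow> bool" where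
  "finitary U C D F \<longleftrightarrow> is_functor C D F \<and>
     (\<forall>(J :: ('u, 'u) cat) G A c. small_category U J \<and> filtered J \<and> is_colimit J C G A c \<longrightarrow>
        is_colimit J D (comp_ftr F G) (fob F A) (\<lambda>i. far F (c i)))"

text \<open>An object \<open>X\<close> is finitely presentable if \<open>hom C X -\<close> preserves small filtered colimits.  By the
  construction of filtered colimits of sets, this says that the canonical map from the colimit
  of the sets \<open>hom C X (D i)\<close> to \<open>hom C X A\<close> is surjective and injective.\<close>

definition finitely_presentable :: "'u set \<Rightarrow> ('o, 'a) cat \<Rightarrow> 'o \<Rightarrow> bool" where
  "finitely_presentable U C X \<longleftrightarrow> X \<in> obs C \<and>
     (\<forall>(J :: ('u, 'u) cat) D A c. small_category U J \<and> filtered J \<and> is_colimit J C D A c \<longrightarrow>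
        (\<forall>f\<in>hom C X A. \<exists>i\<in>obs J. \<exists>g\<in>hom C X (fob D i). c i \<cdot>\<^bsub>C\<^esub> g = f) \<and>
        (\<forall>i\<in>obs J. \<forall>j\<in>obs J. \<forall>g\<in>hom C X (fob D i). \<forall>h\<in>hom C X (fob D j).
           c i \<cdot>\<^bsub>C\<^esub> g = c j \<cdot>\<^bsub>C\<^esub> h \<longrightarrow>
           (\<exists>k\<in>obs J. \<exists>u\<in>hom J i k. \<exists>v\<in>hom J j k. far D u \<cdot>\<^bsub>C\<^esub> g = far D v \<cdot>\<^bsub>C\<^esub> h)))"

text \<open>The smallness condition below says that \<open>G\<close> spans a small full subcategory (via identities it
  also bounds \<open>G\<close> itself).  If the cardinality of \<open>U\<close> is inaccessible, this is equivalent, given the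
  other clauses, to \<open>G\<close> being a small set and \<open>C\<close> having small hom-sets.\<close>

definition locally_finitely_presentable :: "'u set \<Rightarrow> ('o, 'a) cat \<Rightarrow> bool" where
  "locally_finitely_presentable U C \<longleftrightarrow> category C \<and> cocomplete U C \<and>
     (\<exists>G. G \<subseteq> obs C \<and> {f \<in> arrs C. src C f \<in> G \<and> tgt C f \<in> G} \<prec> U \<and>
        (\<forall>A\<in>G. finitely_presentable U C A) \<and>
        (\<forall>X\<in>obs C. \<exists>(J :: ('u, 'u) cat) D c. small_category U J \<and> filtered J \<and>
           fob D ` obs J \<subseteq> G \<and> is_colimit J C D X c))"

definition initial_object :: "('o, 'a) cat \<Rightarrow> 'o \<Rightarrow> bool" where
  "initial_object C Z \<longleftrightarrow> Z \<in> obs C \<and> (\<forall>X\<in>obs C. \<exists>!f. f \<in> hom C Z X)"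

record ('o, 'a) coprods =
  csum :: "'o \<Rightarrow> 'o \<Rightarrow> 'o"
  cinl :: "'o \<Rightarrow> 'o \<Rightarrow> 'a"
  cinr :: "'o \<Rightarrow> 'o \<Rightarrow> 'a"

definition binary_coproducts :: "('o, 'a) cat \<Rightarrow> ('o, 'a) coprods \<Rightarrow> bool" where
  "binary_coproducts C cp \<longleftrightarrow>
     (\<forall>X\<in>obs C. \<forall>Y\<in>obs C. csum cp X Y \<in> obs C \<and>
        cinl cp X Y \<in> hom C X (csum cp X Y) \<and> cinr cp X Y \<in> hom C Y (csum cp X Y) \<and>
        (\<forall>A\<in>obs C. \<forall>f\<in>hom C X A. \<forall>g\<in>hom C Y A.
           \<exists>!h. h \<in> hom C (csum cp X Y) A \<and> h \<cdot>\<^bsub>C\<^esub> cinl cp X Y = f \<and> h \<cdot>\<^bsub>C\<^esub> cinr cp X Y = g))"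

definition copair :: "('o, 'a) cat \<Rightarrow> ('o, 'a) coprods \<Rightarrow> 'a \<Rightarrow> 'a \<Rightarrow> 'a" where
  "copair C cp f g = (THE h. h \<in> hom C (csum cp (src C f) (src C g)) (tgt C f) \<and>
     h \<cdot>\<^bsub>C\<^esub> cinl cp (src C f) (src C g) = f \<and> h \<cdot>\<^bsub>C\<^esub> cinr cp (src C f) (src C g) = g)"

definition sum_map :: "('o, 'a) cat \<Rightarrow> ('o, 'a) coprods \<Rightarrow> 'a \<Rightarrow> 'a \<Rightarrow> 'a" where
  "sum_map C cp f g =
     copair C cp (cinl cp (tgt C f) (tgt C g) \<cdot>\<^bsub>C\<^esub> f) (cinr cp (tgt C f) (tgt C g) \<cdot>\<^bsub>C\<^esub> g)"

section \<open>Monads\<close>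

record ('o, 'a) monad = "('o, 'a, 'o, 'a) ftr" +
  unit :: "'o \<Rightarrow> 'a"
  mult :: "'o \<Rightarrow> 'a"

definition id_ftr :: "('o, 'a, 'o, 'a) ftr" where
  "id_ftr = \<lparr>fob = id, far = id\<rparr>"

definition is_monad :: "('o, 'a) cat \<Rightarrow> ('o, 'a) monad \<Rightarrow> bool" where
  "is_monad C M \<longleftrightarrow> is_functor C C M \<and>
     nat_trans C C id_ftr M (unit M) \<and>
     nat_trans C C (comp_ftr M M) M (mult M) \<and>
     (\<forall>X\<in>obs C.
        mult M X \<cdot>\<^bsub>C\<^esub> unit M (fob M X) = idn C (fob M X) \<and>
        mult M X \<cdot>\<^bsub>C\<^esub> far M (unit M X) = idn C (fob M X) \<and>
        mult M X \<cdot>\<^bsub>C\<^esub> far M (mult M X) = mult M X \<cdot>\<^bsub>C\<^esub> mult M (fob M X))"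

definition finitary_monad :: "'u set \<Rightarrow> ('o, 'a) cat \<Rightarrow> ('o, 'a) monad \<Rightarrow> bool" where
  "finitary_monad U C M \<longleftrightarrow> is_monad C M \<and> finitary U C C M"

definition monad_morphism ::
  "('o, 'a) cat \<Rightarrow> ('o, 'a) monad \<Rightarrow> ('o, 'a) monad \<Rightarrow> ('o \<Rightarrow> 'a) \<Rightarrow> bool" where
  "monad_morphism C M N \<alpha> \<longleftrightarrow> nat_trans C C M N \<alpha> \<and>
     (\<forall>X\<in>obs C.
        \<alpha> X \<cdot>\<^bsub>C\<^esub> unit M X = unit N X \<and>
        \<alpha> X \<cdot>\<^bsub>C\<^esub> mult M X = mult N X \<cdot>\<^bsub>C\<^esub> far N (\<alpha> X) \<cdot>\<^bsub>C\<^esub> \<alpha> (fob M X))"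

text \<open>\<open>induced_morphism C M i N b k\<close>: \<open>k\<close> is a monad morphism from \<open>M\<close> to \<open>N\<close> that extends \<open>b\<close>
  along \<open>i\<close>.  If \<open>M\<close> is free with insertion \<open>i\<close>, it is unique on objects.\<close>

definition induced_morphism ::
  "('o, 'a) cat \<Rightarrow> ('o, 'a) monad \<Rightarrow> ('o \<Rightarrow> 'a) \<Rightarrow> ('o, 'a) monad \<Rightarrow> ('o \<Rightarrow> 'a) \<Rightarrow> ('o \<Rightarrow> 'a) \<Rightarrow> bool" where
  "induced_morphism C M i N b k \<longleftrightarrow>
     monad_morphism C M N k \<and> (\<forall>X\<in>obs C. k X \<cdot>\<^bsub>C\<^esub> i X = b X)"

definition free_monad ::
  "('o, 'a) cat \<Rightarrow> ('o, 'a, 'o, 'a) ftr \<Rightarrow> ('o, 'a) monad \<Rightarrow> ('o \<Rightarrow> 'a) \<Rightarrow> bool" where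
  "free_monad C F M i \<longleftrightarrow> is_monad C M \<and> nat_trans C C F M i \<and>
     (\<forall>N b. is_monad C N \<and> nat_trans C C F N b \<longrightarrow>
        (\<exists>k. induced_morphism C M i N b k) \<and>
        (\<forall>k k'. induced_morphism C M i N b k \<and> induced_morphism C M i N b k' \<longrightarrow>
           (\<forall>X\<in>obs C. k X = k' X)))"

text \<open>\<open>Z\<close> is the initial object of \<open>C\<close>.\<close>

definition constant_free :: "('o, 'a) cat \<Rightarrow> 'o \<Rightarrow> ('o, 'a) monad \<Rightarrow> bool" where
  "constant_free C Z T \<longleftrightarrow> is_iso C (unit T Z)"

definition admissible :: "('o, 'a) cat \<Rightarrow> 'o \<Rightarrow> ('o \<Rightarrow> 'a) \<Rightarrow> bool" where
  "admissible C Z \<alpha> \<longleftrightarrow> is_iso C (\<alpha> Z)"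

definition fin_monad_coequaliser ::
  "'u set \<Rightarrow> ('o, 'a) cat \<Rightarrow> ('o, 'a) monad \<Rightarrow> ('o, 'a) monad \<Rightarrow> ('o \<Rightarrow> 'a) \<Rightarrow> ('o \<Rightarrow> 'a)
    \<Rightarrow> ('o, 'a) monad \<Rightarrow> ('o \<Rightarrow> 'a) \<Rightarrow> bool" where
  "fin_monad_coequaliser U C P M l r Q q \<longleftrightarrow>
     finitary_monad U C Q \<and> monad_morphism C M Q q \<and>
     (\<forall>X\<in>obs C. q X \<cdot>\<^bsub>C\<^esub> l X = q X \<cdot>\<^bsub>C\<^esub> r X) \<and>
     (\<forall>N h. finitary_monad U C N \<and> monad_morphism C M N h \<and>
        (\<forall>X\<in>obs C. h X \<cdot>\<^bsub>C\<^esub> l X = h X \<cdot>\<^bsub>C\<^esub> r X) \<longrightarrow>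
        (\<exists>k. induced_morphism C Q q N h k) \<and>
        (\<forall>k k'. induced_morphism C Q q N h k \<and> induced_morphism C Q q N h k' \<longrightarrow>
           (\<forall>X\<in>obs C. k X = k' X)))"

definition distributive_law ::
  "('o, 'a) cat \<Rightarrow> ('o, 'a) monad \<Rightarrow> ('o, 'a) monad \<Rightarrow> ('o \<Rightarrow> 'a) \<Rightarrow> bool" where
  "distributive_law C S T \<delta> \<longleftrightarrow> nat_trans C C (comp_ftr T S) (comp_ftr S T) \<delta> \<and>
     (\<forall>X\<in>obs C.
        \<delta> X \<cdot>\<^bsub>C\<^esub> far T (unit S X) = unit S (fob T X) \<and>
        \<delta> X \<cdot>\<^bsub>C\<^esub> unit T (fob S X) = far S (unit T X) \<and>
        \<delta> X \<cdot>\<^bsub>C\<^esub> far T (mult S X) = mult S (fob T X) \<cdot>\<^bsub>C\<^esub> far S (\<delta> X) \<cdot>\<^bsub>C\<^esub> \<delta> (fob S X) \<and>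
        \<delta> X \<cdot>\<^bsub>C\<^esub> mult T (fob S X) = far S (mult T X) \<cdot>\<^bsub>C\<^esub> \<delta> (fob T X) \<cdot>\<^bsub>C\<^esub> far T (\<delta> X))"

definition composite_monad ::
  "('o, 'a) cat \<Rightarrow> ('o, 'a) monad \<Rightarrow> ('o, 'a) monad \<Rightarrow> ('o \<Rightarrow> 'a) \<Rightarrow> ('o, 'a) monad" where
  "composite_monad C S T \<delta> = \<lparr>
     fob = fob S \<circ> fob T,
     far = far S \<circ> far T,
     unit = (\<lambda>X. unit S (fob T X) \<cdot>\<^bsub>C\<^esub> unit T X),
     mult = (\<lambda>X. mult S (fob T X) \<cdot>\<^bsub>C\<^esub> far S (far S (mult T X)) \<cdot>\<^bsub>C\<^esub> far S (\<delta> (fob T X)))\<rparr>"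

section \<open>Structural equational systems\<close>

type_synonym ('o, 'a) bifunctor = "('o \<times> 'o, 'a \<times> 'a, 'o, 'a) ftr"

text \<open>\<open>Y + Z + W\<close> in the target of \<open>d\<close> is bracketed as \<open>Y + (Z + W)\<close>.\<close>

definition incremental_structural_law ::
  "'u set \<Rightarrow> ('o, 'a) cat \<Rightarrow> ('o, 'a) coprods \<Rightarrow> ('o, 'a, 'o, 'a) ftr \<Rightarrow> ('o, 'a) monad
    \<Rightarrow> ('o, 'a) monad \<Rightarrow> ('o \<Rightarrow> 'a) \<Rightarrow> ('o, 'a) bifunctor \<Rightarrow> ('o \<times> 'o \<Rightarrow> 'a) \<Rightarrow> bool" where
  "incremental_structural_law U C cp \<Sigma> S T \<delta> \<Theta> d \<longleftrightarrow>
     is_functor (prod_cat C C) C \<Theta> \<and>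
     (\<forall>Y\<in>obs C. cocontinuous U C C
        \<lparr>fob = (\<lambda>X. fob \<Theta> (X, Y)), far = (\<lambda>f. far \<Theta> (f, idn C Y))\<rparr>) \<and>
     (\<forall>X\<in>obs C. finitary U C C
        \<lparr>fob = (\<lambda>Y. fob \<Theta> (X, Y)), far = (\<lambda>g. far \<Theta> (idn C X, g))\<rparr>) \<and>
     (let ST = composite_monad C S T \<delta> in
      nat_trans (prod_cat C C) C
        \<lparr>fob = (\<lambda>(X, Y). fob \<Theta> (fob \<Sigma> X, Y)),
         far = (\<lambda>(f, g). far \<Theta> (far \<Sigma> f, g))\<rparr>
        \<lparr>fob = (\<lambda>(X, Y). fob ST (csum cp (fob \<Theta> (X, fob ST Y)) (csum cp X Y))),
         far = (\<lambda>(f, g). far ST (sum_map C cp (far \<Theta> (f, far ST g)) (sum_map C cp f g)))\<rparr>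
        d)"

text \<open>\<open>\<eta>\<Sigma>\<close> is the canonical transformation from \<open>\<Sigma>\<close> to \<open>S\<close>.\<close>

definition structural_interpretation ::
  "('o, 'a) cat \<Rightarrow> ('o, 'a) coprods \<Rightarrow> ('o, 'a) monad \<Rightarrow> ('o \<Rightarrow> 'a) \<Rightarrow> ('o, 'a) monad
    \<Rightarrow> ('o \<Rightarrow> 'a) \<Rightarrow> ('o, 'a) bifunctor \<Rightarrow> ('o \<times> 'o \<Rightarrow> 'a) \<Rightarrow> ('o \<Rightarrow> 'a) \<Rightarrow> bool" where
  "structural_interpretation C cp S \<eta>\<Sigma> T \<delta> \<Theta> d K \<longleftrightarrow>
     (let ST = composite_monad C S T \<delta> in
      nat_trans C C \<lparr>fob = (\<lambda>X. fob \<Theta> (X, X)), far = (\<lambda>f. far \<Theta> (f, f))\<rparr> ST K \<and>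
      (\<forall>X\<in>obs C.
         mult S (fob T X) \<cdot>\<^bsub>C\<^esub> far S (\<delta> X) \<cdot>\<^bsub>C\<^esub> K (fob S X) \<cdot>\<^bsub>C\<^esub> far \<Theta> (\<eta>\<Sigma> X, unit S X)
       = mult ST X
           \<cdot>\<^bsub>C\<^esub> far ST (copair C cp (mult ST X) (unit ST X))
           \<cdot>\<^bsub>C\<^esub> far ST (sum_map C cp (K (fob ST X)) (idn C X))
           \<cdot>\<^bsub>C\<^esub> far ST (sum_map C cp (far \<Theta> (unit ST X, idn C (fob ST X)))
                                   (copair C cp (idn C X) (idn C X)))
           \<cdot>\<^bsub>C\<^esub> d (X, X)))"

definition structural_equational_system ::
  "'u set \<Rightarrow> ('o, 'a) cat \<Rightarrow> ('o, 'a) coprods \<Rightarrow> ('o, 'a, 'o, 'a) ftr \<Rightarrow> ('o, 'a) monad \<Rightarrow> ('o \<Rightarrow> 'a)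
    \<Rightarrow> ('o, 'a) monad \<Rightarrow> ('o \<Rightarrow> 'a) \<Rightarrow> ('o, 'a) bifunctor \<Rightarrow> ('o \<times> 'o \<Rightarrow> 'a) \<Rightarrow> ('o \<Rightarrow> 'a) \<Rightarrow> ('o \<Rightarrow> 'a)
    \<Rightarrow> bool" where
  "structural_equational_system U C cp \<Sigma> S \<eta>\<Sigma> T \<delta> \<Theta> d L R \<longleftrightarrow>
     incremental_structural_law U C cp \<Sigma> S T \<delta> \<Theta> d \<and>
     structural_interpretation C cp S \<eta>\<Sigma> T \<delta> \<Theta> d L \<and>
     structural_interpretation C cp S \<eta>\<Sigma> T \<delta> \<Theta> d R"

definition theta_ftr :: "('o, 'a) bifunctor \<Rightarrow> ('o, 'a) monad \<Rightarrow> ('o, 'a, 'o, 'a) ftr" where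
  "theta_ftr \<Theta> S = \<lparr>fob = (\<lambda>X. fob \<Theta> (X, fob S X)), far = (\<lambda>f. far \<Theta> (f, far S f))\<rparr>"

definition theta_interp ::
  "('o, 'a) cat \<Rightarrow> ('o, 'a) monad \<Rightarrow> ('o, 'a) monad \<Rightarrow> ('o \<Rightarrow> 'a) \<Rightarrow> ('o, 'a) bifunctor \<Rightarrow> ('o \<Rightarrow> 'a)
    \<Rightarrow> 'o \<Rightarrow> 'a" where
  "theta_interp C S T \<delta> \<Theta> K X =
     mult S (fob T X) \<cdot>\<^bsub>C\<^esub> far S (\<delta> X) \<cdot>\<^bsub>C\<^esub> K (fob S X) \<cdot>\<^bsub>C\<^esub> far \<Theta> (unit S X, idn C (fob S X))"

text \<open>\<open>P\<close> with insertion \<open>\<iota>\<close> is the free monad on \<open>theta_ftr \<Theta> S\<close>; \<open>Lt\<close> and \<open>Rt\<close> are the monad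
  morphisms out of it that form the induced equational system.\<close>

definition induced_equational_system ::
  "('o, 'a) cat \<Rightarrow> ('o, 'a) monad \<Rightarrow> ('o, 'a) monad \<Rightarrow> ('o \<Rightarrow> 'a) \<Rightarrow> ('o, 'a) bifunctor
    \<Rightarrow> ('o \<Rightarrow> 'a) \<Rightarrow> ('o \<Rightarrow> 'a) \<Rightarrow> ('o, 'a) monad \<Rightarrow> ('o \<Rightarrow> 'a) \<Rightarrow> ('o \<Rightarrow> 'a) \<Rightarrow> ('o \<Rightarrow> 'a) \<Rightarrow> bool" where
  "induced_equational_system C S T \<delta> \<Theta> L R P \<iota> Lt Rt \<longleftrightarrow>
     free_monad C (theta_ftr \<Theta> S) P \<iota> \<and>
     induced_morphism C P \<iota> (composite_monad C S T \<delta>) (theta_interp C S T \<delta> \<Theta> L) Lt \<and>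
     induced_morphism C P \<iota> (composite_monad C S T \<delta>) (theta_interp C S T \<delta> \<Theta> R) Rt"

end

theory Submission
  imports Defs
begin

text \<open>Put \<open>I = ST Z\<close>, an \<open>ST\<close>-algebra with structure map \<open>a\<close>.  A structural interpretation \<open>K\<close> acts on \<open>I\<close>
  by \<open>\<phi> = a K\<^sub>I : \<Theta>(I, I) \<rightarrow> I\<close>, and its defining equation becomes a recursion for \<open>\<phi>\<close> along the
  \<open>\<Sigma>\<close>-algebra structure of \<open>I\<close> in the first argument of \<open>\<Theta>\<close>.  Since \<open>T\<close> is constant-free, \<open>TZ\<close> is initial, so \<open>I = S(TZ)\<close> is
  the initial \<open>\<Sigma>\<close>-algebra; as \<open>\<Theta>(-, I)\<close> preserves the initial chain, the recursion has at most one
  solution.  Hence the two interpretations agree on \<open>I\<close>, that is, \<open>I\<close> satisfies the equational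
  system.

  It remains to see that the coequaliser \<open>Q\<close>, which is only given by a universal property among
  finitary monads, is computed by free algebras; an \<open>ST\<close>-algebra \<open>ST X\<close> satisfying the equations is
  then already the free one on \<open>X\<close>.  As \<open>U\<close> is merely uncountable, \<open>C\<close> need not have powers, and
  endomorphism monads are not available; instead free algebras are constructed as colimits of
  countable chains.  The monad of free algebras is finitary and has the universal property of \<open>Q\<close>.
  The same construction, applied to \<open>X + \<Sigma> X\<close>, shows that the free monad \<open>S\<close> is finitary and that its
  values admit the induction principle used above.\<close>

section \<open>Categories and countable colimits\<close>

text \<open>The recursive call in the recursion for \<phi> has ST I, not I, as second argument of
  \<Theta>. The algebra structure \<open>a\<close> maps it back to I, so the second argument can
  stay fixed at I and only the first is subject to induction.

  That induction runs inside the functor \<Theta>(-, I): the stages of a chain are linked by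
  coequalisers, and the images of these under \<Theta>(-, I) have to be cancelled. So freeness
  carries an induction principle for all cocontinuous functors, whose case of the identity functor
  is the usual uniqueness.

  Both applications of the chain present their algebras by a pointed functor and equations of depth
  at most two. The arity X |-> \<Theta>(X, S X) of the equations runs diagonally through the two
  arguments of \<Theta>; an arity is therefore only asked to send the cocones of filtered colimits
  to jointly epic families.

  S and Q are known only by universal properties among monads, which do not describe their values.
  Each is shown to be a retract of a monad of free algebras, and this suffices to transfer
  finitariness, induction and invertibility.\<close>

lemma in_hom [simp]: "f \<in> hom C X Y \<longleftrightarrow> f \<in> arrs C \<and> src C f = X \<and> tgt C f = Y"
  by (simp add: hom_def)

locale base_cat =
  fixes C :: "('o, 'a) cat" (structure)
  assumes category: "category C"
begin

abbreviation endo :: "('o, 'a, 'o, 'a, 'z) ftr_scheme \<Rightarrow> bool" where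
  "endo F \<equiv> is_functor C C F"

lemma src_obs [simp]: "f \<in> arrs C \<Longrightarrow> src C f \<in> obs C"
  and tgt_obs [simp]: "f \<in> arrs C \<Longrightarrow> tgt C f \<in> obs C"
  and idn_arr [simp]: "X \<in> obs C \<Longrightarrow> idn C X \<in> arrs C"
  and src_idn [simp]: "X \<in> obs C \<Longrightarrow> src C (idn C X) = X"
  and tgt_idn [simp]: "X \<in> obs C \<Longrightarrow> tgt C (idn C X) = X"
  using category by (auto simp: category_def)

lemma cmp_arr [simp]:
  assumes "f \<in> arrs C" "g \<in> arrs C" "tgt C f = src C g"
  shows "g \<cdot> f \<in> arrs C" "src C (g \<cdot> f) = src C f" "tgt C (g \<cdot> f) = tgt C g"
  using category assms by (auto simp: category_def)

lemma cmp_idn [simp]: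
  "f \<in> arrs C \<Longrightarrow> src C f = X \<Longrightarrow> f \<cdot> idn C X = f"
  "f \<in> arrs C \<Longrightarrow> tgt C f = X \<Longrightarrow> idn C X \<cdot> f = f"
  using category by (auto simp: category_def)

lemma cmp_assoc [simp]:
  assumes "f \<in> arrs C" "g \<in> arrs C" "h \<in> arrs C" "tgt C f = src C g" "tgt C g = src C h"
  shows "(h \<cdot> g) \<cdot> f = h \<cdot> (g \<cdot> f)"
  using category assms unfolding category_def by blast

text \<open>Since \<open>cmp_assoc\<close> nests composites to the right, an equation for
  \<open>g \<cdot> f\<close> no longer matches inside a longer composite. This form rewrites
  there.\<close>

lemma ext_eq:
  assumes "g \<cdot> f = k" "f \<in> arrs C" "g \<in> arrs C" "tgt C f = src C g" "x \<in> arrs C" "tgt C x = src C f"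
  shows "g \<cdot> (f \<cdot> x) = k \<cdot> x"
  using assms cmp_assoc by metis

lemma fob_obs [simp]: "endo F \<Longrightarrow> X \<in> obs C \<Longrightarrow> fob F X \<in> obs C"
  and far_id [simp]: "endo F \<Longrightarrow> X \<in> obs C \<Longrightarrow> far F (idn C X) = idn C (fob F X)"
  by (auto simp: is_functor_def)

lemma far_arr [simp]:
  assumes "endo F" "f \<in> arrs C"
  shows "far F f \<in> arrs C" "src C (far F f) = fob F (src C f)" "tgt C (far F f) = fob F (tgt C f)"
  using assms unfolding is_functor_def in_hom by blast+

lemma far_comp [simp]:
  "endo F \<Longrightarrow> f \<in> arrs C \<Longrightarrow> g \<in> arrs C \<Longrightarrow> tgt C f = src C g \<Longrightarrow> far F (g \<cdot> f) = far F g \<cdot> far F f"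
  unfolding is_functor_def by blast

lemma endo_comp: "endo F \<Longrightarrow> endo G \<Longrightarrow> endo (comp_ftr F G)"
  unfolding is_functor_def[of C C "comp_ftr F G"] by (auto simp: comp_ftr_def)

lemma nat_arr:
  assumes "nat_trans C C F G \<alpha>" "X \<in> obs C"
  shows "\<alpha> X \<in> arrs C" "src C (\<alpha> X) = fob F X" "tgt C (\<alpha> X) = fob G X"
  using assms by (auto simp: nat_trans_def)

lemma nat_eq:
  assumes "nat_trans C C F G \<alpha>" "f \<in> arrs C" "src C f = X" "tgt C f = Y"
  shows "\<alpha> Y \<cdot> far F f = far G f \<cdot> \<alpha> X"
  using assms by (auto simp: nat_trans_def)

lemma cocone_arr:
  assumes "cocone J C D A c" "i \<in> obs J"
  shows "c i \<in> arrs C" "src C (c i) = fob D i" "tgt C (c i) = A"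
  using assms by (auto simp: cocone_def)

lemma colimit_cocone: "is_colimit J C D A c \<Longrightarrow> cocone J C D A c"
  by (simp add: is_colimit_def)

lemmas colimit_arr = cocone_arr[OF colimit_cocone]

lemma colimit_obs: "is_colimit J C D A c \<Longrightarrow> A \<in> obs C"
  by (simp add: is_colimit_def cocone_def)

lemma diagram_arr:
  assumes "is_functor J C D" "u \<in> arrs J"
  shows "far D u \<in> arrs C" "src C (far D u) = fob D (src J u)" "tgt C (far D u) = fob D (tgt J u)"
  using assms by (auto simp: is_functor_def)

lemma cocone_comp:
  assumes "category J" "cocone J C D A c" "h \<in> arrs C" "src C h = A" "tgt C h = B"
  shows "cocone J C D B (\<lambda>i. h \<cdot> c i)"
  unfolding cocone_def
proof (intro conjI ballI)
  show "is_functor J C D" "B \<in> obs C" using assms by (auto simp: cocone_def)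
  show "h \<cdot> c i \<in> hom C (fob D i) B" if "i \<in> obs J" for i
    using that assms cocone_arr[OF assms(2) that] by simp
  show "(h \<cdot> c (tgt J u)) \<cdot> far D u = h \<cdot> c (src J u)" if "u \<in> arrs J" for u
  proof -
    have "tgt J u \<in> obs J" using assms(1) that by (auto simp: category_def)
    then show ?thesis
      using that assms cocone_arr[OF assms(2)] diagram_arr[of J D u] by (simp add: cocone_def)
  qed
qed

lemma colimit_ex:
  assumes "is_colimit J C D A c" "cocone J C D B e"
  obtains h where "h \<in> arrs C" "src C h = A" "tgt C h = B" "\<And>i. i \<in> obs J \<Longrightarrow> h \<cdot> c i = e i"
  using assms unfolding is_colimit_def in_hom by blast

text \<open>The uniqueness half of the universal property, in the form in which almost every
  equation out of a colimit is proved below.\<close>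

lemma colimit_epi:
  assumes "category J" "is_colimit J C D A c" "u \<in> arrs C" "v \<in> arrs C" "src C u = A" "src C v = A"
    "tgt C u = tgt C v" "\<And>i. i \<in> obs J \<Longrightarrow> u \<cdot> c i = v \<cdot> c i"
  shows "u = v"
proof -
  have "cocone J C D (tgt C u) (\<lambda>i. v \<cdot> c i)"
    using cocone_comp[OF assms(1) colimit_cocone[OF assms(2)], of v] assms by simp
  then have "\<exists>!h. h \<in> hom C A (tgt C u) \<and> (\<forall>i\<in>obs J. h \<cdot> c i = v \<cdot> c i)"
    using assms(2) unfolding is_colimit_def by blast
  then show ?thesis using assms(3-) by (simp add: Ex1_def) metis
qed

end

text \<open>\<open>cocomplete\<close>, \<open>finitary\<close> and \<open>cocontinuous\<close> speak
  of index categories over the type of \<open>U\<close>, whereas chains and parallel pairs are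
  easier to build over the natural numbers. An injection \<open>\<epsilon>\<close> carries the
  latter to the former; \<open>inv \<epsilon>\<close> matters only on the range of
  \<open>\<epsilon>\<close>.\<close>

definition copy_cat :: "(nat \<Rightarrow> 'u) \<Rightarrow> (nat, nat) cat \<Rightarrow> ('u, 'u) cat" where
  "copy_cat \<epsilon> J = \<lparr>obs = \<epsilon> ` obs J, arrs = \<epsilon> ` arrs J, src = \<epsilon> \<circ> src J \<circ> inv \<epsilon>, tgt = \<epsilon> \<circ> tgt J \<circ> inv \<epsilon>,
     idn = \<epsilon> \<circ> idn J \<circ> inv \<epsilon>, cmp = (\<lambda>g f. \<epsilon> (cmp J (inv \<epsilon> g) (inv \<epsilon> f)))\<rparr>"

definition copy_ftr :: "(nat \<Rightarrow> 'u) \<Rightarrow> (nat, nat, 'o, 'a) ftr \<Rightarrow> ('u, 'u, 'o, 'a) ftr" where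
  "copy_ftr \<epsilon> D = \<lparr>fob = fob D \<circ> inv \<epsilon>, far = far D \<circ> inv \<epsilon>\<rparr>"

lemma copy_cat_simps [simp]:
  assumes "inj \<epsilon>"
  shows "obs (copy_cat \<epsilon> J) = \<epsilon> ` obs J" "arrs (copy_cat \<epsilon> J) = \<epsilon> ` arrs J"
    "src (copy_cat \<epsilon> J) (\<epsilon> x) = \<epsilon> (src J x)" "tgt (copy_cat \<epsilon> J) (\<epsilon> x) = \<epsilon> (tgt J x)"
    "idn (copy_cat \<epsilon> J) (\<epsilon> x) = \<epsilon> (idn J x)"
    "cmp (copy_cat \<epsilon> J) (\<epsilon> x) (\<epsilon> y) = \<epsilon> (cmp J x y)"
  using assms by (auto simp: copy_cat_def)

lemma copy_ftr_simps [simp]: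
  assumes "inj \<epsilon>"
  shows "fob (copy_ftr \<epsilon> D) (\<epsilon> x) = fob D x" "far (copy_ftr \<epsilon> D) (\<epsilon> x) = far D x"
  using assms by (auto simp: copy_ftr_def)

lemma comp_copy_ftr: "comp_ftr F (copy_ftr \<epsilon> D) = copy_ftr \<epsilon> (comp_ftr F D)"
  by (simp add: comp_ftr_def copy_ftr_def comp_assoc)

lemma category_copy: "inj \<epsilon> \<Longrightarrow> category J \<Longrightarrow> category (copy_cat \<epsilon> J)"
  by (auto simp: category_def inj_eq)

lemma filtered_copy:
  assumes "inj \<epsilon>" "filtered J"
  shows "filtered (copy_cat \<epsilon> J)"
proof -
  have 1: "hom (copy_cat \<epsilon> J) (\<epsilon> i) (\<epsilon> j) = \<epsilon> ` hom J i j" for i j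
    using assms(1) by (auto simp: inj_eq)
  show ?thesis
    using assms(2) unfolding filtered_def
    by (simp add: assms(1) 1 inj_eq del: in_hom)
qed

lemma functor_copy:
  "inj \<epsilon> \<Longrightarrow> is_functor (copy_cat \<epsilon> J) C (copy_ftr \<epsilon> D) \<longleftrightarrow> is_functor J C D"
  by (simp add: is_functor_def inj_eq)

lemma cocone_copy:
  "inj \<epsilon> \<Longrightarrow> cocone (copy_cat \<epsilon> J) C (copy_ftr \<epsilon> D) A e \<longleftrightarrow> cocone J C D A (e \<circ> \<epsilon>)"
  by (simp add: cocone_def functor_copy)

lemma colimit_copy:
  assumes "inj \<epsilon>"
  shows "is_colimit (copy_cat \<epsilon> J) C (copy_ftr \<epsilon> D) A e \<longleftrightarrow> is_colimit J C D A (e \<circ> \<epsilon>)"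
proof -
  have "(\<forall>B f. cocone J C D B (f \<circ> \<epsilon>) \<longrightarrow>
      (\<exists>!h. h \<in> hom C A B \<and> (\<forall>i\<in>obs J. cmp C h (e (\<epsilon> i)) = f (\<epsilon> i)))) \<longleftrightarrow>
    (\<forall>B f. cocone J C D B f \<longrightarrow>
      (\<exists>!h. h \<in> hom C A B \<and> (\<forall>i\<in>obs J. cmp C h (e (\<epsilon> i)) = f i)))" (is "?l = ?r")
  proof
    assume l: ?l
    show ?r
    proof (intro allI impI)
      fix B f assume "cocone J C D B f"
      \<comment> \<open>A family indexed by the natural numbers is the restriction along
        \<open>\<epsilon>\<close> of a family on the type of \<open>U\<close>, whose values off the
        range are arbitrary.\<close>
      then have "cocone J C D B ((f \<circ> inv \<epsilon>) \<circ> \<epsilon>)" using assms by (simp add: comp_assoc)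
      from l[rule_format, OF this] show "\<exists>!h. h \<in> hom C A B \<and> (\<forall>i\<in>obs J. cmp C h (e (\<epsilon> i)) = f i)"
        using assms by simp
    qed
  next
    assume r: ?r
    show ?l
    proof (intro allI impI)
      fix B f assume "cocone J C D B (f \<circ> \<epsilon>)"
      from r[rule_format, OF this]
      show "\<exists>!h. h \<in> hom C A B \<and> (\<forall>i\<in>obs J. cmp C h (e (\<epsilon> i)) = f (\<epsilon> i))" by simp
    qed
  qed
  then show ?thesis
    unfolding is_colimit_def by (simp add: cocone_copy assms)
qed

text \<open>Uncountability of \<open>U\<close> puts every countable set strictly below it.\<close>

lemma small_copy:
  fixes U :: "'u set"
  assumes "uncountable U" "inj \<epsilon>" "category J"
  shows "small_category U (copy_cat \<epsilon> J)"
proof -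
  have *: "\<epsilon> ` X \<prec> U" for X
  proof -
    have "countable (\<epsilon> ` X)" by simp
    then have "\<epsilon> ` X \<lesssim> (UNIV :: nat set)" by (auto simp: countable_def lepoll_def)
    also have "(UNIV :: nat set) \<lesssim> U"
      using assms(1) by (meson infinite_le_lepoll uncountable_infinite)
    finally have "\<epsilon> ` X \<lesssim> U" .
    moreover have "\<not> U \<lesssim> \<epsilon> ` X"
      using \<open>countable (\<epsilon> ` X)\<close> assms(1) countable_lepoll by blast
    ultimately show ?thesis
      by (meson eqpoll_imp_lepoll eqpoll_sym lesspoll_def)
  qed
  show ?thesis using assms * by (simp add: small_category_def category_copy)
qed

locale colim_cat = base_cat C for C :: "('o, 'a) cat" (structure) +
  fixes U :: "'u set"
  assumes unc: "uncountable U" and cocomplete: "cocomplete U C"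
begin

lemma ex_inj: "\<exists>\<epsilon> :: nat \<Rightarrow> 'u. inj \<epsilon>"
proof -
  have "infinite (UNIV :: 'u set)" using unc by (meson countable_finite finite_subset subset_UNIV)
  then show ?thesis by (meson infinite_countable_subset)
qed

lemma countable_colimit:
  fixes J :: "(nat, nat) cat"
  assumes "category J" "is_functor J C D"
  obtains A c where "is_colimit J C D A c"
proof -
  obtain \<epsilon> :: "nat \<Rightarrow> 'u" where "inj \<epsilon>" using ex_inj by blast
  then obtain A c where "is_colimit (copy_cat \<epsilon> J) C (copy_ftr \<epsilon> D) A c"
    using cocomplete small_copy[OF unc _ assms(1)] assms(2) functor_copy unfolding cocomplete_def by blast
  then show thesis using that \<open>inj \<epsilon>\<close> by (simp add: colimit_copy)
qed

lemma cocontinuous_countable: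
  fixes J :: "(nat, nat) cat"
  assumes "category J" "cocontinuous U C C \<Phi>" "is_colimit J C D A c"
  shows "is_colimit J C (comp_ftr \<Phi> D) (fob \<Phi> A) (\<lambda>i. far \<Phi> (c i))"
proof -
  obtain \<epsilon> :: "nat \<Rightarrow> 'u" where \<epsilon>: "inj \<epsilon>" using ex_inj by blast
  have "is_colimit (copy_cat \<epsilon> J) C (copy_ftr \<epsilon> D) A (c \<circ> inv \<epsilon>)"
    using \<epsilon> assms by (simp add: colimit_copy comp_assoc)
  then have "is_colimit (copy_cat \<epsilon> J) C (comp_ftr \<Phi> (copy_ftr \<epsilon> D)) (fob \<Phi> A) (\<lambda>i. far \<Phi> ((c \<circ> inv \<epsilon>) i))"
    using assms(2) small_copy[OF unc \<epsilon> assms(1)] unfolding cocontinuous_def by blast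
  then show ?thesis using \<epsilon> by (simp add: comp_copy_ftr colimit_copy comp_def)
qed

lemma finitary_countable:
  fixes J :: "(nat, nat) cat"
  assumes "category J" "filtered J" "finitary U C C \<Phi>" "is_colimit J C D A c"
  shows "is_colimit J C (comp_ftr \<Phi> D) (fob \<Phi> A) (\<lambda>i. far \<Phi> (c i))"
proof -
  obtain \<epsilon> :: "nat \<Rightarrow> 'u" where \<epsilon>: "inj \<epsilon>" using ex_inj by blast
  have "is_colimit (copy_cat \<epsilon> J) C (copy_ftr \<epsilon> D) A (c \<circ> inv \<epsilon>)"
    using \<epsilon> assms by (simp add: colimit_copy comp_assoc)
  then have "is_colimit (copy_cat \<epsilon> J) C (comp_ftr \<Phi> (copy_ftr \<epsilon> D)) (fob \<Phi> A) (\<lambda>i. far \<Phi> ((c \<circ> inv \<epsilon>) i))"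
    using assms small_copy[OF unc \<epsilon> assms(1)] filtered_copy[OF \<epsilon>] unfolding finitary_def by blast
  then show ?thesis using \<epsilon> by (simp add: comp_copy_ftr colimit_copy comp_def)
qed

end

section \<open>Coequalisers and chains\<close>

context colim_cat
begin

definition epi :: "'a \<Rightarrow> bool" where
  "epi x \<longleftrightarrow> (\<forall>u\<in>arrs C. \<forall>v\<in>arrs C. src C u = tgt C x \<longrightarrow> src C v = tgt C x \<longrightarrow> tgt C u = tgt C v \<longrightarrow>
     u \<cdot> x = v \<cdot> x \<longrightarrow> u = v)"

definition coequalises :: "('a \<times> 'a) set \<Rightarrow> 'a \<Rightarrow> bool" where
  "coequalises R q \<longleftrightarrow> (\<forall>(u, v)\<in>R. q \<cdot> u = q \<cdot> v)"

text \<open>Uniqueness of the factorisation is contained in the last clause, with the identity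
  functor for \<open>\<Phi>\<close> (see \<open>cocontinuous_id\<close>). The clause asks for more
  because the inductions below cancel the image of a coequaliser under a cocontinuous
  functor.\<close>

definition coequaliser :: "'o \<Rightarrow> ('a \<times> 'a) set \<Rightarrow> 'a \<Rightarrow> bool" where
  "coequaliser B R q \<longleftrightarrow> q \<in> arrs C \<and> src C q = B \<and> coequalises R q \<and>
     (\<forall>f\<in>arrs C. src C f = B \<longrightarrow> coequalises R f \<longrightarrow>
        (\<exists>h\<in>arrs C. src C h = tgt C q \<and> tgt C h = tgt C f \<and> h \<cdot> q = f)) \<and>
     (\<forall>\<Phi> :: ('o, 'a, 'o, 'a) ftr. cocontinuous U C C \<Phi> \<longrightarrow> epi (far \<Phi> q))"

text \<open>The parallel pair: 0 and 1 are also the identities, while 2 and 3 go from 0 to 1. In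
  \<open>cmp\<close>, if \<open>f\<close> is not an identity, then a composable \<open>g\<close> is
  the identity on 1.\<close>

definition pair_cat :: "(nat, nat) cat" where
  "pair_cat = \<lparr>obs = {0, 1}, arrs = {0, 1, 2, 3}, src = (\<lambda>x. if x = 1 then 1 else 0),
     tgt = (\<lambda>x. if x = 0 then 0 else 1), idn = (\<lambda>x. x), cmp = (\<lambda>g f. if f \<le> 1 then g else f)\<rparr>"

definition pair_ftr :: "'a \<Rightarrow> 'a \<Rightarrow> (nat, nat, 'o, 'a) ftr" where
  "pair_ftr u v = \<lparr>fob = (\<lambda>i. if i = 0 then src C u else tgt C u),
     far = (\<lambda>x. if x = 0 then idn C (src C u) else if x = 1 then idn C (tgt C u) else if x = 2 then u else v)\<rparr>"

lemma category_pair_cat: "category pair_cat"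
  by (auto simp: pair_cat_def category_def split: if_splits)

lemma functor_pair_ftr:
  assumes "u \<in> arrs C" "v \<in> arrs C" "src C v = src C u" "tgt C v = tgt C u"
  shows "is_functor pair_cat C (pair_ftr u v)"
  using assms by (auto simp: is_functor_def pair_cat_def pair_ftr_def)

lemma cocone_pair:
  assumes "u \<in> arrs C" "v \<in> arrs C" "src C v = src C u" "tgt C v = tgt C u"
  shows "cocone pair_cat C (pair_ftr u v) A e \<longleftrightarrow>
    e 1 \<in> arrs C \<and> src C (e 1) = tgt C u \<and> tgt C (e 1) = A \<and> e 1 \<cdot> u = e 0 \<and> e 1 \<cdot> v = e 0"
  (is "?l = ?r")
proof
  assume l: ?l
  then show ?r
    unfolding cocone_def by (auto simp: pair_cat_def pair_ftr_def)
next
  assume r: ?r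
  have e0: "e 0 \<in> arrs C" "src C (e 0) = src C u" "tgt C (e 0) = A"
    using r assms cmp_arr[of u "e 1"] by simp_all
  have "e (tgt pair_cat w) \<cdot> far (pair_ftr u v) w = e (src pair_cat w)" if w: "w \<in> arrs pair_cat" for w
  proof -
    consider "w = 0" | "w = 1" | "w = 2" | "w = 3"
      using w by (auto simp: pair_cat_def)
    then show ?thesis
      using r assms e0 by cases (auto simp: pair_cat_def pair_ftr_def)
  qed
  moreover have "e i \<in> hom C (fob (pair_ftr u v) i) A" if "i \<in> obs pair_cat" for i
    using that r assms e0 by (auto simp: pair_cat_def pair_ftr_def)
  ultimately show ?l
    unfolding cocone_def using functor_pair_ftr[OF assms] r by auto
qed

lemma cocontinuous_functor: "cocontinuous U C C \<Phi> \<Longrightarrow> endo \<Phi>"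
  by (simp add: cocontinuous_def)

text \<open>The leg at 1 of the colimit is the coequaliser. Its image under \<open>\<Phi>\<close> is
  epi because \<open>\<Phi>\<close> preserves the colimit and the leg at 0 factors through the leg
  at 1.\<close>

lemma ex_coequaliser_pair:
  assumes "u \<in> arrs C" "v \<in> arrs C" "src C v = src C u" "tgt C v = tgt C u"
  shows "\<exists>q. coequaliser (tgt C u) {(u, v)} q"
proof -
  obtain A c where c: "is_colimit pair_cat C (pair_ftr u v) A c"
    using countable_colimit[OF category_pair_cat functor_pair_ftr[OF assms]] by blast
  have q: "c 1 \<in> arrs C" "src C (c 1) = tgt C u" "tgt C (c 1) = A" "c 1 \<cdot> u = c 0" "c 1 \<cdot> v = c 0"
    using colimit_cocone[OF c] by (simp_all add: cocone_pair[OF assms])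
  have "\<exists>h\<in>arrs C. src C h = A \<and> tgt C h = tgt C f \<and> h \<cdot> c 1 = f"
    if f: "f \<in> arrs C" "src C f = tgt C u" "f \<cdot> u = f \<cdot> v" for f
  proof -
    have "cocone pair_cat C (pair_ftr u v) (tgt C f) (\<lambda>i. if i = 0 then f \<cdot> u else f)"
      using f by (simp add: cocone_pair[OF assms])
    then obtain h where h: "h \<in> arrs C" "src C h = A" "tgt C h = tgt C f"
      "\<And>i. i \<in> obs pair_cat \<Longrightarrow> h \<cdot> c i = (if i = 0 then f \<cdot> u else f)"
      using colimit_ex[OF c] by blast
    then show ?thesis using h(4)[of 1] by (auto simp: pair_cat_def)
  qed
  moreover have "epi (far \<Phi> (c 1))" if \<Phi>: "cocontinuous U C C \<Phi>" for \<Phi> :: "('o, 'a, 'o, 'a) ftr"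
    unfolding epi_def
  proof (intro ballI impI)
    note F [simp] = cocontinuous_functor[OF \<Phi>]
    fix s t assume st: "s \<in> arrs C" "t \<in> arrs C" "src C s = tgt C (far \<Phi> (c 1))"
      "src C t = tgt C (far \<Phi> (c 1))" "tgt C s = tgt C t" "s \<cdot> far \<Phi> (c 1) = t \<cdot> far \<Phi> (c 1)"
    have c0: "c 0 = c 1 \<cdot> u" using q by simp
    have "s \<cdot> far \<Phi> (c i) = t \<cdot> far \<Phi> (c i)" if "i \<in> obs pair_cat" for i
    proof (cases "i = 0")
      case True
      have "s \<cdot> far \<Phi> (c 1) \<cdot> far \<Phi> u = t \<cdot> far \<Phi> (c 1) \<cdot> far \<Phi> u"
        using st q assms ext_eq[OF st(6)] by simp
      then show ?thesis using True q assms c0 by simp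
    next
      case False
      then show ?thesis using st that by (simp add: pair_cat_def)
    qed
    then show "s = t"
      using colimit_epi[OF category_pair_cat cocontinuous_countable[OF category_pair_cat \<Phi> c]] st q by simp
  qed
  ultimately show ?thesis
    using q unfolding coequaliser_def coequalises_def by auto
qed

lemma epi_comp:
  assumes "epi x" "epi y" "x \<in> arrs C" "y \<in> arrs C" "tgt C x = src C y"
  shows "epi (y \<cdot> x)"
  unfolding epi_def
proof (intro ballI impI)
  fix u v assume *: "u \<in> arrs C" "v \<in> arrs C" "src C u = tgt C (y \<cdot> x)" "src C v = tgt C (y \<cdot> x)"
    "tgt C u = tgt C v" "u \<cdot> y \<cdot> x = v \<cdot> y \<cdot> x"
  then have "(u \<cdot> y) \<cdot> x = (v \<cdot> y) \<cdot> x" using assms by simp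
  moreover have "u \<cdot> y \<in> arrs C" "v \<cdot> y \<in> arrs C" "src C (u \<cdot> y) = tgt C x" "src C (v \<cdot> y) = tgt C x"
    "tgt C (u \<cdot> y) = tgt C (v \<cdot> y)" using * assms by simp_all
  ultimately have "u \<cdot> y = v \<cdot> y" using assms(1) unfolding epi_def by blast
  moreover have "src C u = tgt C y" "src C v = tgt C y" using * assms by simp_all
  ultimately show "u = v" using assms(2) * unfolding epi_def by blast
qed

lemma epi_idn: "X \<in> obs C \<Longrightarrow> epi (idn C X)"
  by (auto simp: epi_def)

text \<open>The pairs are coequalised one after another: once \<open>q\<close> handles
  \<open>R\<close>, the next coequaliser is that of \<open>q \<cdot> u\<close> and
  \<open>q \<cdot> v\<close>. The pairs may have different sources.\<close>

lemma ex_coequaliser: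
  assumes "finite R" "B \<in> obs C"
    "\<And>u v. (u, v) \<in> R \<Longrightarrow> u \<in> arrs C \<and> v \<in> arrs C \<and> src C v = src C u \<and> tgt C u = B \<and> tgt C v = B"
  shows "\<exists>q. coequaliser B R q"
  using assms(1,3)
proof (induction R rule: finite_induct)
  case empty
  have "coequaliser B {} (idn C B)"
    unfolding coequaliser_def coequalises_def
    using assms(2) by (auto simp: epi_idn cocontinuous_functor)
  then show ?case by blast
next
  case (insert w R)
  obtain u v where w: "w = (u, v)" by fastforce
  have uv: "u \<in> arrs C" "v \<in> arrs C" "src C v = src C u" "tgt C u = B" "tgt C v = B"
    using insert.prems[of u v] w by auto
  have Rarr: "s \<in> arrs C \<and> t \<in> arrs C \<and> src C t = src C s \<and> tgt C s = B \<and> tgt C t = B"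
    if "(s, t) \<in> R" for s t
    using insert.prems[of s t] that by auto
  obtain q where q: "coequaliser B R q" using insert.IH Rarr by blast
  then have qa: "q \<in> arrs C" "src C q = B" by (auto simp: coequaliser_def)
  obtain r where "coequaliser (tgt C (q \<cdot> u)) {(q \<cdot> u, q \<cdot> v)} r"
    using ex_coequaliser_pair[of "q \<cdot> u" "q \<cdot> v"] uv qa by auto
  then have r: "coequaliser (tgt C q) {(q \<cdot> u, q \<cdot> v)} r" using uv qa by simp
  then have ra: "r \<in> arrs C" "src C r = tgt C q" by (auto simp: coequaliser_def)
  have "coequaliser B (insert w R) (r \<cdot> q)"
    unfolding coequaliser_def
  proof (intro conjI ballI allI impI)
    show "r \<cdot> q \<in> arrs C" "src C (r \<cdot> q) = B" using qa ra by simp_all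
    have "r \<cdot> q \<cdot> s = r \<cdot> q \<cdot> t" if "(s, t) \<in> R" for s t
      using q that by (auto simp: coequaliser_def coequalises_def)
    moreover have "r \<cdot> q \<cdot> u = r \<cdot> q \<cdot> v" using r by (simp add: coequaliser_def coequalises_def)
    ultimately show "coequalises (insert w R) (r \<cdot> q)"
      using qa ra uv Rarr unfolding coequalises_def w by fastforce
  next
    fix f assume f: "f \<in> arrs C" "src C f = B" "coequalises (insert w R) f"
    then have "coequalises R f" and fuv: "f \<cdot> u = f \<cdot> v" by (auto simp: coequalises_def w)
    then obtain g where g: "g \<in> arrs C" "src C g = tgt C q" "tgt C g = tgt C f" "g \<cdot> q = f"
      using q f unfolding coequaliser_def by blast
    have "g \<cdot> q \<cdot> u = f \<cdot> u" "g \<cdot> q \<cdot> v = f \<cdot> v"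
      using ext_eq[OF g(4)] qa uv g by simp_all
    then have "coequalises {(q \<cdot> u, q \<cdot> v)} g" using fuv by (simp add: coequalises_def)
    then obtain h where h: "h \<in> arrs C" "src C h = tgt C r" "tgt C h = tgt C g" "h \<cdot> r = g"
      using r g unfolding coequaliser_def by blast
    have "h \<cdot> r \<cdot> q = f" using ext_eq[OF h(4)] h qa ra g by simp
    then show "\<exists>h\<in>arrs C. src C h = tgt C (r \<cdot> q) \<and> tgt C h = tgt C f \<and> h \<cdot> r \<cdot> q = f"
      using h g qa ra by (intro bexI[of _ h]) auto
  next
    fix \<Phi> :: "('o, 'a, 'o, 'a) ftr" assume \<Phi>: "cocontinuous U C C \<Phi>"
    note cocontinuous_functor[OF \<Phi>, simp]
    have "epi (far \<Phi> r \<cdot> far \<Phi> q)"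
      using \<Phi> q r qa ra by (intro epi_comp) (auto simp: coequaliser_def)
    then show "epi (far \<Phi> (r \<cdot> q))" using qa ra by simp
  qed
  then show ?case by blast
qed

section \<open>Chains as diagrams over the poset of natural numbers\<close>

fun chain_arr :: "(nat \<Rightarrow> 'o) \<Rightarrow> (nat \<Rightarrow> 'a) \<Rightarrow> nat \<Rightarrow> nat \<Rightarrow> 'a" where
  "chain_arr A e m 0 = idn C (A m)"
| "chain_arr A e m (Suc k) = e (m + k) \<cdot> chain_arr A e m k"

text \<open>The poset \<open>\<omega>\<close>; the code of \<open>(m, k)\<close> is the arrow from \<open>m\<close> to \<open>m + k\<close>.\<close>

definition omega_cat :: "(nat, nat) cat" where
  "omega_cat = \<lparr>obs = UNIV, arrs = UNIV, src = (\<lambda>x. fst (prod_decode x)),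
     tgt = (\<lambda>x. fst (prod_decode x) + snd (prod_decode x)), idn = (\<lambda>m. prod_encode (m, 0)),
     cmp = (\<lambda>g f. prod_encode (fst (prod_decode f), snd (prod_decode f) + snd (prod_decode g)))\<rparr>"

definition chain_ftr :: "(nat \<Rightarrow> 'o) \<Rightarrow> (nat \<Rightarrow> 'a) \<Rightarrow> (nat, nat, 'o, 'a) ftr" where
  "chain_ftr A e = \<lparr>fob = A, far = (\<lambda>x. chain_arr A e (fst (prod_decode x)) (snd (prod_decode x)))\<rparr>"

lemma category_omega: "category omega_cat"
  unfolding category_def omega_cat_def by (auto simp: ac_simps)

lemma omega_arr_eq: "src omega_cat u = src omega_cat v \<Longrightarrow> tgt omega_cat u = tgt omega_cat v \<Longrightarrow> u = v"
  by (auto simp: omega_cat_def prod_eq_iff intro: injD[OF inj_prod_decode[of UNIV]])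

lemma filtered_omega: "filtered omega_cat"
  unfolding filtered_def
proof (intro conjI ballI)
  show "obs omega_cat \<noteq> {}" by (simp add: omega_cat_def)
  fix i j :: nat
  have "prod_encode (i, j) \<in> hom omega_cat i (i + j)" "prod_encode (j, i) \<in> hom omega_cat j (i + j)"
    by (auto simp: omega_cat_def)
  then show "\<exists>k\<in>obs omega_cat. hom omega_cat i k \<noteq> {} \<and> hom omega_cat j k \<noteq> {}"
    by (intro bexI[of _ "i + j"]) (blast, simp add: omega_cat_def)
  fix u v assume "u \<in> hom omega_cat i j" "v \<in> hom omega_cat i j"
  then have "u = v" by (auto intro: omega_arr_eq)
  then show "\<exists>k\<in>obs omega_cat. \<exists>w\<in>hom omega_cat j k. cmp omega_cat w u = cmp omega_cat w v"
    by (intro bexI[of _ j] bexI[of _ "prod_encode (j, 0)"]) (auto simp: omega_cat_def)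
qed

definition chain :: "(nat \<Rightarrow> 'o) \<Rightarrow> (nat \<Rightarrow> 'a) \<Rightarrow> bool" where
  "chain A e \<longleftrightarrow> (\<forall>n. A n \<in> obs C \<and> e n \<in> arrs C \<and> src C (e n) = A n \<and> tgt C (e n) = A (Suc n))"

lemma chain_arr_arr:
  assumes "chain A e"
  shows "chain_arr A e m k \<in> arrs C \<and> src C (chain_arr A e m k) = A m \<and> tgt C (chain_arr A e m k) = A (m + k)"
  using assms by (induction k) (auto simp: chain_def)

lemma chain_arr_add:
  assumes "chain A e"
  shows "chain_arr A e m (k + l) = chain_arr A e (m + k) l \<cdot> chain_arr A e m k"
proof (induction l)
  case 0
  then show ?case using chain_arr_arr[OF assms] by simp
next
  case (Suc l)
  then show ?case
    using chain_arr_arr[OF assms] assms by (simp add: chain_def add.assoc)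
qed

lemma functor_chain: "chain A e \<Longrightarrow> is_functor omega_cat C (chain_ftr A e)"
  unfolding is_functor_def
  using chain_arr_arr[of A e] chain_arr_add[of A e]
  by (auto simp: omega_cat_def chain_ftr_def chain_def)

text \<open>Compatibility with the generating arrows \<open>e n\<close> is enough, since every arrow
  of the diagram is a composite of them.\<close>

lemma cocone_chain:
  assumes "chain A e"
  shows "cocone omega_cat C (chain_ftr A e) B p \<longleftrightarrow> B \<in> obs C \<and>
    (\<forall>n. p n \<in> arrs C \<and> src C (p n) = A n \<and> tgt C (p n) = B \<and> p (Suc n) \<cdot> e n = p n)" (is "?l = ?r")
proof
  assume l: ?l
  have "p (Suc n) \<cdot> e n = p n" for n
  proof -
    have "p (tgt omega_cat w) \<cdot> far (chain_ftr A e) w = p (src omega_cat w)" for w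
      using l by (simp add: cocone_def omega_cat_def)
    from this[of "prod_encode (n, 1)"] show ?thesis
      using assms by (simp add: omega_cat_def chain_ftr_def chain_def)
  qed
  then show ?r using l by (simp add: cocone_def omega_cat_def chain_ftr_def)
next
  assume r: ?r
  have "p (m + k) \<cdot> chain_arr A e m k = p m" for m k
  proof (induction k)
    case 0
    then show ?case using r by simp
  next
    case (Suc k)
    have "p (Suc (m + k)) \<cdot> e (m + k) \<cdot> chain_arr A e m k = p (m + k) \<cdot> chain_arr A e m k"
      using r assms chain_arr_arr[OF assms] by (intro ext_eq) (auto simp: chain_def)
    then show ?case using Suc by simp
  qed
  then show ?l
    unfolding cocone_def using r functor_chain[OF assms] by (simp add: omega_cat_def chain_ftr_def)
qed

lemma comp_chain_ftr:
  assumes "endo H" "chain A e"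
  shows "cocone omega_cat C (comp_ftr H (chain_ftr A e)) B p \<longleftrightarrow>
    cocone omega_cat C (chain_ftr (\<lambda>n. fob H (A n)) (\<lambda>n. far H (e n))) B p"
proof -
  have 1: "far H (chain_arr A e m k) = chain_arr (\<lambda>n. fob H (A n)) (\<lambda>n. far H (e n)) m k" for m k
    using assms chain_arr_arr[OF assms(2)] by (induction k) (auto simp: chain_def)
  have "comp_ftr H (chain_ftr A e) = chain_ftr (\<lambda>n. fob H (A n)) (\<lambda>n. far H (e n))"
    by (simp add: comp_ftr_def chain_ftr_def 1 comp_def)
  then show ?thesis by simp
qed

lemma chain_far: "endo H \<Longrightarrow> chain A e \<Longrightarrow> chain (\<lambda>n. fob H (A n)) (\<lambda>n. far H (e n))"
  by (simp add: chain_def)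

end

section \<open>Free algebras for pointed finitary functors with equations\<close>

context colim_cat
begin

text \<open>This is what is asked of the arity of an equation: its two sides are compared by
  restricting them along the images of the legs. It is weaker than \<open>finitary\<close> (see
  \<open>finitary_jointly_epi\<close>) and is easily verified for the diagonal arity in
  \<open>jointly_epi_theta\<close>.\<close>

definition jointly_epi_preserving :: "('o, 'a, 'o, 'a) ftr \<Rightarrow> bool" where
  "jointly_epi_preserving G \<longleftrightarrow> endo G \<and>
     (\<forall>(J :: ('u, 'u) cat) D A c. small_category U J \<and> filtered J \<and> is_colimit J C D A c \<longrightarrow>
       (\<forall>u\<in>arrs C. \<forall>v\<in>arrs C. src C u = fob G A \<and> src C v = fob G A \<and> tgt C u = tgt C v \<and>
          (\<forall>i\<in>obs J. u \<cdot> far G (c i) = v \<cdot> far G (c i)) \<longrightarrow> u = v))"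

lemma jointly_epi_preserving_D:
  fixes J :: "('u, 'u) cat"
  assumes "jointly_epi_preserving G" "small_category U J" "filtered J" "is_colimit J C D A c"
    "u \<in> arrs C" "v \<in> arrs C" "src C u = fob G A" "src C v = fob G A" "tgt C u = tgt C v"
    "\<And>i. i \<in> obs J \<Longrightarrow> u \<cdot> far G (c i) = v \<cdot> far G (c i)"
  shows "u = v"
  using assms unfolding jointly_epi_preserving_def by blast

lemma finitary_functor: "finitary U C C G \<Longrightarrow> endo G"
  by (simp add: finitary_def)

lemma finitary_jointly_epi:
  assumes "finitary U C C G"
  shows "jointly_epi_preserving G"
  unfolding jointly_epi_preserving_def
proof (intro conjI allI impI ballI)
  show "endo G" using assms by (rule finitary_functor)
next
  fix J :: "('u, 'u) cat" and D A c u v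
  assume *: "small_category U J \<and> filtered J \<and> is_colimit J C D A c" "u \<in> arrs C" "v \<in> arrs C"
    "src C u = fob G A \<and> src C v = fob G A \<and> tgt C u = tgt C v \<and> (\<forall>i\<in>obs J. u \<cdot> far G (c i) = v \<cdot> far G (c i))"
  then have "is_colimit J C (comp_ftr G D) (fob G A) (\<lambda>i. far G (c i))"
    using assms unfolding finitary_def by blast
  from colimit_epi[OF _ this] * show "u = v" by (simp add: small_category_def)
qed

lemma jointly_epi_chain:
  assumes "jointly_epi_preserving G" "chain A e" "is_colimit omega_cat C (chain_ftr A e) B p"
    "u \<in> arrs C" "v \<in> arrs C" "src C u = fob G B" "src C v = fob G B" "tgt C u = tgt C v"
    "\<And>n. u \<cdot> far G (p n) = v \<cdot> far G (p n)"
  shows "u = v"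
proof -
  obtain \<epsilon> :: "nat \<Rightarrow> 'u" where \<epsilon>: "inj \<epsilon>" using ex_inj by blast
  have "is_colimit (copy_cat \<epsilon> omega_cat) C (copy_ftr \<epsilon> (chain_ftr A e)) B (p \<circ> inv \<epsilon>)"
    using \<epsilon> assms(3) by (simp add: colimit_copy comp_assoc)
  from jointly_epi_preserving_D[OF assms(1) small_copy[OF unc \<epsilon> category_omega] filtered_copy[OF \<epsilon> filtered_omega] this]
  show ?thesis using assms \<epsilon> by simp
qed

lemma cocontinuous_id: "cocontinuous U C C id_ftr"
proof -
  have "comp_ftr id_ftr G = G" for G :: "('u, 'u, 'o, 'a) ftr"
    by (simp add: comp_ftr_def id_ftr_def)
  then show ?thesis
    by (auto simp: cocontinuous_def is_functor_def id_ftr_def)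
qed

end

text \<open>Every equation \<open>(G, l, r)\<close> of \<open>E\<close> relates two terms of depth at most two.  The equation
  required in \<open>unit_eq\<close> holds in every algebra; it makes the chain below a chain of algebra
  approximations.\<close>

locale equational_theory = colim_cat C U for C :: "('o, 'a) cat" (structure) and U :: "'u set" +
  fixes H :: "('o, 'a, 'o, 'a) ftr" and \<eta> :: "'o \<Rightarrow> 'a"
    and E :: "(('o, 'a, 'o, 'a) ftr \<times> ('o \<Rightarrow> 'a) \<times> ('o \<Rightarrow> 'a)) set"
  assumes finitary_H: "finitary U C C H"
    and nat_\<eta>: "nat_trans C C id_ftr H \<eta>"
    and finite_E: "finite E"
    and E_nat: "(G, l, r) \<in> E \<Longrightarrow> nat_trans C C G (comp_ftr H H) l \<and> nat_trans C C G (comp_ftr H H) r"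
    and E_epi: "(G, l, r) \<in> E \<Longrightarrow> jointly_epi_preserving G"
    and unit_eq: "(H, \<lambda>X. far H (\<eta> X), \<lambda>X. \<eta> (fob H X)) \<in> E"
begin

lemma functor_H [simp]: "endo H"
  using finitary_H by (rule finitary_functor)

lemma \<eta>_arr [simp]: "X \<in> obs C \<Longrightarrow> \<eta> X \<in> arrs C" "X \<in> obs C \<Longrightarrow> src C (\<eta> X) = X"
  "X \<in> obs C \<Longrightarrow> tgt C (\<eta> X) = fob H X"
  using nat_arr[OF nat_\<eta>] by (simp_all add: id_ftr_def)

lemma \<eta>_nat: "f \<in> arrs C \<Longrightarrow> src C f = X \<Longrightarrow> tgt C f = Y \<Longrightarrow> \<eta> Y \<cdot> f = far H f \<cdot> \<eta> X"
  using nat_eq[OF nat_\<eta>] by (simp add: id_ftr_def)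

lemma E_functor: "(G, l, r) \<in> E \<Longrightarrow> endo G"
  using E_epi by (auto simp: jointly_epi_preserving_def)

lemma E_arr:
  assumes "(G, l, r) \<in> E" "X \<in> obs C"
  shows "l X \<in> arrs C" "src C (l X) = fob G X" "tgt C (l X) = fob H (fob H X)"
    "r X \<in> arrs C" "src C (r X) = fob G X" "tgt C (r X) = fob H (fob H X)"
  using nat_arr[OF conjunct1[OF E_nat[OF assms(1)]] assms(2)] nat_arr[OF conjunct2[OF E_nat[OF assms(1)]] assms(2)]
  by (simp_all add: comp_ftr_def)

lemma E_natural:
  assumes "(G, l, r) \<in> E" "f \<in> arrs C" "src C f = X" "tgt C f = Y"
  shows "l Y \<cdot> far G f = far H (far H f) \<cdot> l X" "r Y \<cdot> far G f = far H (far H f) \<cdot> r X"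
  using nat_eq[OF conjunct1[OF E_nat[OF assms(1)]] assms(2-4)] nat_eq[OF conjunct2[OF E_nat[OF assms(1)]] assms(2-4)]
  by (simp_all add: comp_ftr_def)

text \<open>Algebras for \<open>H\<close> as a pointed functor; \<open>b \<cdot> far H b\<close>
  evaluates the terms of depth two in which the equations are written.\<close>

definition alg :: "'o \<Rightarrow> 'a \<Rightarrow> bool" where
  "alg B b \<longleftrightarrow> B \<in> obs C \<and> b \<in> arrs C \<and> src C b = fob H B \<and> tgt C b = B \<and> b \<cdot> \<eta> B = idn C B \<and>
     (\<forall>(G, l, r)\<in>E. b \<cdot> far H b \<cdot> l B = b \<cdot> far H b \<cdot> r B)"

definition alg_hom :: "'o \<Rightarrow> 'a \<Rightarrow> 'o \<Rightarrow> 'a \<Rightarrow> 'a \<Rightarrow> bool" where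
  "alg_hom A a B b h \<longleftrightarrow> h \<in> arrs C \<and> src C h = A \<and> tgt C h = B \<and> h \<cdot> a = b \<cdot> far H h"

text \<open>The last clause is induction over the generators \<open>i\<close> and the operation
  \<open>a\<close>, carried out after applying a cocontinuous functor. With the identity functor it
  gives uniqueness of extensions (\<open>free_alg_unique\<close>); the general form is what the
  recursion in the first argument of \<open>\<Theta>\<close> relies on.\<close>

definition free_alg :: "'o \<Rightarrow> 'o \<Rightarrow> 'a \<Rightarrow> 'a \<Rightarrow> bool" where
  "free_alg X W i a \<longleftrightarrow> alg W a \<and> i \<in> arrs C \<and> src C i = X \<and> tgt C i = W \<and>
     (\<forall>B b f. alg B b \<and> f \<in> arrs C \<and> src C f = X \<and> tgt C f = B \<longrightarrow> (\<exists>h. alg_hom W a B b h \<and> h \<cdot> i = f)) \<and>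
     (\<forall>(\<Phi> :: ('o, 'a, 'o, 'a) ftr) u v. cocontinuous U C C \<Phi> \<and> u \<in> arrs C \<and> v \<in> arrs C \<and>
        src C u = fob \<Phi> W \<and> src C v = fob \<Phi> W \<and> tgt C u = tgt C v \<and> u \<cdot> far \<Phi> i = v \<cdot> far \<Phi> i \<and>
        (\<forall>p\<in>arrs C. tgt C p = W \<and> u \<cdot> far \<Phi> p = v \<cdot> far \<Phi> p \<longrightarrow>
           u \<cdot> far \<Phi> (a \<cdot> far H p) = v \<cdot> far \<Phi> (a \<cdot> far H p)) \<longrightarrow> u = v)"

text \<open>Here \<open>y\<close> is a partial action, from \<open>fob H A\<close> to a further
  object. It evaluates the inner layer of each side of an equation; an action on the target of
  \<open>y\<close> has to identify the results.\<close>

definition rels :: "'o \<Rightarrow> 'a \<Rightarrow> ('a \<times> 'a) set" where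
  "rels A y = (\<lambda>(G, l, r). (far H y \<cdot> l A, far H y \<cdot> r A)) ` E"

text \<open>Stage \<open>n\<close> consists of an object \<open>A n\<close> and a partial action
  from \<open>fob H (A n)\<close> to \<open>A (Suc n)\<close>; the target of the action is the next
  object. The start is \<open>X\<close> with an identity, so \<open>A 1\<close> is
  \<open>fob H X\<close>. Each later action is universal among those that satisfy the equations over
  the previous stage.\<close>

primrec stage :: "'o \<Rightarrow> nat \<Rightarrow> 'o \<times> 'a" where
  "stage X 0 = (X, idn C (fob H X))"
| "stage X (Suc n) = (tgt C (snd (stage X n)),
     SOME z. coequaliser (fob H (tgt C (snd (stage X n)))) (rels (fst (stage X n)) (snd (stage X n))) z)"

abbreviation stage_ob :: "'o \<Rightarrow> nat \<Rightarrow> 'o" where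
  "stage_ob X n \<equiv> fst (stage X n)"

abbreviation stage_act :: "'o \<Rightarrow> nat \<Rightarrow> 'a" where
  "stage_act X n \<equiv> snd (stage X n)"

definition stage_arr :: "'o \<Rightarrow> nat \<Rightarrow> 'a" where
  "stage_arr X n = stage_act X n \<cdot> \<eta> (stage_ob X n)"

lemma ex_rels_coequaliser:
  assumes "A \<in> obs C" "y \<in> arrs C" "src C y = fob H A"
  shows "\<exists>z. coequaliser (fob H (tgt C y)) (rels A y) z"
proof (rule ex_coequaliser)
  show "finite (rels A y)" using finite_E by (simp add: rels_def)
  show "fob H (tgt C y) \<in> obs C" using assms by simp
  show "u \<in> arrs C \<and> v \<in> arrs C \<and> src C v = src C u \<and> tgt C u = fob H (tgt C y) \<and> tgt C v = fob H (tgt C y)"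
    if uv: "(u, v) \<in> rels A y" for u v
  proof -
    obtain G l r where "(G, l, r) \<in> E" "u = far H y \<cdot> l A" "v = far H y \<cdot> r A"
      using uv by (auto simp: rels_def)
    then show ?thesis using E_arr assms by simp
  qed
qed

lemma stage_props:
  assumes "X \<in> obs C"
  shows "stage_ob X n \<in> obs C \<and> stage_act X n \<in> arrs C \<and> src C (stage_act X n) = fob H (stage_ob X n)"
proof (induction n)
  case 0
  then show ?case using assms by simp
next
  case (Suc n)
  then have "coequaliser (fob H (tgt C (stage_act X n))) (rels (stage_ob X n) (stage_act X n)) (stage_act X (Suc n))"
    using someI_ex[OF ex_rels_coequaliser] by simp
  then show ?case using Suc by (simp add: coequaliser_def)
qed

lemma stage_simps [simp]:
  assumes "X \<in> obs C"
  shows "stage_ob X n \<in> obs C" "stage_act X n \<in> arrs C" "src C (stage_act X n) = fob H (stage_ob X n)"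
    "tgt C (stage_act X n) = stage_ob X (Suc n)"
  using stage_props[OF assms] by simp_all

lemma stage_coequaliser:
  assumes "X \<in> obs C"
  shows "coequaliser (fob H (stage_ob X (Suc n))) (rels (stage_ob X n) (stage_act X n)) (stage_act X (Suc n))"
  using someI_ex[OF ex_rels_coequaliser] stage_props[OF assms] by simp

declare stage.simps [simp del]

lemma stage_0: "stage_ob X 0 = X" "stage_act X 0 = idn C (fob H X)"
  by (simp_all add: stage.simps)

lemma stage_rel:
  assumes "X \<in> obs C" "(G, l, r) \<in> E"
  shows "stage_act X (Suc n) \<cdot> far H (stage_act X n) \<cdot> l (stage_ob X n) =
    stage_act X (Suc n) \<cdot> far H (stage_act X n) \<cdot> r (stage_ob X n)"
  using stage_coequaliser[OF assms(1), of n] assms(2)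
  by (auto simp: coequaliser_def coequalises_def rels_def)

lemma stage_arr_arr [simp]:
  assumes "X \<in> obs C"
  shows "stage_arr X n \<in> arrs C" "src C (stage_arr X n) = stage_ob X n"
    "tgt C (stage_arr X n) = stage_ob X (Suc n)"
  using assms by (simp_all add: stage_arr_def)

lemma chain_stage: "X \<in> obs C \<Longrightarrow> chain (stage_ob X) (stage_arr X)"
  by (simp add: chain_def)

text \<open>The equation of \<open>unit_eq\<close> at stage \<open>n\<close> replaces
  \<open>far H (\<eta> A)\<close> by \<open>\<eta> (fob H A)\<close>, and naturality of
  \<open>\<eta>\<close> moves it past the action. This compatibility lets the partial actions pass
  to the colimit.\<close>

lemma stage_act_nat:
  assumes "X \<in> obs C"
  shows "stage_act X (Suc n) \<cdot> far H (stage_arr X n) = stage_arr X (Suc n) \<cdot> stage_act X n"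
proof -
  have "stage_act X (Suc n) \<cdot> far H (stage_arr X n) =
      stage_act X (Suc n) \<cdot> far H (stage_act X n) \<cdot> \<eta> (fob H (stage_ob X n))"
    using stage_rel[OF assms unit_eq, of n] assms by (simp add: stage_arr_def)
  also have "\<dots> = stage_act X (Suc n) \<cdot> \<eta> (stage_ob X (Suc n)) \<cdot> stage_act X n"
    using \<eta>_nat[of "stage_act X n"] assms by simp
  finally show ?thesis using assms by (simp add: stage_arr_def)
qed

section \<open>The colimit of the stages is a free algebra\<close>

context
  fixes X W p a
  assumes X [simp]: "X \<in> obs C"
    and W: "is_colimit omega_cat C (chain_ftr (stage_ob X) (stage_arr X)) W p"
    and a [simp]: "a \<in> arrs C" "src C a = fob H W" "tgt C a = W"
    and ap: "\<And>n. a \<cdot> far H (p n) = p (Suc n) \<cdot> stage_act X n"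
begin

lemma p_arr [simp]: "p n \<in> arrs C" "src C (p n) = stage_ob X n" "tgt C (p n) = W" "W \<in> obs C"
  and p_stage: "p (Suc n) \<cdot> stage_arr X n = p n"
  using colimit_cocone[OF W] by (simp_all add: cocone_chain chain_stage)

lemma H_p_epi:
  "u \<in> arrs C \<Longrightarrow> v \<in> arrs C \<Longrightarrow> src C u = fob H W \<Longrightarrow> src C v = fob H W \<Longrightarrow> tgt C u = tgt C v \<Longrightarrow>
    (\<And>n. u \<cdot> far H (p n) = v \<cdot> far H (p n)) \<Longrightarrow> u = v"
  using jointly_epi_chain[OF finitary_jointly_epi[OF finitary_H] chain_stage[OF X] W] by blast

lemma stage_colimit_alg: "alg W a"
  unfolding alg_def
proof (intro conjI ballI)
  show "a \<cdot> \<eta> W = idn C W"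
  proof (rule colimit_epi[OF category_omega W])
    fix i
    have "a \<cdot> \<eta> W \<cdot> p i = a \<cdot> far H (p i) \<cdot> \<eta> (stage_ob X i)"
      using \<eta>_nat[of "p i"] by simp
    also have "\<dots> = p (Suc i) \<cdot> stage_arr X i"
      using ext_eq[OF ap] by (simp add: stage_arr_def)
    finally show "(a \<cdot> \<eta> W) \<cdot> p i = idn C W \<cdot> p i" by (simp add: p_stage)
  qed simp_all
next
  fix t assume "t \<in> E"
  moreover obtain G l r where t: "t = (G, l, r)" by (cases t)
  ultimately have e: "(G, l, r) \<in> E" by simp
  note E_functor[OF e, simp] E_arr[OF e, simp]
  \<comment> \<open>Terms of depth two over stage \<open>n\<close> are evaluated in stage
    \<open>n + 2\<close>, and the action that performs the outer evaluation was chosen to coequalise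
    the equations over stage \<open>n\<close>.\<close>
  have *: "a \<cdot> far H a \<cdot> far H (far H (p n)) \<cdot> z =
      p (Suc (Suc n)) \<cdot> stage_act X (Suc n) \<cdot> far H (stage_act X n) \<cdot> z"
    if "z \<in> arrs C" "tgt C z = fob H (fob H (stage_ob X n))" for n z
  proof -
    have "far H a \<cdot> far H (far H (p n)) = far H (p (Suc n)) \<cdot> far H (stage_act X n)"
      using arg_cong[OF ap[of n], of "far H"] by simp
    then show ?thesis using that ext_eq[of "far H a"] ext_eq[OF ap[of "Suc n"]] by simp
  qed
  have "a \<cdot> far H a \<cdot> l W = a \<cdot> far H a \<cdot> r W"
  \<comment> \<open>The legs need not generate \<open>fob G W\<close> as a colimit; agreement on all
    stages already gives equality because the arity keeps them jointly epic.\<close>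
  proof (rule jointly_epi_chain[OF E_epi[OF e] chain_stage[OF X] W])
    fix n
    have "a \<cdot> far H a \<cdot> l W \<cdot> far G (p n) = a \<cdot> far H a \<cdot> r W \<cdot> far G (p n)"
      using E_natural[OF e, of "p n"] stage_rel[OF X e, of n] * by simp
    then show "(a \<cdot> far H a \<cdot> l W) \<cdot> far G (p n) = (a \<cdot> far H a \<cdot> r W) \<cdot> far G (p n)" by simp
  qed simp_all
  then show "case t of (G, l, r) \<Rightarrow> a \<cdot> far H a \<cdot> l W = a \<cdot> far H a \<cdot> r W" by (simp add: t)
qed simp_all

lemma stage_colimit_ext:
  assumes B: "alg B b" and f [simp]: "f \<in> arrs C" "src C f = X" "tgt C f = B"
  shows "\<exists>h. alg_hom W a B b h \<and> h \<cdot> p 0 = f"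
proof -
  have b [simp]: "b \<in> arrs C" "src C b = fob H B" "tgt C b = B" "B \<in> obs C" and b\<eta>: "b \<cdot> \<eta> B = idn C B"
    using B by (auto simp: alg_def)
  \<comment> \<open>The invariant demands a successor \<open>g'\<close> of \<open>g\<close> as well:
    the factorisation through the next action is available only for an arrow \<open>g'\<close> that
    itself extends some \<open>g\<close>. At stage 0 the action is an identity, so \<open>g'\<close>
    is \<open>b \<cdot> far H f\<close>.\<close>
  define P where "P n g \<longleftrightarrow> g \<in> arrs C \<and> src C g = stage_ob X n \<and> tgt C g = B \<and> (n = 0 \<longrightarrow> g = f) \<and>
    (\<exists>g'\<in>arrs C. src C g' = stage_ob X (Suc n) \<and> tgt C g' = B \<and> g' \<cdot> stage_act X n = b \<cdot> far H g)" for n g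
  have "\<exists>g. P 0 g"
    unfolding P_def
    by (intro exI[of _ f] conjI bexI[of _ "b \<cdot> far H f"])
      (use stage_simps(4)[OF X, of 0] in \<open>simp_all add: stage_0\<close>)
  moreover have "\<exists>g'. P (Suc n) g' \<and> g' \<cdot> stage_act X n = b \<cdot> far H g" if P: "P n g" for g n
  proof -
    obtain g' where g' [simp]: "g' \<in> arrs C" "src C g' = stage_ob X (Suc n)" "tgt C g' = B"
      and e: "g' \<cdot> stage_act X n = b \<cdot> far H g"
      using P unfolding P_def by blast
    have g [simp]: "g \<in> arrs C" "src C g = stage_ob X n" "tgt C g = B" using P by (auto simp: P_def)
    have He: "far H g' \<cdot> far H (stage_act X n) = far H b \<cdot> far H (far H g)"
      using arg_cong[OF e, of "far H"] by simp
    \<comment> \<open>Since \<open>g'\<close> extends \<open>g\<close> along the action, evaluating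
      in the stage and then mapping to \<open>B\<close> is the same as mapping by \<open>g\<close>
      and evaluating in \<open>B\<close>, where the two sides of an equation agree.\<close>
    have "coequalises (rels (stage_ob X n) (stage_act X n)) (b \<cdot> far H g')"
      unfolding coequalises_def
    proof (clarify)
      fix u v assume "(u, v) \<in> rels (stage_ob X n) (stage_act X n)"
      then obtain G l r where E: "(G, l, r) \<in> E" and uv: "u = far H (stage_act X n) \<cdot> l (stage_ob X n)"
        "v = far H (stage_act X n) \<cdot> r (stage_ob X n)" by (auto simp: rels_def)
      note E_functor[OF E, simp] E_arr[OF E, simp]
      have eqB: "b \<cdot> far H b \<cdot> l B = b \<cdot> far H b \<cdot> r B" using B E by (auto simp: alg_def)
      have "b \<cdot> far H g' \<cdot> u = b \<cdot> far H b \<cdot> far H (far H g) \<cdot> l (stage_ob X n)"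
        using ext_eq[OF He] by (simp add: uv)
      also have "\<dots> = (b \<cdot> far H b \<cdot> l B) \<cdot> far G g" using E_natural(1)[OF E, of g] by simp
      also have "\<dots> = (b \<cdot> far H b \<cdot> r B) \<cdot> far G g" using eqB by simp
      also have "\<dots> = b \<cdot> far H b \<cdot> far H (far H g) \<cdot> r (stage_ob X n)" using E_natural(2)[OF E, of g] by simp
      also have "\<dots> = b \<cdot> far H g' \<cdot> v"
        using ext_eq[OF He] by (simp add: uv)
      finally show "(b \<cdot> far H g') \<cdot> u = (b \<cdot> far H g') \<cdot> v" by (simp add: uv)
    qed
    then obtain g'' where "g'' \<in> arrs C" "src C g'' = stage_ob X (Suc (Suc n))" "tgt C g'' = B"
      "g'' \<cdot> stage_act X (Suc n) = b \<cdot> far H g'"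
      using stage_coequaliser[OF X, of n] unfolding coequaliser_def
      by (metis X b cmp_arr far_arr functor_H g' stage_simps(4))
    then have "P (Suc n) g'" unfolding P_def by auto
    then show ?thesis using e by blast
  qed
  ultimately have "\<exists>g. \<forall>n. P n (g n) \<and> g (Suc n) \<cdot> stage_act X n = b \<cdot> far H (g n)"
    by (rule dependent_nat_choice)
  then obtain g where g: "\<And>n. P n (g n)" "\<And>n. g (Suc n) \<cdot> stage_act X n = b \<cdot> far H (g n)" by blast
  have ga [simp]: "g n \<in> arrs C" "src C (g n) = stage_ob X n" "tgt C (g n) = B" for n
    using g(1)[of n] by (auto simp: P_def)
  have g0: "g 0 = f" using g(1)[of 0] by (simp add: P_def)
  have "g (Suc n) \<cdot> stage_arr X n = g n" for n
    unfolding stage_arr_def using ext_eq[OF g(2)[of n]] \<eta>_nat[of "g n" "stage_ob X n" B] ext_eq[OF b\<eta>, of "g n"] by simp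
  then have "cocone omega_cat C (chain_ftr (stage_ob X) (stage_arr X)) B g"
    by (simp add: cocone_chain chain_stage)
  then obtain h where h [simp]: "h \<in> arrs C" "src C h = W" "tgt C h = B" and hp': "\<And>n. n \<in> obs omega_cat \<Longrightarrow> h \<cdot> p n = g n"
    by (rule colimit_ex[OF W]) blast
  then have hp: "\<And>n. h \<cdot> p n = g n" by (simp add: omega_cat_def)
  have "h \<cdot> a = b \<cdot> far H h"
  proof (rule H_p_epi)
    fix n
    have "h \<cdot> a \<cdot> far H (p n) = b \<cdot> far H (g n)"
      using ap[of n] ext_eq[OF hp[of "Suc n"]] g(2)[of n] by simp
    also have "\<dots> = b \<cdot> far H h \<cdot> far H (p n)" using arg_cong[OF hp[of n], of "far H"] by simp
    finally show "(h \<cdot> a) \<cdot> far H (p n) = (b \<cdot> far H h) \<cdot> far H (p n)" by simp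
  qed simp_all
  then show ?thesis using hp[of 0] g0 by (intro exI[of _ h]) (simp add: alg_hom_def)
qed

text \<open>The step yields agreement on \<open>p (Suc n) \<cdot> stage_act X n\<close>, and the
  image of \<open>stage_act X n\<close> under \<open>\<Phi>\<close> is epi, so agreement passes from
  \<open>p n\<close> to \<open>p (Suc n)\<close>. The images of all \<open>p n\<close> are jointly
  epic because \<open>\<Phi>\<close> preserves the colimit.\<close>

lemma stage_colimit_induct:
  fixes \<Phi> :: "('o, 'a, 'o, 'a) ftr"
  assumes \<Phi>: "cocontinuous U C C \<Phi>"
    and uv [simp]: "u \<in> arrs C" "v \<in> arrs C" "src C u = fob \<Phi> W" "src C v = fob \<Phi> W" "tgt C u = tgt C v"
    and base: "u \<cdot> far \<Phi> (p 0) = v \<cdot> far \<Phi> (p 0)"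
    and step: "\<And>q. q \<in> arrs C \<Longrightarrow> tgt C q = W \<Longrightarrow> u \<cdot> far \<Phi> q = v \<cdot> far \<Phi> q \<Longrightarrow>
      u \<cdot> far \<Phi> (a \<cdot> far H q) = v \<cdot> far \<Phi> (a \<cdot> far H q)"
  shows "u = v"
proof -
  have [simp]: "endo \<Phi>" using \<Phi> by (rule cocontinuous_functor)
  have epi: "epi (far \<Phi> (stage_act X n))" for n
    by (cases n) (use stage_coequaliser[OF X] \<Phi> in \<open>auto simp: coequaliser_def stage_0 epi_idn\<close>)
  have "u \<cdot> far \<Phi> (p n) = v \<cdot> far \<Phi> (p n)" for n
  proof (induction n)
    case 0
    show ?case by (rule base)
  next
    case (Suc n)
    have "(u \<cdot> far \<Phi> (p (Suc n))) \<cdot> far \<Phi> (stage_act X n) = (v \<cdot> far \<Phi> (p (Suc n))) \<cdot> far \<Phi> (stage_act X n)"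
      using step[of "p n"] Suc arg_cong[OF ap[of n], of "far \<Phi>"] by simp
    then show ?case
      using epi[of n] unfolding epi_def by simp
  qed
  then show ?thesis
    using colimit_epi[OF category_omega cocontinuous_countable[OF category_omega \<Phi> W]] by simp
qed

end

theorem ex_free_alg:
  assumes X [simp]: "X \<in> obs C"
  obtains W i a where "free_alg X W i a"
proof -
  note ch = chain_stage[OF X]
  obtain W p where W: "is_colimit omega_cat C (chain_ftr (stage_ob X) (stage_arr X)) W p"
    using countable_colimit[OF category_omega functor_chain[OF ch]] by blast
  have p [simp]: "p n \<in> arrs C" "src C (p n) = stage_ob X n" "tgt C (p n) = W" "W \<in> obs C"
    and pe: "p (Suc n) \<cdot> stage_arr X n = p n" for n
    using colimit_cocone[OF W] by (simp_all add: cocone_chain ch)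
  have "p (Suc (Suc n)) \<cdot> stage_act X (Suc n) \<cdot> far H (stage_arr X n) = p (Suc n) \<cdot> stage_act X n" for n
    using ext_eq[OF pe[of "Suc n"]] by (simp add: stage_act_nat)
  \<comment> \<open>The partial actions raise the stage by one, hence the shifted leg
    \<open>p (Suc n)\<close>. As \<open>H\<close> preserves the colimit of the chain, this cocone
    induces a total action on \<open>W\<close>.\<close>
  then have "cocone omega_cat C (comp_ftr H (chain_ftr (stage_ob X) (stage_arr X))) W (\<lambda>n. p (Suc n) \<cdot> stage_act X n)"
    using ch by (simp add: comp_chain_ftr cocone_chain chain_far)
  then obtain a where a: "a \<in> arrs C" "src C a = fob H W" "tgt C a = W"
    "\<And>n. n \<in> obs omega_cat \<Longrightarrow> a \<cdot> far H (p n) = p (Suc n) \<cdot> stage_act X n"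
    by (rule colimit_ex[OF finitary_countable[OF category_omega filtered_omega finitary_H W]]) blast
  then have ap: "\<And>n. a \<cdot> far H (p n) = p (Suc n) \<cdot> stage_act X n" by (simp add: omega_cat_def)
  have "free_alg X W (p 0) a"
    unfolding free_alg_def
    using stage_colimit_alg[OF X W a(1-3) ap] stage_colimit_ext[OF X W a(1-3) ap] stage_colimit_induct[OF X W a(1-3) ap]
    by (auto simp: stage_0)
  then show thesis by (rule that)
qed

end

section \<open>The monad of free algebras\<close>

context base_cat
begin

lemma monad_functor [simp]: "is_monad C M \<Longrightarrow> endo M"
  by (simp add: is_monad_def)

lemma monad_arr [simp]:
  assumes "is_monad C M" "X \<in> obs C"
  shows "unit M X \<in> arrs C" "src C (unit M X) = X" "tgt C (unit M X) = fob M X"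
    "mult M X \<in> arrs C" "src C (mult M X) = fob M (fob M X)" "tgt C (mult M X) = fob M X"
proof -
  have "nat_trans C C id_ftr M (unit M)" "nat_trans C C (comp_ftr M M) M (mult M)"
    using assms by (simp_all add: is_monad_def)
  from nat_arr[OF this(1) assms(2)] nat_arr[OF this(2) assms(2)]
  show "unit M X \<in> arrs C" "src C (unit M X) = X" "tgt C (unit M X) = fob M X"
    "mult M X \<in> arrs C" "src C (mult M X) = fob M (fob M X)" "tgt C (mult M X) = fob M X"
    by (simp_all add: id_ftr_def comp_ftr_def)
qed

lemma unit_nat:
  assumes "is_monad C M" "f \<in> arrs C" "src C f = X" "tgt C f = Y"
  shows "unit M Y \<cdot> f = far M f \<cdot> unit M X"
  using nat_eq[OF _ assms(2-4), of id_ftr M "unit M"] assms(1) by (simp add: is_monad_def id_ftr_def)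

lemma mult_nat:
  assumes "is_monad C M" "f \<in> arrs C" "src C f = X" "tgt C f = Y"
  shows "mult M Y \<cdot> far M (far M f) = far M f \<cdot> mult M X"
  using nat_eq[OF _ assms(2-4), of "comp_ftr M M" M "mult M"] assms(1) by (simp add: is_monad_def comp_ftr_def)

lemma monad_laws:
  assumes "is_monad C M" "X \<in> obs C"
  shows "mult M X \<cdot> unit M (fob M X) = idn C (fob M X)"
    "mult M X \<cdot> far M (unit M X) = idn C (fob M X)"
    "mult M X \<cdot> far M (mult M X) = mult M X \<cdot> mult M (fob M X)"
  using assms by (simp_all add: is_monad_def)

lemma morphism_nat: "monad_morphism C M N k \<Longrightarrow> nat_trans C C M N k"
  by (simp add: monad_morphism_def)

lemma morphism_laws:
  assumes "monad_morphism C M N k" "X \<in> obs C"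
  shows "k X \<cdot> unit M X = unit N X" "k X \<cdot> mult M X = mult N X \<cdot> far N (k X) \<cdot> k (fob M X)"
  using assms by (simp_all add: monad_morphism_def)

end

context equational_theory
begin

lemma alg_arr:
  assumes "alg B b"
  shows "B \<in> obs C" "b \<in> arrs C" "src C b = fob H B" "tgt C b = B" "b \<cdot> \<eta> B = idn C B"
  using assms by (simp_all add: alg_def)

lemma alg_eq: "alg B b \<Longrightarrow> (G, l, r) \<in> E \<Longrightarrow> b \<cdot> far H b \<cdot> l B = b \<cdot> far H b \<cdot> r B"
  by (auto simp: alg_def)

lemma alg_hom_arr:
  assumes "alg_hom A a B b h"
  shows "h \<in> arrs C" "src C h = A" "tgt C h = B" "h \<cdot> a = b \<cdot> far H h"
  using assms by (simp_all add: alg_hom_def)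

lemma alg_hom_comp:
  assumes "alg A a" "alg B b" "alg D d" "alg_hom A a B b h" "alg_hom B b D d k"
  shows "alg_hom A a D d (k \<cdot> h)"
  unfolding alg_hom_def
  using alg_arr[OF assms(1)] alg_arr[OF assms(2)] alg_arr[OF assms(3)] alg_hom_arr[OF assms(4)]
    alg_hom_arr[OF assms(5)] ext_eq[OF alg_hom_arr(4)[OF assms(5)]]
  by simp

lemma alg_hom_idn: "alg A a \<Longrightarrow> alg_hom A a A a (idn C A)"
  using alg_arr[of A a] by (simp add: alg_hom_def)

lemma free_alg_alg: "free_alg X W i a \<Longrightarrow> alg W a"
  by (simp add: free_alg_def)

lemma free_alg_arr:
  assumes "free_alg X W i a"
  shows "i \<in> arrs C" "src C i = X" "tgt C i = W"
  using assms by (simp_all add: free_alg_def)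

lemma free_alg_ext:
  assumes "free_alg X W i a" "alg B b" "f \<in> arrs C" "src C f = X" "tgt C f = B"
  shows "\<exists>h. alg_hom W a B b h \<and> h \<cdot> i = f"
  using assms unfolding free_alg_def by blast

lemma free_alg_induct:
  fixes \<Phi> :: "('o, 'a, 'o, 'a) ftr"
  assumes "free_alg X W i a" "cocontinuous U C C \<Phi>" "u \<in> arrs C" "v \<in> arrs C"
    "src C u = fob \<Phi> W" "src C v = fob \<Phi> W" "tgt C u = tgt C v" "u \<cdot> far \<Phi> i = v \<cdot> far \<Phi> i"
    "\<And>p. p \<in> arrs C \<Longrightarrow> tgt C p = W \<Longrightarrow> u \<cdot> far \<Phi> p = v \<cdot> far \<Phi> p \<Longrightarrow>
      u \<cdot> far \<Phi> (a \<cdot> far H p) = v \<cdot> far \<Phi> (a \<cdot> far H p)"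
  shows "u = v"
  using assms unfolding free_alg_def by blast

text \<open>Induction with the identity functor: homomorphisms that agree on \<open>p\<close> agree
  on \<open>a \<cdot> far H p\<close>.\<close>

lemma free_alg_unique:
  assumes F: "free_alg X W i a" and B: "alg B b" and h: "alg_hom W a B b h" and k: "alg_hom W a B b k"
    and eq: "h \<cdot> i = k \<cdot> i"
  shows "h = k"
proof (rule free_alg_induct[OF F cocontinuous_id])
  note alg_arr[OF B, simp] alg_hom_arr(1-3)[OF h, simp] alg_hom_arr(1-3)[OF k, simp]
    alg_arr[OF free_alg_alg[OF F], simp]
  fix p assume p [simp]: "p \<in> arrs C" "tgt C p = W" and e: "h \<cdot> far id_ftr p = k \<cdot> far id_ftr p"
  have "far H h \<cdot> far H p = far H k \<cdot> far H p"
    using arg_cong[OF e, of "far H"] by (simp add: id_ftr_def)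
  then show "h \<cdot> far id_ftr (a \<cdot> far H p) = k \<cdot> far id_ftr (a \<cdot> far H p)"
    using ext_eq[OF alg_hom_arr(4)[OF h]] ext_eq[OF alg_hom_arr(4)[OF k]] by (simp add: id_ftr_def)
qed (use eq alg_hom_arr[OF h] alg_hom_arr[OF k] in \<open>simp_all add: id_ftr_def\<close>)

definition chosen :: "'o \<Rightarrow> 'o \<times> 'a \<times> 'a" where
  "chosen X = (SOME (W, i, a). free_alg X W i a)"

definition F_ob :: "'o \<Rightarrow> 'o" where "F_ob X = fst (chosen X)"
definition F_in :: "'o \<Rightarrow> 'a" where "F_in X = fst (snd (chosen X))"
definition F_act :: "'o \<Rightarrow> 'a" where "F_act X = snd (snd (chosen X))"

definition ext :: "'o \<Rightarrow> 'a \<Rightarrow> 'a \<Rightarrow> 'a" where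
  "ext B b f = (SOME h. alg_hom (F_ob (src C f)) (F_act (src C f)) B b h \<and> h \<cdot> F_in (src C f) = f)"

definition FM :: "('o, 'a) monad" where
  "FM = \<lparr>fob = F_ob, far = (\<lambda>f. ext (F_ob (tgt C f)) (F_act (tgt C f)) (F_in (tgt C f) \<cdot> f)),
     unit = F_in, mult = (\<lambda>X. ext (F_ob X) (F_act X) (idn C (F_ob X)))\<rparr>"

text \<open>The terms of depth one, as a transformation from \<open>H\<close> to \<open>FM\<close>.
  It is natural and determines the actions by \<open>F_act_eq\<close>, so that algebras need not be
  mentioned in the universal property of \<open>FM\<close>.\<close>

definition F_ins :: "'o \<Rightarrow> 'a" where
  "F_ins X = F_act X \<cdot> far H (F_in X)"

lemma FM_free: "X \<in> obs C \<Longrightarrow> free_alg X (F_ob X) (F_in X) (F_act X)"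
proof -
  assume "X \<in> obs C"
  then obtain W i a where "free_alg X W i a" by (rule ex_free_alg)
  then have "case (W, i, a) of (W, i, a) \<Rightarrow> free_alg X W i a" by simp
  then have "case chosen X of (W, i, a) \<Rightarrow> free_alg X W i a" unfolding chosen_def by (rule someI)
  then show ?thesis by (simp add: F_ob_def F_in_def F_act_def case_prod_beta)
qed

lemmas F_alg = free_alg_alg[OF FM_free]

lemma F_arr [simp]:
  assumes "X \<in> obs C"
  shows "F_in X \<in> arrs C" "src C (F_in X) = X" "tgt C (F_in X) = F_ob X" "F_ob X \<in> obs C"
    "F_act X \<in> arrs C" "src C (F_act X) = fob H (F_ob X)" "tgt C (F_act X) = F_ob X"
  using free_alg_arr[OF FM_free[OF assms]] alg_arr[OF F_alg[OF assms]] by simp_all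

lemma ext_props:
  assumes "alg B b" "f \<in> arrs C" "src C f = X" "tgt C f = B"
  shows "alg_hom (F_ob X) (F_act X) B b (ext B b f)" "ext B b f \<cdot> F_in X = f"
  using someI_ex[OF free_alg_ext[OF FM_free[of X] assms]] assms src_obs[OF assms(2)]
  by (auto simp: ext_def)

lemma F_unique:
  assumes "X \<in> obs C" "alg B b" "alg_hom (F_ob X) (F_act X) B b h" "alg_hom (F_ob X) (F_act X) B b k"
    "h \<cdot> F_in X = k \<cdot> F_in X"
  shows "h = k"
  using free_alg_unique[OF FM_free[OF assms(1)] assms(2-5)] .

lemma FM_sel [simp]: "fob FM = F_ob" "unit FM = F_in"
  by (simp_all add: FM_def)

lemma F_far:
  assumes "f \<in> arrs C" "src C f = X" "tgt C f = Y"
  shows "alg_hom (F_ob X) (F_act X) (F_ob Y) (F_act Y) (far FM f)" "far FM f \<cdot> F_in X = F_in Y \<cdot> f"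
  using ext_props[OF F_alg[of Y], of "F_in Y \<cdot> f" X] assms tgt_obs[OF assms(1)] by (simp_all add: FM_def)

lemma F_mult:
  assumes "X \<in> obs C"
  shows "alg_hom (F_ob (F_ob X)) (F_act (F_ob X)) (F_ob X) (F_act X) (mult FM X)"
    "mult FM X \<cdot> F_in (F_ob X) = idn C (F_ob X)"
  using ext_props[OF F_alg[OF assms], of "idn C (F_ob X)" "F_ob X"] assms by (simp_all add: FM_def)

lemma F_far_arr [simp]:
  assumes "f \<in> arrs C"
  shows "far FM f \<in> arrs C" "src C (far FM f) = F_ob (src C f)" "tgt C (far FM f) = F_ob (tgt C f)"
  using alg_hom_arr[OF F_far(1)[OF assms refl refl]] by simp_all

lemma F_mult_arr [simp]:
  assumes "X \<in> obs C"
  shows "mult FM X \<in> arrs C" "src C (mult FM X) = F_ob (F_ob X)" "tgt C (mult FM X) = F_ob X"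
  using alg_hom_arr[OF F_mult(1)[OF assms]] by simp_all

text \<open>Here and for the monad laws, the two sides are homomorphisms out of a free algebra that
  agree on its generators.\<close>

lemma functor_FM [simp]: "endo FM"
  unfolding is_functor_def
proof (intro conjI ballI impI)
  fix X assume X: "X \<in> obs C"
  show "far FM (idn C X) = idn C (fob FM X)"
    by (rule F_unique[OF X F_alg[OF X]]) (use X F_far[of "idn C X" X X] alg_hom_idn[OF F_alg[OF X]] in simp_all)
next
  fix f g assume fg: "f \<in> arrs C" "g \<in> arrs C" "tgt C f = src C g"
  show "far FM (g \<cdot> f) = far FM g \<cdot> far FM f"
  proof (rule F_unique[of "src C f" "F_ob (tgt C g)" "F_act (tgt C g)"])
    show "alg_hom (F_ob (src C f)) (F_act (src C f)) (F_ob (tgt C g)) (F_act (tgt C g)) (far FM (g \<cdot> f))"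
      using fg by (intro F_far) simp_all
    show "alg_hom (F_ob (src C f)) (F_act (src C f)) (F_ob (tgt C g)) (F_act (tgt C g)) (far FM g \<cdot> far FM f)"
      using fg by (intro alg_hom_comp[OF F_alg F_alg[of "src C g"] F_alg] F_far) simp_all
    show "far FM (g \<cdot> f) \<cdot> F_in (src C f) = (far FM g \<cdot> far FM f) \<cdot> F_in (src C f)"
      using fg F_far(2)[of f "src C f" "src C g"] F_far(2)[of "g \<cdot> f" "src C f" "tgt C g"]
        F_far(2)[of g "src C g" "tgt C g"] ext_eq[OF F_far(2)[of g "src C g" "tgt C g"]] by simp
  qed (use fg F_alg in simp_all)
qed simp_all

lemma is_monad_FM: "is_monad C FM"
  unfolding is_monad_def nat_trans_def
proof (intro conjI ballI)
  fix X assume X [simp]: "X \<in> obs C"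
  note A = F_alg[OF X] and A2 = F_alg[of "F_ob X", simplified]
  show "mult FM X \<cdot> unit FM (fob FM X) = idn C (fob FM X)" using F_mult(2)[OF X] by simp
  have "mult FM X \<cdot> far FM (F_in X) = idn C (F_ob X)"
  proof (rule F_unique[OF X A _ alg_hom_idn[OF A]])
    show "alg_hom (F_ob X) (F_act X) (F_ob X) (F_act X) (mult FM X \<cdot> far FM (F_in X))"
      using F_mult(1)[OF X] F_far(1)[of "F_in X" X "F_ob X"] by (intro alg_hom_comp[OF A A2 A]) simp_all
    show "(mult FM X \<cdot> far FM (F_in X)) \<cdot> F_in X = idn C (F_ob X) \<cdot> F_in X"
      using F_far(2)[of "F_in X" X "F_ob X"] ext_eq[OF F_mult(2)[OF X]] by simp
  qed
  then show "mult FM X \<cdot> far FM (unit FM X) = idn C (fob FM X)" by simp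
  have A3: "alg (F_ob (F_ob (F_ob X))) (F_act (F_ob (F_ob X)))" using F_alg[of "F_ob (F_ob X)"] by simp
  show "mult FM X \<cdot> far FM (mult FM X) = mult FM X \<cdot> mult FM (fob FM X)"
  proof (rule F_unique[OF _ A])
    show "alg_hom (F_ob (F_ob (F_ob X))) (F_act (F_ob (F_ob X))) (F_ob X) (F_act X) (mult FM X \<cdot> far FM (mult FM X))"
      using F_mult(1)[OF X] F_far(1)[of "mult FM X"] by (intro alg_hom_comp[OF A3 A2 A]) simp_all
    show "alg_hom (F_ob (F_ob (F_ob X))) (F_act (F_ob (F_ob X))) (F_ob X) (F_act X) (mult FM X \<cdot> mult FM (fob FM X))"
      using F_mult(1)[OF X] F_mult(1)[of "F_ob X"] by (intro alg_hom_comp[OF A3 A2 A]) simp_all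
    show "(mult FM X \<cdot> far FM (mult FM X)) \<cdot> F_in (F_ob (F_ob X)) =
        (mult FM X \<cdot> mult FM (fob FM X)) \<cdot> F_in (F_ob (F_ob X))"
      using F_far(2)[of "mult FM X" "F_ob (F_ob X)" "F_ob X"] F_mult(2)[of "F_ob X"] ext_eq[OF F_mult(2)[OF X]] by simp
  qed simp
next
  fix f assume f [simp]: "f \<in> arrs C"
  show "unit FM (tgt C f) \<cdot> far id_ftr f = far FM f \<cdot> unit FM (src C f)"
    using F_far(2)[OF f refl refl] by (simp add: id_ftr_def)
  have "mult FM (tgt C f) \<cdot> far FM (far FM f) = far FM f \<cdot> mult FM (src C f)"
  proof (rule F_unique[of "F_ob (src C f)" "F_ob (tgt C f)" "F_act (tgt C f)"])
    show "alg_hom (F_ob (F_ob (src C f))) (F_act (F_ob (src C f))) (F_ob (tgt C f)) (F_act (tgt C f))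
        (mult FM (tgt C f) \<cdot> far FM (far FM f))"
      using F_mult(1)[of "tgt C f"] F_far(1)[of "far FM f"]
      by (intro alg_hom_comp[OF F_alg F_alg[of "F_ob (tgt C f)"] F_alg]) simp_all
    show "alg_hom (F_ob (F_ob (src C f))) (F_act (F_ob (src C f))) (F_ob (tgt C f)) (F_act (tgt C f))
        (far FM f \<cdot> mult FM (src C f))"
      using F_mult(1)[of "src C f"] F_far(1)[of f]
      by (intro alg_hom_comp[OF F_alg F_alg[of "src C f"] F_alg]) simp_all
    show "(mult FM (tgt C f) \<cdot> far FM (far FM f)) \<cdot> F_in (F_ob (src C f)) =
        (far FM f \<cdot> mult FM (src C f)) \<cdot> F_in (F_ob (src C f))"
      using F_far(2)[of "far FM f" "F_ob (src C f)" "F_ob (tgt C f)"] F_mult(2)[of "src C f"]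
        ext_eq[OF F_mult(2)[of "tgt C f"]] by simp
  qed (simp_all add: F_alg)
  then show "mult FM (tgt C f) \<cdot> far (comp_ftr FM FM) f = far FM f \<cdot> mult FM (src C f)"
    by (simp add: comp_ftr_def)
qed (simp_all add: id_ftr_def comp_ftr_def)

lemma F_ins_arr [simp]:
  assumes "X \<in> obs C"
  shows "F_ins X \<in> arrs C" "src C (F_ins X) = fob H X" "tgt C (F_ins X) = F_ob X"
  using assms by (simp_all add: F_ins_def)

lemma F_act_eq: "X \<in> obs C \<Longrightarrow> mult FM X \<cdot> F_ins (F_ob X) = F_act X"
  using ext_eq[OF alg_hom_arr(4)[OF F_mult(1)[of X]], of "far H (F_in (F_ob X))"]
    arg_cong[OF F_mult(2)[of X], of "far H"]
  by (simp add: F_ins_def)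

lemma F_ins_nat: "nat_trans C C H FM F_ins"
  unfolding nat_trans_def
proof (intro conjI ballI)
  fix f assume f [simp]: "f \<in> arrs C"
  have "far H (far FM f) \<cdot> far H (F_in (src C f)) = far H (F_in (tgt C f)) \<cdot> far H f"
    using arg_cong[OF F_far(2)[OF f refl refl], of "far H"] by simp
  then show "F_ins (tgt C f) \<cdot> far H f = far FM f \<cdot> F_ins (src C f)"
    using ext_eq[OF alg_hom_arr(4)[OF F_far(1)[OF f refl refl]]] by (simp add: F_ins_def)
qed simp_all

lemma F_ins_unit: "X \<in> obs C \<Longrightarrow> F_ins X \<cdot> \<eta> X = F_in X"
  using ext_eq[OF alg_arr(5)[OF F_alg[of X]], of "F_in X"] \<eta>_nat[of "F_in X" X "F_ob X"]
  by (simp add: F_ins_def)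

text \<open>The colimit \<open>Y\<close> of the free algebras on the diagram is itself an algebra:
  \<open>H\<close> preserves it, and the arities keep its legs jointly epic. Hence there is a
  homomorphism \<open>t\<close> from the free algebra on \<open>A\<close> to \<open>Y\<close>,
  besides the comparison \<open>s\<close> in the other direction. The induced arrow of a cocone is
  \<open>h \<cdot> t\<close>; it is unique because any candidate \<open>k\<close> satisfies
  \<open>k \<cdot> s = h\<close> and \<open>t\<close> is a section of \<open>s\<close>.\<close>

lemma finitary_FM: "finitary U C C FM"
  unfolding finitary_def
proof (intro conjI allI impI, simp, elim conjE)
  fix J :: "('u, 'u) cat" and D A c
  assume J: "small_category U J" "filtered J" and A: "is_colimit J C D A c"
  have cJ: "category J" using J by (simp add: small_category_def)
  have Jobs [simp]: "src J w \<in> obs J" "tgt J w \<in> obs J" if "w \<in> arrs J" for w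
    using cJ that by (auto simp: category_def)
  have D: "is_functor J C D" using A by (simp add: is_colimit_def cocone_def)
  note diagram_arr[OF D, simp] colimit_arr[OF A, simp] colimit_obs[OF A, simp]
  have Dobs [simp]: "fob D i \<in> obs C" if "i \<in> obs J" for i using D that by (simp add: is_functor_def)
  have cD: "c (tgt J w) \<cdot> far D w = c (src J w)" if "w \<in> arrs J" for w
    using A that by (simp add: is_colimit_def cocone_def)
  have FD: "is_functor J C (comp_ftr FM D)"
    using D unfolding is_functor_def by (auto simp: comp_ftr_def)
  have cocF: "cocone J C (comp_ftr FM D) (F_ob A) (\<lambda>i. far FM (c i))"
    unfolding cocone_def
    using FD cD by (simp add: comp_ftr_def flip: far_comp)
  obtain Y y where Y: "is_colimit J C (comp_ftr FM D) Y y"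
    using cocomplete FD J(1) unfolding cocomplete_def by blast
  have y [simp]: "y i \<in> arrs C" "src C (y i) = F_ob (fob D i)" "tgt C (y i) = Y" if "i \<in> obs J" for i
    using colimit_arr[OF Y that] by (simp_all add: comp_ftr_def)
  note colimit_obs[OF Y, simp]
  have yD: "y (tgt J w) \<cdot> far FM (far D w) = y (src J w)" if "w \<in> arrs J" for w
    using Y that by (simp add: is_colimit_def cocone_def comp_ftr_def)
  have HY: "is_colimit J C (comp_ftr H (comp_ftr FM D)) (fob H Y) (\<lambda>i. far H (y i))"
    using finitary_H J Y unfolding finitary_def by blast
  have "cocone J C (comp_ftr H (comp_ftr FM D)) Y (\<lambda>i. y i \<cdot> F_act (fob D i))"
    unfolding cocone_def
  proof (intro conjI ballI)
    show "is_functor J C (comp_ftr H (comp_ftr FM D))" using HY by (simp add: is_colimit_def cocone_def)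
    show "(y (tgt J w) \<cdot> F_act (fob D (tgt J w))) \<cdot> far (comp_ftr H (comp_ftr FM D)) w = y (src J w) \<cdot> F_act (fob D (src J w))"
      if "w \<in> arrs J" for w
      using that alg_hom_arr(4)[OF F_far(1)[of "far D w" "fob D (src J w)" "fob D (tgt J w)"], symmetric]
        ext_eq[OF yD[OF that]]
      by (simp add: comp_ftr_def)
  qed (simp_all add: comp_ftr_def)
  then obtain b where b [simp]: "b \<in> arrs C" "src C b = fob H Y" "tgt C b = Y"
    and b_y: "\<And>i. i \<in> obs J \<Longrightarrow> b \<cdot> far H (y i) = y i \<cdot> F_act (fob D i)"
    by (rule colimit_ex[OF HY]) blast
  have H_epi: "u = v" if "u \<in> arrs C" "v \<in> arrs C" "src C u = fob H Y" "src C v = fob H Y" "tgt C u = tgt C v"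
    "\<And>i. i \<in> obs J \<Longrightarrow> u \<cdot> far H (y i) = v \<cdot> far H (y i)" for u v
    using colimit_epi[OF cJ HY that] .
  have Yb: "alg Y b"
    unfolding alg_def
  proof (intro conjI ballI)
    show "b \<cdot> \<eta> Y = idn C Y"
    proof (rule colimit_epi[OF cJ Y])
      fix i assume i [simp]: "i \<in> obs J"
      show "(b \<cdot> \<eta> Y) \<cdot> y i = idn C Y \<cdot> y i"
        using \<eta>_nat[OF y[OF i]] ext_eq[OF b_y[OF i], of "\<eta> (F_ob (fob D i))"] alg_arr(5)[OF F_alg[OF Dobs[OF i]]] by simp
    qed simp_all
  next
    fix t assume "t \<in> E"
    moreover obtain G l r where t: "t = (G, l, r)" by (cases t)
    ultimately have e: "(G, l, r) \<in> E" by simp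
    note E_functor[OF e, simp] E_arr[OF e, simp]
    have "b \<cdot> far H b \<cdot> l Y = b \<cdot> far H b \<cdot> r Y"
    proof (rule jointly_epi_preserving_D[OF E_epi[OF e] J Y])
      fix i assume i [simp]: "i \<in> obs J"
      have Hb: "far H b \<cdot> far H (far H (y i)) = far H (y i) \<cdot> far H (F_act (fob D i))"
        using arg_cong[OF b_y[OF i], of "far H"] by simp
      have *: "b \<cdot> far H b \<cdot> far H (far H (y i)) \<cdot> z = y i \<cdot> F_act (fob D i) \<cdot> far H (F_act (fob D i)) \<cdot> z"
        if "z \<in> arrs C" "tgt C z = fob H (fob H (F_ob (fob D i)))" for z
        using that ext_eq[OF Hb, of z] ext_eq[OF b_y[OF i]] by simp
      show "(b \<cdot> far H b \<cdot> l Y) \<cdot> far G (y i) = (b \<cdot> far H b \<cdot> r Y) \<cdot> far G (y i)"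
        using E_natural[OF e y[OF i]] * alg_eq[OF F_alg[OF Dobs[OF i]] e] by simp
    qed simp_all
    then show "case t of (G, l, r) \<Rightarrow> b \<cdot> far H b \<cdot> l Y = b \<cdot> far H b \<cdot> r Y" by (simp add: t)
  qed simp_all
  have y_hom: "alg_hom (F_ob (fob D i)) (F_act (fob D i)) Y b (y i)" if "i \<in> obs J" for i
    using that b_y[OF that] by (simp add: alg_hom_def)
  have "cocone J C D Y (\<lambda>i. y i \<cdot> F_in (fob D i))"
    unfolding cocone_def
    using D F_far(2)[of "far D w" "fob D (src J w)" "fob D (tgt J w)" for w] ext_eq[OF yD]
    by (simp flip: F_far(2))
  then obtain f where f [simp]: "f \<in> arrs C" "src C f = A" "tgt C f = Y"
    and fc: "\<And>i. i \<in> obs J \<Longrightarrow> f \<cdot> c i = y i \<cdot> F_in (fob D i)"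
    by (rule colimit_ex[OF A]) blast
  obtain t where t: "alg_hom (F_ob A) (F_act A) Y b t" "t \<cdot> F_in A = f"
    using ext_props[OF Yb f] by blast
  note alg_hom_arr(1-3)[OF t(1), simp]
  obtain s where s [simp]: "s \<in> arrs C" "src C s = Y" "tgt C s = F_ob A"
    and sy: "\<And>i. i \<in> obs J \<Longrightarrow> s \<cdot> y i = far FM (c i)"
    by (rule colimit_ex[OF Y cocF]) blast
  have tc: "t \<cdot> far FM (c i) = y i" if i [simp]: "i \<in> obs J" for i
  proof (rule F_unique[OF Dobs[OF i] Yb _ y_hom[OF i]])
    show "alg_hom (F_ob (fob D i)) (F_act (fob D i)) Y b (t \<cdot> far FM (c i))"
      by (rule alg_hom_comp[OF F_alg F_alg Yb F_far(1) t(1)]) simp_all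
    show "(t \<cdot> far FM (c i)) \<cdot> F_in (fob D i) = y i \<cdot> F_in (fob D i)"
      using F_far(2)[of "c i" "fob D i" A] fc[OF i] ext_eq[OF t(2)] by simp
  qed
  have s_hom: "alg_hom Y b (F_ob A) (F_act A) s"
    unfolding alg_hom_def
  proof (intro conjI)
    show "s \<cdot> b = F_act A \<cdot> far H s"
    proof (rule H_epi)
      fix i assume i [simp]: "i \<in> obs J"
      have "far H s \<cdot> far H (y i) = far H (far FM (c i))"
        using arg_cong[OF sy[OF i], of "far H"] by simp
      then show "(s \<cdot> b) \<cdot> far H (y i) = (F_act A \<cdot> far H s) \<cdot> far H (y i)"
        using b_y[OF i] ext_eq[OF sy[OF i]] alg_hom_arr(4)[OF F_far(1)[of "c i" "fob D i" A]] by simp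
    qed simp_all
  qed simp_all
  have sf: "s \<cdot> f = F_in A"
  proof (rule colimit_epi[OF cJ A])
    fix i assume i [simp]: "i \<in> obs J"
    show "(s \<cdot> f) \<cdot> c i = F_in A \<cdot> c i"
      using fc[OF i] ext_eq[OF sy[OF i]] F_far(2)[of "c i" "fob D i" A] by simp
  qed simp_all
  have st: "s \<cdot> t = idn C (F_ob A)"
  proof (rule F_unique[OF _ F_alg _ alg_hom_idn[OF F_alg]])
    show "alg_hom (F_ob A) (F_act A) (F_ob A) (F_act A) (s \<cdot> t)"
      by (rule alg_hom_comp[OF F_alg Yb F_alg t(1) s_hom]) simp_all
    show "(s \<cdot> t) \<cdot> F_in A = idn C (F_ob A) \<cdot> F_in A"
      using t(2) sf by simp
  qed simp_all
  have "\<exists>!h. h \<in> hom C (F_ob A) B \<and> (\<forall>i\<in>obs J. h \<cdot> far FM (c i) = e i)"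
    if e: "cocone J C (comp_ftr FM D) B e" for B e
  proof -
    obtain h where h [simp]: "h \<in> arrs C" "src C h = Y" "tgt C h = B"
      and hy: "\<And>i. i \<in> obs J \<Longrightarrow> h \<cdot> y i = e i"
      by (rule colimit_ex[OF Y e]) blast
    have 1: "h \<cdot> t \<in> hom C (F_ob A) B \<and> (\<forall>i\<in>obs J. (h \<cdot> t) \<cdot> far FM (c i) = e i)"
      using hy tc by simp
    have 2: "k = h \<cdot> t" if k: "k \<in> hom C (F_ob A) B \<and> (\<forall>i\<in>obs J. k \<cdot> far FM (c i) = e i)" for k
    proof -
      have "k \<cdot> s = h"
      proof (rule colimit_epi[OF cJ Y])
        fix i assume i [simp]: "i \<in> obs J"
        show "(k \<cdot> s) \<cdot> y i = h \<cdot> y i" using k hy[OF i] sy[OF i] by simp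
      qed (use k in simp_all)
      then have "h \<cdot> t = k \<cdot> s \<cdot> t" using k by auto
      then show ?thesis using k st by simp
    qed
    show ?thesis using 1 2 by blast
  qed
  then show "is_colimit J C (comp_ftr FM D) (fob FM A) (\<lambda>i. far FM (c i))"
    unfolding is_colimit_def using cocF by simp
qed

section \<open>Monad morphisms out of the monad of free algebras\<close>

context
  fixes N :: "('o, 'a) monad" and \<beta>
  assumes N [simp]: "is_monad C N" and \<beta>: "nat_trans C C H N \<beta>"
    and \<beta>\<eta>: "\<And>X. X \<in> obs C \<Longrightarrow> \<beta> X \<cdot> \<eta> X = unit N X"
begin

lemma \<beta>_arr [simp]:
  "X \<in> obs C \<Longrightarrow> \<beta> X \<in> arrs C" "X \<in> obs C \<Longrightarrow> src C (\<beta> X) = fob H X" "X \<in> obs C \<Longrightarrow> tgt C (\<beta> X) = fob N X"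
  using nat_arr[OF \<beta>] by simp_all

context
  assumes \<beta>E: "\<And>G l r X. (G, l, r) \<in> E \<Longrightarrow> X \<in> obs C \<Longrightarrow>
    mult N X \<cdot> far N (\<beta> X) \<cdot> \<beta> (fob H X) \<cdot> l X = mult N X \<cdot> far N (\<beta> X) \<cdot> \<beta> (fob H X) \<cdot> r X"
begin

text \<open>The free \<open>N\<close>-algebra, restricted along \<open>\<beta>\<close>. Evaluating a
  term of depth two amounts to composing \<open>\<beta>\<close> with itself and multiplying, so the
  assumption \<open>\<beta>E\<close> at \<open>fob N X\<close> yields the equations.\<close>

lemma N_alg:
  assumes X [simp]: "X \<in> obs C"
  shows "alg (fob N X) (mult N X \<cdot> \<beta> (fob N X))"
  unfolding alg_def
proof (intro conjI ballI)
  show "(mult N X \<cdot> \<beta> (fob N X)) \<cdot> \<eta> (fob N X) = idn C (fob N X)"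
    using \<beta>\<eta>[of "fob N X"] monad_laws(1)[OF N X] by simp
next
  fix t assume "t \<in> E"
  moreover obtain G l r where t: "t = (G, l, r)" by (cases t)
  ultimately have e: "(G, l, r) \<in> E" by simp
  note E_functor[OF e, simp] E_arr[OF e, simp]
  let ?b = "mult N X \<cdot> \<beta> (fob N X)"
  have *: "?b \<cdot> far H ?b \<cdot> z = mult N X \<cdot> mult N (fob N X) \<cdot> far N (\<beta> (fob N X)) \<cdot> \<beta> (fob H (fob N X)) \<cdot> z"
    if "z \<in> arrs C" "tgt C z = fob H (fob H (fob N X))" for z
    using that ext_eq[OF nat_eq[OF \<beta>, of ?b "fob H (fob N X)" "fob N X"], of z]
      ext_eq[OF monad_laws(3)[OF N X]] by simp
  have "?b \<cdot> far H ?b \<cdot> l (fob N X) = ?b \<cdot> far H ?b \<cdot> r (fob N X)"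
    using \<beta>E[OF e, of "fob N X"] by (simp only: * E_arr[OF e] fob_obs monad_functor N X)
  then show "case t of (G, l, r) \<Rightarrow> ?b \<cdot> far H ?b \<cdot> l (fob N X) = ?b \<cdot> far H ?b \<cdot> r (fob N X)" by (simp add: t)
qed simp_all

lemma N_far_hom:
  assumes [simp]: "f \<in> arrs C" "src C f = X" "tgt C f = Y"
  shows "alg_hom (fob N X) (mult N X \<cdot> \<beta> (fob N X)) (fob N Y) (mult N Y \<cdot> \<beta> (fob N Y)) (far N f)"
proof -
  have [simp]: "X \<in> obs C" "Y \<in> obs C" using assms src_obs tgt_obs by blast+
  show ?thesis
    using ext_eq[OF mult_nat[OF N assms]] nat_eq[OF \<beta>, of "far N f"] by (simp add: alg_hom_def)
qed

lemma N_mult_hom: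
  assumes X [simp]: "X \<in> obs C"
  shows "alg_hom (fob N (fob N X)) (mult N (fob N X) \<cdot> \<beta> (fob N (fob N X))) (fob N X) (mult N X \<cdot> \<beta> (fob N X)) (mult N X)"
  using nat_eq[OF \<beta>, of "mult N X"] ext_eq[OF monad_laws(3)[OF N X]] by (simp add: alg_hom_def)

text \<open>\<open>k X\<close> extends \<open>unit N X\<close> to a homomorphism into the restricted
  free \<open>N\<close>-algebra. Naturality and compatibility with multiplication are again
  equalities of homomorphisms that agree on generators.\<close>

lemma ex_F_morphism: "\<exists>k. monad_morphism C FM N k \<and> (\<forall>X\<in>obs C. k X \<cdot> F_ins X = \<beta> X)"
proof -
  define k where "k X = ext (fob N X) (mult N X \<cdot> \<beta> (fob N X)) (unit N X)" for X
  have k: "alg_hom (F_ob X) (F_act X) (fob N X) (mult N X \<cdot> \<beta> (fob N X)) (k X)" "k X \<cdot> F_in X = unit N X"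
    if "X \<in> obs C" for X
    using ext_props[OF N_alg[OF that], of "unit N X" X] that by (simp_all add: k_def)
  have ka [simp]: "k X \<in> arrs C" "src C (k X) = F_ob X" "tgt C (k X) = fob N X" if "X \<in> obs C" for X
    using alg_hom_arr[OF k(1)[OF that]] by simp_all
  have "nat_trans C C FM N k"
    unfolding nat_trans_def
  proof (intro conjI ballI)
    fix f assume f [simp]: "f \<in> arrs C"
    let ?X = "src C f" and ?Y = "tgt C f"
    show "k ?Y \<cdot> far FM f = far N f \<cdot> k ?X"
    proof (rule F_unique[OF _ N_alg[of ?Y]])
      show "alg_hom (F_ob ?X) (F_act ?X) (fob N ?Y) (mult N ?Y \<cdot> \<beta> (fob N ?Y)) (k ?Y \<cdot> far FM f)"
        by (rule alg_hom_comp[OF F_alg F_alg N_alg F_far(1) k(1)]) simp_all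
      show "alg_hom (F_ob ?X) (F_act ?X) (fob N ?Y) (mult N ?Y \<cdot> \<beta> (fob N ?Y)) (far N f \<cdot> k ?X)"
        by (rule alg_hom_comp[OF F_alg N_alg N_alg k(1) N_far_hom]) simp_all
      show "(k ?Y \<cdot> far FM f) \<cdot> F_in ?X = (far N f \<cdot> k ?X) \<cdot> F_in ?X"
        using F_far(2)[OF f refl refl] ext_eq[OF k(2)[of ?Y], of f] k(2)[of ?X] unit_nat[OF N f refl refl] by simp
    qed simp_all
  qed simp_all
  moreover have "k X \<cdot> mult FM X = mult N X \<cdot> far N (k X) \<cdot> k (F_ob X)" if X [simp]: "X \<in> obs C" for X
  proof (rule F_unique[OF _ N_alg[OF X]])
    show "alg_hom (F_ob (F_ob X)) (F_act (F_ob X)) (fob N X) (mult N X \<cdot> \<beta> (fob N X)) (k X \<cdot> mult FM X)"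
      by (rule alg_hom_comp[OF F_alg F_alg N_alg F_mult(1) k(1)]) simp_all
    show "alg_hom (F_ob (F_ob X)) (F_act (F_ob X)) (fob N X) (mult N X \<cdot> \<beta> (fob N X)) (mult N X \<cdot> far N (k X) \<cdot> k (F_ob X))"
      by (rule alg_hom_comp[OF F_alg N_alg N_alg alg_hom_comp[OF F_alg N_alg N_alg k(1) N_far_hom] N_mult_hom]) simp_all
    show "(k X \<cdot> mult FM X) \<cdot> F_in (F_ob X) = (mult N X \<cdot> far N (k X) \<cdot> k (F_ob X)) \<cdot> F_in (F_ob X)"
      using F_mult(2)[OF X] k(2)[of "F_ob X"] unit_nat[OF N, of "k X"] ext_eq[OF monad_laws(1)[OF N X], of "k X"] by simp
  qed simp
  ultimately have "monad_morphism C FM N k"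
    by (simp add: monad_morphism_def k(2))
  moreover have "k X \<cdot> F_ins X = \<beta> X" if X [simp]: "X \<in> obs C" for X
  proof -
    have "k X \<cdot> F_ins X = mult N X \<cdot> \<beta> (fob N X) \<cdot> far H (unit N X)"
      using ext_eq[OF alg_hom_arr(4)[OF k(1)[OF X]], of "far H (F_in X)"] arg_cong[OF k(2)[OF X], of "far H"]
      by (simp add: F_ins_def)
    also have "\<dots> = \<beta> X"
      using nat_eq[OF \<beta>, of "unit N X"] ext_eq[OF monad_laws(2)[OF N X], of "\<beta> X"] by simp
    finally show ?thesis .
  qed
  ultimately show ?thesis by blast
qed

end

end

text \<open>The interface to the construction. Only existence of \<open>k\<close> is recorded: in
  both applications the uniqueness required comes from the universal property of the monad that is
  compared with \<open>F\<close>.\<close>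

theorem free_algebra_monad:
  obtains F \<zeta> where "finitary_monad U C F" "nat_trans C C H F \<zeta>"
    "\<And>X. X \<in> obs C \<Longrightarrow> \<zeta> X \<cdot> \<eta> X = unit F X"
    "\<And>X. X \<in> obs C \<Longrightarrow> free_alg X (fob F X) (unit F X) (mult F X \<cdot> \<zeta> (fob F X))"
    "\<And>N \<beta>. is_monad C N \<Longrightarrow> nat_trans C C H N \<beta> \<Longrightarrow> (\<And>X. X \<in> obs C \<Longrightarrow> \<beta> X \<cdot> \<eta> X = unit N X) \<Longrightarrow>
       (\<And>G l r X. (G, l, r) \<in> E \<Longrightarrow> X \<in> obs C \<Longrightarrow>
          mult N X \<cdot> far N (\<beta> X) \<cdot> \<beta> (fob H X) \<cdot> l X = mult N X \<cdot> far N (\<beta> X) \<cdot> \<beta> (fob H X) \<cdot> r X) \<Longrightarrow>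
       \<exists>k. monad_morphism C F N k \<and> (\<forall>X\<in>obs C. k X \<cdot> \<zeta> X = \<beta> X)"
proof (rule that[of FM F_ins])
  show "finitary_monad U C FM" using is_monad_FM finitary_FM by (simp add: finitary_monad_def)
  show "free_alg X (fob FM X) (unit FM X) (mult FM X \<cdot> F_ins (fob FM X))" if "X \<in> obs C" for X
    using FM_free[OF that] F_act_eq[OF that] by simp
  show "F_ins X \<cdot> \<eta> X = unit FM X" if "X \<in> obs C" for X using F_ins_unit[OF that] by simp
  show "\<exists>k. monad_morphism C FM N k \<and> (\<forall>X\<in>obs C. k X \<cdot> F_ins X = \<beta> X)"
    if "is_monad C N" "nat_trans C C H N \<beta>" "\<And>X. X \<in> obs C \<Longrightarrow> \<beta> X \<cdot> \<eta> X = unit N X"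
      "\<And>G l r X. (G, l, r) \<in> E \<Longrightarrow> X \<in> obs C \<Longrightarrow>
        mult N X \<cdot> far N (\<beta> X) \<cdot> \<beta> (fob H X) \<cdot> l X = mult N X \<cdot> far N (\<beta> X) \<cdot> \<beta> (fob H X) \<cdot> r X" for N \<beta>
    using that by (rule ex_F_morphism)
qed (rule F_ins_nat)

end

section \<open>Free monads on finitary endofunctors\<close>

context base_cat
begin

lemma natI:
  assumes "\<And>X. X \<in> obs C \<Longrightarrow> \<alpha> X \<in> arrs C \<and> src C (\<alpha> X) = fob F X \<and> tgt C (\<alpha> X) = fob G X"
    "\<And>f X Y. f \<in> arrs C \<Longrightarrow> src C f = X \<Longrightarrow> tgt C f = Y \<Longrightarrow> X \<in> obs C \<Longrightarrow> Y \<in> obs C \<Longrightarrow>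
      \<alpha> Y \<cdot> far F f = far G f \<cdot> \<alpha> X"
  shows "nat_trans C C F G \<alpha>"
  using assms by (simp add: nat_trans_def)

lemma morphism_comp:
  assumes M: "is_monad C M" and N: "is_monad C N" and K: "is_monad C K"
    and h: "monad_morphism C M N h" and k: "monad_morphism C N K k"
  shows "monad_morphism C M K (\<lambda>X. k X \<cdot> h X)"
proof -
  note nat_arr[OF morphism_nat[OF h], simp] nat_arr[OF morphism_nat[OF k], simp] M [simp] N [simp] K [simp]
  have "nat_trans C C M K (\<lambda>X. k X \<cdot> h X)"
  proof (rule natI)
    fix f X Y assume f [simp]: "f \<in> arrs C" "src C f = X" "tgt C f = Y" "X \<in> obs C" "Y \<in> obs C"
    show "(k Y \<cdot> h Y) \<cdot> far M f = far K f \<cdot> k X \<cdot> h X"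
      using nat_eq[OF morphism_nat[OF h] f(1-3)] ext_eq[OF nat_eq[OF morphism_nat[OF k] f(1-3)]] by simp
  qed simp_all
  moreover have "(k X \<cdot> h X) \<cdot> unit M X = unit K X" if [simp]: "X \<in> obs C" for X
    using morphism_laws(1)[OF h] morphism_laws(1)[OF k] by simp
  moreover have "(k X \<cdot> h X) \<cdot> mult M X = mult K X \<cdot> far K (k X \<cdot> h X) \<cdot> k (fob M X) \<cdot> h (fob M X)"
    if X [simp]: "X \<in> obs C" for X
    using morphism_laws(2)[OF h X] ext_eq[OF morphism_laws(2)[OF k X], of "far N (h X) \<cdot> h (fob M X)"]
      ext_eq[OF nat_eq[OF morphism_nat[OF k], of "h X" "fob M X" "fob N X"]] by simp
  ultimately show ?thesis by (simp add: monad_morphism_def)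
qed

lemma morphism_idn: "is_monad C M \<Longrightarrow> monad_morphism C M M (\<lambda>X. idn C (fob M X))"
  by (simp add: monad_morphism_def nat_trans_def)

end

context colim_cat
begin

lemma finitary_comp:
  assumes "finitary U C C F" "finitary U C C G"
  shows "finitary U C C (comp_ftr F G)"
proof -
  have "comp_ftr (comp_ftr F G) D = comp_ftr F (comp_ftr G D)" for D :: "('u, 'u, 'o, 'a) ftr"
    by (simp add: comp_ftr_def comp_assoc)
  moreover have "endo (comp_ftr F G)" using assms by (simp add: finitary_def endo_comp)
  ultimately show ?thesis
    using assms unfolding finitary_def by (auto simp: comp_ftr_def[of F G])
qed

text \<open>A cocone on the diagram under \<open>S\<close> becomes one under \<open>F\<close> by
  precomposing with the retraction \<open>k'\<close>; the arrow it induces, precomposed with the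
  section \<open>k\<close>, is the factorisation sought.\<close>

lemma finitary_retract:
  assumes S: "endo S" and F: "finitary U C C F" and k: "nat_trans C C S F k" and k': "nat_trans C C F S k'"
    and inv: "\<And>X. X \<in> obs C \<Longrightarrow> k' X \<cdot> k X = idn C (fob S X)"
  shows "finitary U C C S"
  unfolding finitary_def
proof (intro conjI allI impI, rule S, elim conjE)
  fix J :: "('u, 'u) cat" and D A c
  assume J: "small_category U J" "filtered J" and A: "is_colimit J C D A c"
  note S [simp] nat_arr[OF k, simp] nat_arr[OF k', simp] finitary_functor[OF F, simp]
  have cJ: "category J" using J by (simp add: small_category_def)
  have Jobs [simp]: "src J w \<in> obs J" "tgt J w \<in> obs J" if "w \<in> arrs J" for w
    using cJ that by (auto simp: category_def)
  have D: "is_functor J C D" using A by (simp add: is_colimit_def cocone_def)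
  note diagram_arr[OF D, simp] colimit_arr[OF A, simp] colimit_obs[OF A, simp]
  have Dobs [simp]: "fob D i \<in> obs C" if "i \<in> obs J" for i using D that by (simp add: is_functor_def)
  have cD: "c (tgt J w) \<cdot> far D w = c (src J w)" if "w \<in> arrs J" for w
    using A that by (simp add: is_colimit_def cocone_def)
  have FA: "is_colimit J C (comp_ftr F D) (fob F A) (\<lambda>i. far F (c i))"
    using F J A unfolding finitary_def by blast
  have SD: "is_functor J C (comp_ftr S D)"
    using D unfolding is_functor_def by (auto simp: comp_ftr_def)
  have cocS: "cocone J C (comp_ftr S D) (fob S A) (\<lambda>i. far S (c i))"
    unfolding cocone_def using SD cD by (simp add: comp_ftr_def flip: far_comp)
  have "\<exists>!h. h \<in> hom C (fob S A) B \<and> (\<forall>i\<in>obs J. h \<cdot> far S (c i) = e i)"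
    if e: "cocone J C (comp_ftr S D) B e" for B e
  proof -
    have ea [simp]: "e i \<in> arrs C" "src C (e i) = fob S (fob D i)" "tgt C (e i) = B" if "i \<in> obs J" for i
      using cocone_arr[OF e that] by (simp_all add: comp_ftr_def)
    have eD: "e (tgt J w) \<cdot> far S (far D w) = e (src J w)" if "w \<in> arrs J" for w
      using e that by (simp add: cocone_def comp_ftr_def)
    have "cocone J C (comp_ftr F D) B (\<lambda>i. e i \<cdot> k' (fob D i))"
      unfolding cocone_def
    proof (intro conjI ballI)
      show "is_functor J C (comp_ftr F D)" using FA by (simp add: is_colimit_def cocone_def)
      show "B \<in> obs C" using e by (simp add: cocone_def)
      show "(e (tgt J w) \<cdot> k' (fob D (tgt J w))) \<cdot> far (comp_ftr F D) w = e (src J w) \<cdot> k' (fob D (src J w))"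
        if "w \<in> arrs J" for w
        using that nat_eq[OF k', of "far D w" "fob D (src J w)" "fob D (tgt J w)"] ext_eq[OF eD[OF that]]
        by (simp add: comp_ftr_def)
    qed (simp_all add: comp_ftr_def)
    then obtain h where h [simp]: "h \<in> arrs C" "src C h = fob F A" "tgt C h = B"
      and hc: "\<And>i. i \<in> obs J \<Longrightarrow> h \<cdot> far F (c i) = e i \<cdot> k' (fob D i)"
      by (rule colimit_ex[OF FA]) blast
    have 1: "(h \<cdot> k A) \<cdot> far S (c i) = e i" if i [simp]: "i \<in> obs J" for i
      using nat_eq[OF k, of "c i" "fob D i" A] ext_eq[OF hc[OF i], of "k (fob D i)"] inv[of "fob D i"] by simp
    have 2: "g = h \<cdot> k A" if g: "g \<in> hom C (fob S A) B \<and> (\<forall>i\<in>obs J. g \<cdot> far S (c i) = e i)" for g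
    proof -
      have ga [simp]: "g \<in> arrs C" "src C g = fob S A" "tgt C g = B" using g by simp_all
      have "g \<cdot> k' A = h"
      proof (rule colimit_epi[OF cJ FA])
        fix i assume i [simp]: "i \<in> obs J"
        have "g \<cdot> far S (c i) = e i" using g by simp
        from ext_eq[OF this, of "k' (fob D i)"] show "(g \<cdot> k' A) \<cdot> far F (c i) = h \<cdot> far F (c i)"
          using nat_eq[OF k', of "c i" "fob D i" A] hc[OF i] by simp
      qed simp_all
      from ext_eq[OF this, of "k A"] show ?thesis using inv[of A] by simp
    qed
    have "h \<cdot> k A \<in> hom C (fob S A) B \<and> (\<forall>i\<in>obs J. (h \<cdot> k A) \<cdot> far S (c i) = e i)"
      using 1 by simp
    with 2 show ?thesis by blast
  qed
  with cocS show "is_colimit J C (comp_ftr S D) (fob S A) (\<lambda>i. far S (c i))"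
    unfolding is_colimit_def by simp
qed

definition empty_cat :: "(nat, nat) cat" where
  "empty_cat = \<lparr>obs = {}, arrs = {}, src = id, tgt = id, idn = id, cmp = (\<lambda>g f. f)\<rparr>"

text \<open>An initial object is a colimit of the empty diagram, so its image is initial
  too.\<close>

lemma cocontinuous_initial:
  fixes \<Phi> :: "('o, 'a, 'o, 'a) ftr"
  assumes \<Phi>: "cocontinuous U C C \<Phi>" and Z: "initial_object C Z"
    and "u \<in> arrs C" "v \<in> arrs C" "src C u = fob \<Phi> Z" "src C v = fob \<Phi> Z" "tgt C u = tgt C v"
  shows "u = v"
proof -
  have cat: "category empty_cat" by (simp add: category_def empty_cat_def)
  have func: "is_functor empty_cat C D" for D :: "(nat, nat, 'o, 'a) ftr"
    by (simp add: is_functor_def empty_cat_def)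
  have "is_colimit empty_cat C D Z c" for D :: "(nat, nat, 'o, 'a) ftr" and c
    using Z func[of D] unfolding is_colimit_def cocone_def initial_object_def by (simp add: empty_cat_def del: in_hom)
  from cocontinuous_countable[OF cat \<Phi> this] show ?thesis
    by (rule colimit_epi[OF cat]) (use assms in \<open>simp_all add: empty_cat_def\<close>)
qed

end

locale coprod_cat = colim_cat C U for C :: "('o, 'a) cat" (structure) and U :: "'u set" +
  fixes cp :: "('o, 'a) coprods"
  assumes coproducts: "binary_coproducts C cp"
begin

lemma coprod_arr [simp]:
  assumes "X \<in> obs C" "Y \<in> obs C"
  shows "csum cp X Y \<in> obs C" "cinl cp X Y \<in> arrs C" "src C (cinl cp X Y) = X" "tgt C (cinl cp X Y) = csum cp X Y"
    "cinr cp X Y \<in> arrs C" "src C (cinr cp X Y) = Y" "tgt C (cinr cp X Y) = csum cp X Y"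
  using coproducts assms unfolding binary_coproducts_def by simp_all

lemma ex1_copair:
  assumes "f \<in> arrs C" "g \<in> arrs C" "tgt C f = tgt C g"
  shows "\<exists>!h. h \<in> hom C (csum cp (src C f) (src C g)) (tgt C f) \<and>
     h \<cdot> cinl cp (src C f) (src C g) = f \<and> h \<cdot> cinr cp (src C f) (src C g) = g"
proof -
  have "f \<in> hom C (src C f) (tgt C f)" "g \<in> hom C (src C g) (tgt C f)" using assms by simp_all
  then show ?thesis
    using coproducts assms(1,2) src_obs tgt_obs unfolding binary_coproducts_def by blast
qed

lemma copair_props:
  assumes "f \<in> arrs C" "g \<in> arrs C" "tgt C f = tgt C g"
  shows "copair C cp f g \<in> arrs C" "src C (copair C cp f g) = csum cp (src C f) (src C g)"
    "tgt C (copair C cp f g) = tgt C f"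
    "src C f = X \<Longrightarrow> src C g = Y \<Longrightarrow> copair C cp f g \<cdot> cinl cp X Y = f"
    "src C f = X \<Longrightarrow> src C g = Y \<Longrightarrow> copair C cp f g \<cdot> cinr cp X Y = g"
  using theI'[OF ex1_copair[OF assms]] by (auto simp: copair_def)

lemmas copair_arr [simp] = copair_props(1-3)
lemmas copair_in [simp] = copair_props(4,5)

lemma coprod_eq:
  assumes uv: "u \<in> arrs C" "v \<in> arrs C" "src C u = csum cp X Y" "src C v = csum cp X Y" "tgt C u = tgt C v"
    and XY: "X \<in> obs C" "Y \<in> obs C"
    and eq: "u \<cdot> cinl cp X Y = v \<cdot> cinl cp X Y" "u \<cdot> cinr cp X Y = v \<cdot> cinr cp X Y"
  shows "u = v"
proof -
  have "\<exists>!h. h \<in> hom C (csum cp X Y) (tgt C u) \<and> h \<cdot> cinl cp X Y = u \<cdot> cinl cp X Y \<and> h \<cdot> cinr cp X Y = u \<cdot> cinr cp X Y"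
    using ex1_copair[of "u \<cdot> cinl cp X Y" "u \<cdot> cinr cp X Y"] uv XY by simp
  moreover have "u \<in> hom C (csum cp X Y) (tgt C u)" "v \<in> hom C (csum cp X Y) (tgt C u)" using uv by simp_all
  ultimately show ?thesis using eq by metis
qed

lemma sum_map_arr [simp]:
  assumes "f \<in> arrs C" "g \<in> arrs C"
  shows "sum_map C cp f g \<in> arrs C" "src C (sum_map C cp f g) = csum cp (src C f) (src C g)"
    "tgt C (sum_map C cp f g) = csum cp (tgt C f) (tgt C g)"
  using assms by (simp_all add: sum_map_def)

lemma sum_map_in:
  assumes "f \<in> arrs C" "g \<in> arrs C" "src C f = X" "src C g = Y"
  shows "sum_map C cp f g \<cdot> cinl cp X Y = cinl cp (tgt C f) (tgt C g) \<cdot> f"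
    "sum_map C cp f g \<cdot> cinr cp X Y = cinr cp (tgt C f) (tgt C g) \<cdot> g"
  using assms by (auto simp: sum_map_def)

lemma comp_copair:
  assumes [simp]: "f \<in> arrs C" "g \<in> arrs C" "tgt C f = tgt C g" "h \<in> arrs C" "src C h = tgt C f"
  shows "h \<cdot> copair C cp f g = copair C cp (h \<cdot> f) (h \<cdot> g)"
  by (rule coprod_eq[where X = "src C f" and Y = "src C g"]) simp_all

lemma copair_sum_map:
  assumes [simp]: "f \<in> arrs C" "g \<in> arrs C" "h \<in> arrs C" "k \<in> arrs C"
    "tgt C f = tgt C g" "tgt C h = src C f" "tgt C k = src C g"
  shows "copair C cp f g \<cdot> sum_map C cp h k = copair C cp (f \<cdot> h) (g \<cdot> k)"
proof (rule coprod_eq[where X = "src C h" and Y = "src C k"])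
  show "(copair C cp f g \<cdot> sum_map C cp h k) \<cdot> cinl cp (src C h) (src C k) = copair C cp (f \<cdot> h) (g \<cdot> k) \<cdot> cinl cp (src C h) (src C k)"
    using ext_eq[OF copair_in(1)[of f g], where x = h] by (simp add: sum_map_in)
  show "(copair C cp f g \<cdot> sum_map C cp h k) \<cdot> cinr cp (src C h) (src C k) = copair C cp (f \<cdot> h) (g \<cdot> k) \<cdot> cinr cp (src C h) (src C k)"
    using ext_eq[OF copair_in(2)[of f g], where x = k] by (simp add: sum_map_in)
qed simp_all

definition two_cat :: "(nat, nat) cat" where
  "two_cat = \<lparr>obs = {0, 1}, arrs = {0, 1}, src = id, tgt = id, idn = id, cmp = (\<lambda>g f. f)\<rparr>"

definition two_ftr :: "'o \<Rightarrow> 'o \<Rightarrow> (nat, nat, 'o, 'a) ftr" where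
  "two_ftr X Y = \<lparr>fob = (\<lambda>i. if i = 0 then X else Y), far = (\<lambda>i. idn C (if i = 0 then X else Y))\<rparr>"

text \<open>A binary coproduct is a colimit over the discrete category with two objects, and
  \<open>\<Phi>\<close> preserves it.\<close>

lemma cocontinuous_coprod:
  fixes \<Phi> :: "('o, 'a, 'o, 'a) ftr"
  assumes \<Phi>: "cocontinuous U C C \<Phi>"
    and uv: "u \<in> arrs C" "v \<in> arrs C" "src C u = fob \<Phi> (csum cp X Y)" "src C v = fob \<Phi> (csum cp X Y)"
      "tgt C u = tgt C v"
    and XY [simp]: "X \<in> obs C" "Y \<in> obs C"
    and eq: "u \<cdot> far \<Phi> (cinl cp X Y) = v \<cdot> far \<Phi> (cinl cp X Y)" "u \<cdot> far \<Phi> (cinr cp X Y) = v \<cdot> far \<Phi> (cinr cp X Y)"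
  shows "u = v"
proof -
  have cat: "category two_cat" by (auto simp: category_def two_cat_def)
  have coc: "cocone two_cat C (two_ftr X Y) B e \<longleftrightarrow> B \<in> obs C \<and> e 0 \<in> hom C X B \<and> e 1 \<in> hom C Y B" for B e
    by (auto simp: cocone_def is_functor_def two_cat_def two_ftr_def)
  let ?c = "\<lambda>i :: nat. if i = 0 then cinl cp X Y else cinr cp X Y"
  have "is_colimit two_cat C (two_ftr X Y) (csum cp X Y) ?c"
    unfolding is_colimit_def
  proof (intro conjI allI impI)
    fix B e assume e: "cocone two_cat C (two_ftr X Y) B e"
    then have "e 0 \<in> hom C X B" "e 1 \<in> hom C Y B" "B \<in> obs C" by (simp_all add: coc)
    then have "\<exists>!h. h \<in> hom C (csum cp X Y) B \<and> h \<cdot> cinl cp X Y = e 0 \<and> h \<cdot> cinr cp X Y = e 1"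
      using coproducts XY unfolding binary_coproducts_def by blast
    then show "\<exists>!h. h \<in> hom C (csum cp X Y) B \<and> (\<forall>i\<in>obs two_cat. h \<cdot> ?c i = e i)"
      by (simp add: two_cat_def)
  qed (simp add: coc)
  from cocontinuous_countable[OF cat \<Phi> this] show ?thesis
    by (rule colimit_epi[OF cat]) (use uv eq in \<open>auto simp: two_cat_def\<close>)
qed

text \<open>An algebra for this functor, pointed by the left injection, is the same thing as an
  algebra for \<open>\<Sigma>\<close>.\<close>

definition pointed_sum :: "('o, 'a, 'o, 'a) ftr \<Rightarrow> ('o, 'a, 'o, 'a) ftr" where
  "pointed_sum \<Sigma> = \<lparr>fob = (\<lambda>X. csum cp X (fob \<Sigma> X)), far = (\<lambda>f. sum_map C cp f (far \<Sigma> f))\<rparr>"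

lemma pointed_sum_simps [simp]:
  "fob (pointed_sum \<Sigma>) X = csum cp X (fob \<Sigma> X)" "far (pointed_sum \<Sigma>) f = sum_map C cp f (far \<Sigma> f)"
  by (simp_all add: pointed_sum_def)

lemma functor_pointed_sum:
  assumes [simp]: "endo \<Sigma>"
  shows "endo (pointed_sum \<Sigma>)"
  unfolding is_functor_def
proof (intro conjI ballI impI)
  fix X assume [simp]: "X \<in> obs C"
  show "far (pointed_sum \<Sigma>) (idn C X) = idn C (fob (pointed_sum \<Sigma>) X)"
    by (rule coprod_eq[where X = X and Y = "fob \<Sigma> X"]) (simp_all add: sum_map_in)
next
  fix f g assume [simp]: "f \<in> arrs C" "g \<in> arrs C" "tgt C f = src C g"
  show "far (pointed_sum \<Sigma>) (g \<cdot> f) = far (pointed_sum \<Sigma>) g \<cdot> far (pointed_sum \<Sigma>) f"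
    by (rule coprod_eq[where X = "src C f" and Y = "fob \<Sigma> (src C f)"])
      (simp_all add: sum_map_in ext_eq[OF sum_map_in(1)] ext_eq[OF sum_map_in(2)])
qed simp_all

text \<open>Restricting a cocone along the two injections gives cocones over \<open>D\<close> and
  over its image under \<open>\<Sigma>\<close>; the arrows induced by these are put together by
  \<open>copair\<close>.\<close>

lemma finitary_pointed_sum:
  assumes \<Sigma>: "finitary U C C \<Sigma>"
  shows "finitary U C C (pointed_sum \<Sigma>)"
  unfolding finitary_def
proof (intro conjI allI impI, rule functor_pointed_sum[OF finitary_functor[OF \<Sigma>]], elim conjE)
  fix J :: "('u, 'u) cat" and D A c
  let ?H = "pointed_sum \<Sigma>"
  assume J: "small_category U J" "filtered J" and A: "is_colimit J C D A c"
  note finitary_functor[OF \<Sigma>, simp]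
  have [simp]: "endo ?H" by (simp add: functor_pointed_sum)
  have cJ: "category J" using J by (simp add: small_category_def)
  have Jobs [simp]: "src J w \<in> obs J" "tgt J w \<in> obs J" if "w \<in> arrs J" for w
    using cJ that by (auto simp: category_def)
  have D: "is_functor J C D" using A by (simp add: is_colimit_def cocone_def)
  note diagram_arr[OF D, simp] colimit_arr[OF A, simp] colimit_obs[OF A, simp]
  have Dobs [simp]: "fob D i \<in> obs C" if "i \<in> obs J" for i using D that by (simp add: is_functor_def)
  have cD: "c (tgt J w) \<cdot> far D w = c (src J w)" if "w \<in> arrs J" for w
    using A that by (simp add: is_colimit_def cocone_def)
  have \<Sigma>A: "is_colimit J C (comp_ftr \<Sigma> D) (fob \<Sigma> A) (\<lambda>i. far \<Sigma> (c i))"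
    using \<Sigma> J A unfolding finitary_def by blast
  have HD: "is_functor J C (comp_ftr ?H D)"
    using D functor_pointed_sum[OF finitary_functor[OF \<Sigma>]] unfolding is_functor_def by (auto simp: comp_ftr_def)
  have cocH: "cocone J C (comp_ftr ?H D) (fob ?H A) (\<lambda>i. far ?H (c i))"
    unfolding cocone_def using HD cD by (simp add: comp_ftr_def flip: far_comp del: pointed_sum_simps(2))
  have "\<exists>!h. h \<in> hom C (fob ?H A) B \<and> (\<forall>i\<in>obs J. h \<cdot> far ?H (c i) = e i)"
    if e: "cocone J C (comp_ftr ?H D) B e" for B e
  proof -
    have B [simp]: "B \<in> obs C" using e by (simp add: cocone_def)
    have ea [simp]: "e i \<in> arrs C" "src C (e i) = csum cp (fob D i) (fob \<Sigma> (fob D i))" "tgt C (e i) = B" if "i \<in> obs J" for i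
      using cocone_arr[OF e that] by (simp_all add: comp_ftr_def)
    have eD: "e (tgt J w) \<cdot> sum_map C cp (far D w) (far \<Sigma> (far D w)) = e (src J w)" if "w \<in> arrs J" for w
      using e that by (simp add: cocone_def comp_ftr_def)
    have "cocone J C D B (\<lambda>i. e i \<cdot> cinl cp (fob D i) (fob \<Sigma> (fob D i)))"
      unfolding cocone_def
    proof (intro conjI ballI, rule D)
      fix w assume w [simp]: "w \<in> arrs J"
      show "(e (tgt J w) \<cdot> cinl cp (fob D (tgt J w)) (fob \<Sigma> (fob D (tgt J w)))) \<cdot> far D w =
          e (src J w) \<cdot> cinl cp (fob D (src J w)) (fob \<Sigma> (fob D (src J w)))"
        using ext_eq[OF eD[OF w], of "cinl cp (fob D (src J w)) (fob \<Sigma> (fob D (src J w)))"] by (simp add: sum_map_in)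
    qed simp_all
    then obtain h1 where h1 [simp]: "h1 \<in> arrs C" "src C h1 = A" "tgt C h1 = B"
      and h1c: "\<And>i. i \<in> obs J \<Longrightarrow> h1 \<cdot> c i = e i \<cdot> cinl cp (fob D i) (fob \<Sigma> (fob D i))"
      by (rule colimit_ex[OF A]) blast
    have "cocone J C (comp_ftr \<Sigma> D) B (\<lambda>i. e i \<cdot> cinr cp (fob D i) (fob \<Sigma> (fob D i)))"
      unfolding cocone_def
    proof (intro conjI ballI)
      show "is_functor J C (comp_ftr \<Sigma> D)" using \<Sigma>A by (simp add: is_colimit_def cocone_def)
      fix w assume w [simp]: "w \<in> arrs J"
      show "(e (tgt J w) \<cdot> cinr cp (fob D (tgt J w)) (fob \<Sigma> (fob D (tgt J w)))) \<cdot> far (comp_ftr \<Sigma> D) w =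
          e (src J w) \<cdot> cinr cp (fob D (src J w)) (fob \<Sigma> (fob D (src J w)))"
        using ext_eq[OF eD[OF w], of "cinr cp (fob D (src J w)) (fob \<Sigma> (fob D (src J w)))"]
        by (simp add: sum_map_in comp_ftr_def)
    qed (simp_all add: comp_ftr_def)
    then obtain h2 where h2 [simp]: "h2 \<in> arrs C" "src C h2 = fob \<Sigma> A" "tgt C h2 = B"
      and h2c: "\<And>i. i \<in> obs J \<Longrightarrow> h2 \<cdot> far \<Sigma> (c i) = e i \<cdot> cinr cp (fob D i) (fob \<Sigma> (fob D i))"
      by (rule colimit_ex[OF \<Sigma>A]) blast
    have 1: "copair C cp h1 h2 \<cdot> far ?H (c i) = e i" if i [simp]: "i \<in> obs J" for i
      by (rule coprod_eq[where X = "fob D i" and Y = "fob \<Sigma> (fob D i)"])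
        (use h1c[OF i] h2c[OF i] in \<open>simp_all add: copair_sum_map\<close>)
    have 2: "g = copair C cp h1 h2" if g: "g \<in> hom C (fob ?H A) B \<and> (\<forall>i\<in>obs J. g \<cdot> far ?H (c i) = e i)" for g
    proof -
      have ga [simp]: "g \<in> arrs C" "src C g = csum cp A (fob \<Sigma> A)" "tgt C g = B" using g by simp_all
      have gc: "g \<cdot> sum_map C cp (c i) (far \<Sigma> (c i)) = e i" if "i \<in> obs J" for i using g that by simp
      have l: "g \<cdot> cinl cp A (fob \<Sigma> A) = h1"
      proof (rule colimit_epi[OF cJ A])
        fix i assume i [simp]: "i \<in> obs J"
        show "(g \<cdot> cinl cp A (fob \<Sigma> A)) \<cdot> c i = h1 \<cdot> c i"
          using ext_eq[OF gc[OF i], of "cinl cp (fob D i) (fob \<Sigma> (fob D i))"] h1c[OF i] by (simp add: sum_map_in)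
      qed simp_all
      have r: "g \<cdot> cinr cp A (fob \<Sigma> A) = h2"
      proof (rule colimit_epi[OF cJ \<Sigma>A])
        fix i assume i [simp]: "i \<in> obs J"
        show "(g \<cdot> cinr cp A (fob \<Sigma> A)) \<cdot> far \<Sigma> (c i) = h2 \<cdot> far \<Sigma> (c i)"
          using ext_eq[OF gc[OF i], of "cinr cp (fob D i) (fob \<Sigma> (fob D i))"] h2c[OF i] by (simp add: sum_map_in)
      qed simp_all
      show ?thesis by (rule coprod_eq[where X = A and Y = "fob \<Sigma> A"]) (simp_all add: l r)
    qed
    have "copair C cp h1 h2 \<in> hom C (fob ?H A) B \<and> (\<forall>i\<in>obs J. copair C cp h1 h2 \<cdot> far ?H (c i) = e i)"
      using 1 by simp
    with 2 show ?thesis by blast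
  qed
  with cocH show "is_colimit J C (comp_ftr ?H D) (fob ?H A) (\<lambda>i. far ?H (c i))"
    unfolding is_colimit_def by simp
qed

section \<open>The free monad as a retract of a monad of free algebras\<close>

context
  fixes \<Sigma> :: "('o, 'a, 'o, 'a) ftr" and S :: "('o, 'a) monad" and \<eta>\<Sigma> :: "'o \<Rightarrow> 'a"
  assumes \<Sigma>: "finitary U C C \<Sigma>" and free: "free_monad C \<Sigma> S \<eta>\<Sigma>"
begin

text \<open>Freeness of \<open>S\<close> gives \<open>k\<close>, the universal property of
  \<open>F\<close> gives \<open>k'\<close>, and \<open>k'\<close> after \<open>k\<close> fixes
  \<open>\<eta>\<Sigma>\<close>, hence is the identity. Exhibiting \<open>S\<close> as a retract is
  enough: finitariness and the induction principle both descend along it.\<close>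

lemma free_monad_retract:
  obtains F k k' \<zeta> where "finitary_monad U C F" "nat_trans C C (pointed_sum \<Sigma>) F \<zeta>"
    "monad_morphism C S F k" "monad_morphism C F S k'"
    "\<And>X. X \<in> obs C \<Longrightarrow> k' X \<cdot> k X = idn C (fob S X)"
    "\<And>X. X \<in> obs C \<Longrightarrow> \<zeta> X \<cdot> cinl cp X (fob \<Sigma> X) = unit F X"
    "\<And>X. X \<in> obs C \<Longrightarrow> k' X \<cdot> \<zeta> X \<cdot> cinr cp X (fob \<Sigma> X) = \<eta>\<Sigma> X"
    "\<And>(\<Phi> :: ('o, 'a, 'o, 'a) ftr) X u v. X \<in> obs C \<Longrightarrow> cocontinuous U C C \<Phi> \<Longrightarrow> u \<in> arrs C \<Longrightarrow> v \<in> arrs C \<Longrightarrow>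
       src C u = fob \<Phi> (fob F X) \<Longrightarrow> src C v = fob \<Phi> (fob F X) \<Longrightarrow> tgt C u = tgt C v \<Longrightarrow>
       u \<cdot> far \<Phi> (unit F X) = v \<cdot> far \<Phi> (unit F X) \<Longrightarrow>
       (\<And>p. p \<in> arrs C \<Longrightarrow> tgt C p = fob F X \<Longrightarrow> u \<cdot> far \<Phi> p = v \<cdot> far \<Phi> p \<Longrightarrow>
          u \<cdot> far \<Phi> ((mult F X \<cdot> \<zeta> (fob F X)) \<cdot> far (pointed_sum \<Sigma>) p) =
          v \<cdot> far \<Phi> ((mult F X \<cdot> \<zeta> (fob F X)) \<cdot> far (pointed_sum \<Sigma>) p)) \<Longrightarrow> u = v"
proof -
  let ?H = "pointed_sum \<Sigma>"
  let ?\<eta> = "\<lambda>X. cinl cp X (fob \<Sigma> X)"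
  \<comment> \<open>Only the compulsory equation of \<open>unit_eq\<close>, which constrains no
    algebra.\<close>
  let ?E = "{(?H, \<lambda>X. far ?H (?\<eta> X), \<lambda>X. ?\<eta> (fob ?H X))}"
  have [simp]: "endo \<Sigma>" using \<Sigma> by (rule finitary_functor)
  have S [simp]: "is_monad C S" and \<eta>\<Sigma>: "nat_trans C C \<Sigma> S \<eta>\<Sigma>"
    using free by (simp_all add: free_monad_def)
  note nat_arr[OF \<eta>\<Sigma>, simp]
  have H: "finitary U C C ?H" using \<Sigma> by (rule finitary_pointed_sum)
  have [simp]: "endo ?H" using H by (rule finitary_functor)
  have \<eta>_nat: "nat_trans C C id_ftr ?H ?\<eta>"
    by (rule natI) (simp_all add: id_ftr_def sum_map_in)
  have 1: "nat_trans C C ?H (comp_ftr ?H ?H) (\<lambda>X. far ?H (?\<eta> X))"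
  proof (rule natI)
    fix f X Y assume f [simp]: "f \<in> arrs C" "src C f = X" "tgt C f = Y" "X \<in> obs C" "Y \<in> obs C"
    show "far ?H (?\<eta> Y) \<cdot> far ?H f = far (comp_ftr ?H ?H) f \<cdot> far ?H (?\<eta> X)"
      using arg_cong[OF nat_eq[OF \<eta>_nat f(1-3)], of "far ?H"]
      by (simp add: comp_ftr_def id_ftr_def del: pointed_sum_simps(2))
  qed (simp_all add: comp_ftr_def)
  have 2: "nat_trans C C ?H (comp_ftr ?H ?H) (\<lambda>X. ?\<eta> (fob ?H X))"
    by (rule natI) (simp_all add: comp_ftr_def sum_map_in)
  interpret T: equational_theory C U ?H ?\<eta> ?E
    by unfold_locales (use H \<eta>_nat 1 2 finitary_jointly_epi[OF H] in auto)
  obtain F \<zeta> where F: "finitary_monad U C F" and \<zeta>: "nat_trans C C ?H F \<zeta>"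
    and \<zeta>\<eta>: "\<And>X. X \<in> obs C \<Longrightarrow> \<zeta> X \<cdot> ?\<eta> X = unit F X"
    and freeF: "\<And>X. X \<in> obs C \<Longrightarrow> T.free_alg X (fob F X) (unit F X) (mult F X \<cdot> \<zeta> (fob F X))"
    and univ: "\<And>N \<beta>. is_monad C N \<Longrightarrow> nat_trans C C ?H N \<beta> \<Longrightarrow> (\<And>X. X \<in> obs C \<Longrightarrow> \<beta> X \<cdot> ?\<eta> X = unit N X) \<Longrightarrow>
       (\<And>G l r X. (G, l, r) \<in> ?E \<Longrightarrow> X \<in> obs C \<Longrightarrow>
          mult N X \<cdot> far N (\<beta> X) \<cdot> \<beta> (fob ?H X) \<cdot> l X = mult N X \<cdot> far N (\<beta> X) \<cdot> \<beta> (fob ?H X) \<cdot> r X) \<Longrightarrow>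
       \<exists>k. monad_morphism C F N k \<and> (\<forall>X\<in>obs C. k X \<cdot> \<zeta> X = \<beta> X)"
    by (rule T.free_algebra_monad) blast
  have Fm [simp]: "is_monad C F" using F by (simp add: finitary_monad_def)
  note nat_arr[OF \<zeta>, simp]
  have "nat_trans C C \<Sigma> F (\<lambda>X. \<zeta> X \<cdot> cinr cp X (fob \<Sigma> X))"
  proof (rule natI)
    fix f X Y assume f [simp]: "f \<in> arrs C" "src C f = X" "tgt C f = Y" "X \<in> obs C" "Y \<in> obs C"
    show "(\<zeta> Y \<cdot> cinr cp Y (fob \<Sigma> Y)) \<cdot> far \<Sigma> f = far F f \<cdot> \<zeta> X \<cdot> cinr cp X (fob \<Sigma> X)"
      using ext_eq[OF nat_eq[OF \<zeta> f(1-3)], of "cinr cp X (fob \<Sigma> X)"] by (simp add: sum_map_in)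
  qed simp_all
  then obtain k where "induced_morphism C S \<eta>\<Sigma> F (\<lambda>X. \<zeta> X \<cdot> cinr cp X (fob \<Sigma> X)) k"
    using free Fm unfolding free_monad_def by blast
  then have k: "monad_morphism C S F k" and k\<eta>: "\<And>X. X \<in> obs C \<Longrightarrow> k X \<cdot> \<eta>\<Sigma> X = \<zeta> X \<cdot> cinr cp X (fob \<Sigma> X)"
    by (simp_all add: induced_morphism_def)
  let ?\<beta> = "\<lambda>X. copair C cp (unit S X) (\<eta>\<Sigma> X)"
  have \<beta>: "nat_trans C C ?H S ?\<beta>"
  proof (rule natI)
    fix f X Y assume f [simp]: "f \<in> arrs C" "src C f = X" "tgt C f = Y" "X \<in> obs C" "Y \<in> obs C"
    show "?\<beta> Y \<cdot> far ?H f = far S f \<cdot> ?\<beta> X"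
      using unit_nat[OF S f(1-3)] nat_eq[OF \<eta>\<Sigma> f(1-3)] by (simp add: copair_sum_map comp_copair)
  qed simp_all
  have "\<exists>k. monad_morphism C F S k \<and> (\<forall>X\<in>obs C. k X \<cdot> \<zeta> X = ?\<beta> X)"
  proof (rule univ[OF S \<beta>])
    show "?\<beta> X \<cdot> ?\<eta> X = unit S X" if "X \<in> obs C" for X using that by simp
    fix G l r X assume "(G, l, r) \<in> ?E" and X [simp]: "X \<in> obs C"
    then have lr: "l X = far ?H (?\<eta> X)" "r X = ?\<eta> (fob ?H X)" by auto
    \<comment> \<open>Both sides reduce to \<open>?\<beta> X\<close>, by the two unit laws of
      \<open>S\<close>.\<close>
    have "mult S X \<cdot> far S (?\<beta> X) \<cdot> ?\<beta> (fob ?H X) \<cdot> l X = mult S X \<cdot> far S (?\<beta> X) \<cdot> far S (?\<eta> X) \<cdot> ?\<beta> X"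
      using nat_eq[OF \<beta>, of "?\<eta> X" X "fob ?H X"] by (simp add: lr)
    also have "\<dots> = mult S X \<cdot> far S (?\<beta> X \<cdot> ?\<eta> X) \<cdot> ?\<beta> X" by (simp del: copair_in)
    also have "\<dots> = ?\<beta> X" using ext_eq[OF monad_laws(2)[OF S X], of "?\<beta> X"] by simp
    also have "\<dots> = mult S X \<cdot> far S (?\<beta> X) \<cdot> ?\<beta> (fob ?H X) \<cdot> r X"
      using unit_nat[OF S, of "?\<beta> X"] ext_eq[OF monad_laws(1)[OF S X], of "?\<beta> X"] by (simp add: lr)
    finally show "mult S X \<cdot> far S (?\<beta> X) \<cdot> ?\<beta> (fob ?H X) \<cdot> l X = mult S X \<cdot> far S (?\<beta> X) \<cdot> ?\<beta> (fob ?H X) \<cdot> r X" .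
  qed
  then obtain k' where k': "monad_morphism C F S k'" and k'\<zeta>: "\<And>X. X \<in> obs C \<Longrightarrow> k' X \<cdot> \<zeta> X = ?\<beta> X" by blast
  note nat_arr[OF morphism_nat[OF k], simp] nat_arr[OF morphism_nat[OF k'], simp]
  have k'\<eta>: "k' X \<cdot> \<zeta> X \<cdot> cinr cp X (fob \<Sigma> X) = \<eta>\<Sigma> X" if "X \<in> obs C" for X
    using that ext_eq[OF k'\<zeta>[OF that], of "cinr cp X (fob \<Sigma> X)"] by simp
  have "induced_morphism C S \<eta>\<Sigma> S \<eta>\<Sigma> (\<lambda>X. k' X \<cdot> k X)"
    using morphism_comp[OF S Fm S k k'] by (simp add: induced_morphism_def k\<eta> k'\<eta>)
  moreover have "induced_morphism C S \<eta>\<Sigma> S \<eta>\<Sigma> (\<lambda>X. idn C (fob S X))"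
    using morphism_idn[OF S] by (simp add: induced_morphism_def)
  ultimately have "k' X \<cdot> k X = idn C (fob S X)" if "X \<in> obs C" for X
    using that free S \<eta>\<Sigma> unfolding free_monad_def by blast
  then show thesis
    using that[OF F \<zeta> k k' _ \<zeta>\<eta> k'\<eta>] T.free_alg_induct[OF freeF] by blast
qed

lemma finitary_free_monad: "finitary U C C S"
proof -
  obtain F k k' \<zeta> where "finitary_monad U C F"
    "monad_morphism C S F k" "monad_morphism C F S k'"
    "\<And>X. X \<in> obs C \<Longrightarrow> k' X \<cdot> k X = idn C (fob S X)"
    by (rule free_monad_retract) blast
  then show ?thesis
    using free by (intro finitary_retract[of S F k k']) (simp_all add: finitary_monad_def morphism_nat free_monad_def)
qed

text \<open>Induction over \<open>F\<close> proves agreement after \<open>k' X\<close>, and the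
  section \<open>k X\<close> then removes \<open>k' X\<close>. In the induction step the source is a
  coproduct: on the left summand the claim is the induction hypothesis, on the right summand it is
  the assumption \<open>step\<close>.\<close>

theorem free_monad_induct:
  fixes \<Phi> :: "('o, 'a, 'o, 'a) ftr"
  assumes X [simp]: "X \<in> obs C" and \<Phi>: "cocontinuous U C C \<Phi>"
    and uv [simp]: "u \<in> arrs C" "v \<in> arrs C" "src C u = fob \<Phi> (fob S X)" "src C v = fob \<Phi> (fob S X)" "tgt C u = tgt C v"
    and base: "u \<cdot> far \<Phi> (unit S X) = v \<cdot> far \<Phi> (unit S X)"
    and step: "\<And>p. p \<in> arrs C \<Longrightarrow> tgt C p = fob S X \<Longrightarrow> u \<cdot> far \<Phi> p = v \<cdot> far \<Phi> p \<Longrightarrow>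
      u \<cdot> far \<Phi> (mult S X \<cdot> \<eta>\<Sigma> (fob S X) \<cdot> far \<Sigma> p) = v \<cdot> far \<Phi> (mult S X \<cdot> \<eta>\<Sigma> (fob S X) \<cdot> far \<Sigma> p)"
  shows "u = v"
proof -
  obtain F k k' \<zeta> where F: "finitary_monad U C F" and \<zeta>: "nat_trans C C (pointed_sum \<Sigma>) F \<zeta>"
    and k: "monad_morphism C S F k" and k': "monad_morphism C F S k'"
    and k'k: "\<And>X. X \<in> obs C \<Longrightarrow> k' X \<cdot> k X = idn C (fob S X)"
    and \<zeta>l: "\<And>X. X \<in> obs C \<Longrightarrow> \<zeta> X \<cdot> cinl cp X (fob \<Sigma> X) = unit F X"
    and \<zeta>r: "\<And>X. X \<in> obs C \<Longrightarrow> k' X \<cdot> \<zeta> X \<cdot> cinr cp X (fob \<Sigma> X) = \<eta>\<Sigma> X"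
    and ind: "\<And>(\<Phi> :: ('o, 'a, 'o, 'a) ftr) X u v. X \<in> obs C \<Longrightarrow> cocontinuous U C C \<Phi> \<Longrightarrow> u \<in> arrs C \<Longrightarrow> v \<in> arrs C \<Longrightarrow>
       src C u = fob \<Phi> (fob F X) \<Longrightarrow> src C v = fob \<Phi> (fob F X) \<Longrightarrow> tgt C u = tgt C v \<Longrightarrow>
       u \<cdot> far \<Phi> (unit F X) = v \<cdot> far \<Phi> (unit F X) \<Longrightarrow>
       (\<And>p. p \<in> arrs C \<Longrightarrow> tgt C p = fob F X \<Longrightarrow> u \<cdot> far \<Phi> p = v \<cdot> far \<Phi> p \<Longrightarrow>
          u \<cdot> far \<Phi> ((mult F X \<cdot> \<zeta> (fob F X)) \<cdot> far (pointed_sum \<Sigma>) p) =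
          v \<cdot> far \<Phi> ((mult F X \<cdot> \<zeta> (fob F X)) \<cdot> far (pointed_sum \<Sigma>) p)) \<Longrightarrow> u = v"
    by (rule free_monad_retract) blast
  have [simp]: "endo \<Sigma>" "endo \<Phi>" using \<Sigma> \<Phi> by (auto simp: finitary_functor cocontinuous_functor)
  have [simp]: "endo (pointed_sum \<Sigma>)" by (simp add: functor_pointed_sum)
  have S [simp]: "is_monad C S" and \<eta>\<Sigma>: "nat_trans C C \<Sigma> S \<eta>\<Sigma>"
    using free by (simp_all add: free_monad_def)
  have Fm [simp]: "is_monad C F" using F by (simp add: finitary_monad_def)
  note nat_arr[OF \<eta>\<Sigma>, simp] nat_arr[OF \<zeta>, simp] nat_arr[OF morphism_nat[OF k], simp] nat_arr[OF morphism_nat[OF k'], simp]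
  have "u \<cdot> far \<Phi> (k' X) = v \<cdot> far \<Phi> (k' X)"
  proof (rule ind[OF X \<Phi>])
    show "(u \<cdot> far \<Phi> (k' X)) \<cdot> far \<Phi> (unit F X) = (v \<cdot> far \<Phi> (k' X)) \<cdot> far \<Phi> (unit F X)"
      using base morphism_laws(1)[OF k' X] by (simp flip: far_comp)
  next
    fix p assume p [simp]: "p \<in> arrs C" "tgt C p = fob F X"
      and eq: "(u \<cdot> far \<Phi> (k' X)) \<cdot> far \<Phi> p = (v \<cdot> far \<Phi> (k' X)) \<cdot> far \<Phi> p"
    let ?A = "src C p"
    let ?q = "(mult F X \<cdot> \<zeta> (fob F X)) \<cdot> far (pointed_sum \<Sigma>) p"
    have A [simp]: "?A \<in> obs C" by simp
    have eq': "u \<cdot> far \<Phi> (k' X \<cdot> p) = v \<cdot> far \<Phi> (k' X \<cdot> p)" using eq by simp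
    have l: "(k' X \<cdot> ?q) \<cdot> cinl cp ?A (fob \<Sigma> ?A) = k' X \<cdot> p"
      using ext_eq[OF \<zeta>l, of "fob F X" p] ext_eq[OF monad_laws(1)[OF Fm X], of p] by (simp add: sum_map_in)
    have "(k' X \<cdot> ?q) \<cdot> cinr cp ?A (fob \<Sigma> ?A) = k' X \<cdot> mult F X \<cdot> \<zeta> (fob F X) \<cdot> cinr cp (fob F X) (fob \<Sigma> (fob F X)) \<cdot> far \<Sigma> p"
      by (simp add: sum_map_in)
    also have "\<dots> = mult S X \<cdot> far S (k' X) \<cdot> (k' (fob F X) \<cdot> \<zeta> (fob F X) \<cdot> cinr cp (fob F X) (fob \<Sigma> (fob F X))) \<cdot> far \<Sigma> p"
      using ext_eq[OF morphism_laws(2)[OF k' X]] by simp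
    also have "\<dots> = mult S X \<cdot> far S (k' X) \<cdot> \<eta>\<Sigma> (fob F X) \<cdot> far \<Sigma> p"
      by (simp only: \<zeta>r fob_obs monad_functor Fm X)
    also have "\<dots> = mult S X \<cdot> \<eta>\<Sigma> (fob S X) \<cdot> far \<Sigma> (k' X \<cdot> p)"
      using ext_eq[OF nat_eq[OF \<eta>\<Sigma>, of "k' X" "fob F X" "fob S X"], of "far \<Sigma> p"] by simp
    finally have r: "(k' X \<cdot> ?q) \<cdot> cinr cp ?A (fob \<Sigma> ?A) = mult S X \<cdot> \<eta>\<Sigma> (fob S X) \<cdot> far \<Sigma> (k' X \<cdot> p)" .
    have "u \<cdot> far \<Phi> (k' X \<cdot> ?q) = v \<cdot> far \<Phi> (k' X \<cdot> ?q)"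
    proof (rule cocontinuous_coprod[OF \<Phi>, where X = ?A and Y = "fob \<Sigma> ?A"])
      show "(u \<cdot> far \<Phi> (k' X \<cdot> ?q)) \<cdot> far \<Phi> (cinl cp ?A (fob \<Sigma> ?A)) = (v \<cdot> far \<Phi> (k' X \<cdot> ?q)) \<cdot> far \<Phi> (cinl cp ?A (fob \<Sigma> ?A))"
        using arg_cong[OF l, of "far \<Phi>"] eq' by simp
      show "(u \<cdot> far \<Phi> (k' X \<cdot> ?q)) \<cdot> far \<Phi> (cinr cp ?A (fob \<Sigma> ?A)) = (v \<cdot> far \<Phi> (k' X \<cdot> ?q)) \<cdot> far \<Phi> (cinr cp ?A (fob \<Sigma> ?A))"
        using arg_cong[OF r, of "far \<Phi>"] step[of "k' X \<cdot> p"] eq' by simp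
    qed simp_all
    then show "(u \<cdot> far \<Phi> (k' X)) \<cdot> far \<Phi> ?q = (v \<cdot> far \<Phi> (k' X)) \<cdot> far \<Phi> ?q" by simp
  qed simp_all
  from ext_eq[OF this, of "far \<Phi> (k X)"] show ?thesis
    using arg_cong[OF k'k[OF X], of "far \<Phi>"] by simp
qed

end

end

section \<open>Composite monads and coequalisers of monads\<close>

context base_cat
begin

section \<open>The composite monad of a distributive law\<close>

context
  fixes S T :: "('o, 'a) monad" and \<delta> :: "'o \<Rightarrow> 'a"
  assumes S [simp]: "is_monad C S" and T [simp]: "is_monad C T" and \<delta>: "distributive_law C S T \<delta>"
begin

abbreviation "composite \<equiv> composite_monad C S T \<delta>"

lemma ST_simps [simp]:
  "fob composite X = fob S (fob T X)" "far composite f = far S (far T f)"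
  "unit composite X = unit S (fob T X) \<cdot> unit T X"
  by (simp_all add: composite_monad_def)

lemma \<delta>_arr [simp]:
  assumes "X \<in> obs C"
  shows "\<delta> X \<in> arrs C" "src C (\<delta> X) = fob T (fob S X)" "tgt C (\<delta> X) = fob S (fob T X)"
  using nat_arr[of "comp_ftr T S" "comp_ftr S T" \<delta>, OF _ assms] \<delta>
  by (simp_all add: distributive_law_def comp_ftr_def)

lemma \<delta>_nat:
  assumes "f \<in> arrs C" "src C f = X" "tgt C f = Y"
  shows "\<delta> Y \<cdot> far T (far S f) = far S (far T f) \<cdot> \<delta> X"
  using nat_eq[of "comp_ftr T S" "comp_ftr S T" \<delta>, OF _ assms] \<delta>
  by (simp add: distributive_law_def comp_ftr_def)

lemma \<delta>_laws:
  assumes "X \<in> obs C"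
  shows "\<delta> X \<cdot> far T (unit S X) = unit S (fob T X)"
    "\<delta> X \<cdot> unit T (fob S X) = far S (unit T X)"
    "\<delta> X \<cdot> far T (mult S X) = mult S (fob T X) \<cdot> far S (\<delta> X) \<cdot> \<delta> (fob S X)"
    "\<delta> X \<cdot> mult T (fob S X) = far S (mult T X) \<cdot> \<delta> (fob T X) \<cdot> far T (\<delta> X)"
  using \<delta> assms by (simp_all add: distributive_law_def)

text \<open>The \<open>T\<close>-algebra obtained by lifting the free \<open>T\<close>-algebra on
  \<open>X\<close> along \<open>S\<close> by means of \<open>\<delta>\<close>. Its algebra laws are
  \<open>\<theta>_unit_T\<close> and \<open>\<theta>_mult_T\<close>, and by \<open>ST_mult\<close>
  it determines the composite multiplication.\<close>

definition \<theta> :: "'o \<Rightarrow> 'a" where "\<theta> X = far S (mult T X) \<cdot> \<delta> (fob T X)"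

lemma \<theta>_arr [simp]:
  assumes "X \<in> obs C"
  shows "\<theta> X \<in> arrs C" "src C (\<theta> X) = fob T (fob S (fob T X))" "tgt C (\<theta> X) = fob S (fob T X)"
  using assms by (simp_all add: \<theta>_def)

lemma ST_mult: "X \<in> obs C \<Longrightarrow> mult composite X = mult S (fob T X) \<cdot> far S (\<theta> X)"
  by (simp add: composite_monad_def \<theta>_def)

lemma \<theta>_nat:
  assumes f [simp]: "f \<in> arrs C" "src C f = X" "tgt C f = Y"
  shows "\<theta> Y \<cdot> far T (far S (far T f)) = far S (far T f) \<cdot> \<theta> X"
proof -
  have [simp]: "X \<in> obs C" "Y \<in> obs C" using f src_obs tgt_obs by blast+
  have "far S (mult T Y) \<cdot> far S (far T (far T f)) = far S (far T f) \<cdot> far S (mult T X)"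
    using arg_cong[OF mult_nat[OF T f], of "far S"] by simp
  from ext_eq[OF this, of "\<delta> (fob T X)"] show ?thesis
    using \<delta>_nat[of "far T f" "fob T X" "fob T Y"] by (simp add: \<theta>_def)
qed

text \<open>In terms of the lifting of \<open>S\<close> to \<open>T\<close>-algebras, where the
  image of \<open>\<theta> X\<close> is
  \<open>far S (\<theta> X) \<cdot> \<delta> (fob S (fob T X))\<close>, this says that the
  multiplication of \<open>S\<close> is a homomorphism.\<close>

lemma \<theta>_mult_S:
  assumes X [simp]: "X \<in> obs C"
  shows "\<theta> X \<cdot> far T (mult S (fob T X)) = mult S (fob T X) \<cdot> far S (\<theta> X) \<cdot> \<delta> (fob S (fob T X))"
  using \<delta>_laws(3)[of "fob T X"] ext_eq[OF mult_nat[OF S, of "mult T X" "fob T (fob T X)" "fob T X"]]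
  by (simp add: \<theta>_def)

lemma \<theta>_mult_T:
  assumes X [simp]: "X \<in> obs C"
  shows "\<theta> X \<cdot> mult T (fob S (fob T X)) = \<theta> X \<cdot> far T (\<theta> X)"
proof -
  have "far S (mult T X) \<cdot> far S (mult T (fob T X)) = far S (mult T X) \<cdot> far S (far T (mult T X))"
    using arg_cong[OF monad_laws(3)[OF T X], of "far S"] by simp
  from ext_eq[OF this]
  have "\<theta> X \<cdot> mult T (fob S (fob T X)) =
      far S (mult T X) \<cdot> far S (far T (mult T X)) \<cdot> \<delta> (fob T (fob T X)) \<cdot> far T (\<delta> (fob T X))"
    using \<delta>_laws(4)[of "fob T X"] by (simp add: \<theta>_def)
  also have "\<dots> = \<theta> X \<cdot> far T (\<theta> X)"
    using ext_eq[OF \<delta>_nat[of "mult T X" "fob T (fob T X)" "fob T X"], of "far T (\<delta> (fob T X))"] by (simp add: \<theta>_def)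
  finally show ?thesis .
qed

lemma \<theta>_unit_S:
  assumes X [simp]: "X \<in> obs C"
  shows "\<theta> X \<cdot> far T (unit S (fob T X)) = unit S (fob T X) \<cdot> mult T X"
  using \<delta>_laws(1)[of "fob T X"] unit_nat[OF S, of "mult T X" "fob T (fob T X)" "fob T X"] by (simp add: \<theta>_def)

lemma \<theta>_unit_T:
  assumes X [simp]: "X \<in> obs C"
  shows "\<theta> X \<cdot> unit T (fob S (fob T X)) = idn C (fob S (fob T X))"
  using \<delta>_laws(2)[of "fob T X"] arg_cong[OF monad_laws(1)[OF T X], of "far S"] by (simp add: \<theta>_def)

lemma functor_ST: "endo composite"
  unfolding is_functor_def by auto

lemma is_monad_ST: "is_monad C composite"
  unfolding is_monad_def
proof (intro conjI ballI functor_ST)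
  show "nat_trans C C id_ftr composite (unit composite)"
  proof (rule natI)
    fix f X Y assume f [simp]: "f \<in> arrs C" "src C f = X" "tgt C f = Y" "X \<in> obs C" "Y \<in> obs C"
    show "unit composite Y \<cdot> far id_ftr f = far composite f \<cdot> unit composite X"
      using unit_nat[OF T f(1-3)] ext_eq[OF unit_nat[OF S, of "far T f" "fob T X" "fob T Y"], of "unit T X"]
      by (simp add: id_ftr_def)
  qed (simp_all add: id_ftr_def)
  show "nat_trans C C (comp_ftr composite composite) composite (mult composite)"
  proof (rule natI)
    fix f X Y assume f [simp]: "f \<in> arrs C" "src C f = X" "tgt C f = Y" "X \<in> obs C" "Y \<in> obs C"
    have "far S (\<theta> Y) \<cdot> far S (far T (far S (far T f))) = far S (far S (far T f)) \<cdot> far S (\<theta> X)"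
      using arg_cong[OF \<theta>_nat[OF f(1-3)], of "far S"] by simp
    then show "mult composite Y \<cdot> far (comp_ftr composite composite) f = far composite f \<cdot> mult composite X"
      using ext_eq[OF mult_nat[OF S, of "far T f" "fob T X" "fob T Y"], of "far S (\<theta> X)"]
      by (simp add: comp_ftr_def ST_mult)
  qed (simp_all add: comp_ftr_def ST_mult)
  fix X assume X [simp]: "X \<in> obs C"
  show "mult composite X \<cdot> unit composite (fob composite X) = idn C (fob composite X)"
    using ext_eq[OF unit_nat[OF S, of "\<theta> X" "fob T (fob S (fob T X))" "fob S (fob T X)", symmetric], of "unit T (fob S (fob T X))"] \<theta>_unit_T[OF X]
      monad_laws(1)[OF S, of "fob T X"] by (simp add: ST_mult)
  have "far S (\<theta> X) \<cdot> far S (far T (unit S (fob T X))) = far S (unit S (fob T X)) \<cdot> far S (mult T X)"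
    using arg_cong[OF \<theta>_unit_S[OF X], of "far S"] by simp
  from ext_eq[OF this, of "far S (far T (unit T X))"]
  show "mult composite X \<cdot> far composite (unit composite X) = idn C (fob composite X)"
    using arg_cong[OF monad_laws(2)[OF T X], of "far S"] monad_laws(2)[OF S, of "fob T X"]
    by (simp add: ST_mult)
  \<comment> \<open>For associativity, \<open>\<theta>_mult_S\<close> pulls the inner
    \<open>mult S\<close> out, naturality of \<open>\<delta>\<close> brings the two copies of
    \<open>\<theta> X\<close> together, \<open>\<theta>_mult_T\<close> trades one of them for
    \<open>mult T\<close>, and naturality of \<open>mult S\<close> restores the composite
    multiplications.\<close>
  have "mult composite X \<cdot> far composite (mult composite X) =
      mult S (fob T X) \<cdot> far S (mult S (fob T X)) \<cdot> far S (far S (\<theta> X)) \<cdot> far S (\<delta> (fob S (fob T X))) \<cdot> far S (far T (far S (\<theta> X)))"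
    using ext_eq[of "far S (\<theta> X)"] arg_cong[OF \<theta>_mult_S[OF X], of "far S"] by (simp add: ST_mult)
  also have "\<dots> = mult S (fob T X) \<cdot> mult S (fob S (fob T X)) \<cdot> far S (far S (\<theta> X)) \<cdot> far S (far S (far T (\<theta> X))) \<cdot> far S (\<delta> (fob T (fob S (fob T X))))"
    using arg_cong[OF \<delta>_nat[of "\<theta> X" "fob T (fob S (fob T X))" "fob S (fob T X)"], of "far S"]
      ext_eq[OF monad_laws(3)[OF S, of "fob T X"]] by simp
  also have "\<dots> = mult S (fob T X) \<cdot> mult S (fob S (fob T X)) \<cdot> far S (far S (\<theta> X)) \<cdot> far S (far S (mult T (fob S (fob T X)))) \<cdot> far S (\<delta> (fob T (fob S (fob T X))))"
  proof -
    have "far S (far S (\<theta> X)) \<cdot> far S (far S (far T (\<theta> X))) = far S (far S (\<theta> X)) \<cdot> far S (far S (mult T (fob S (fob T X))))"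
      using arg_cong[OF \<theta>_mult_T[OF X], of "\<lambda>f. far S (far S f)"] by simp
    from ext_eq[OF this, of "far S (\<delta> (fob T (fob S (fob T X))))"] show ?thesis by simp
  qed
  also have "\<dots> = mult composite X \<cdot> mult composite (fob composite X)"
    using ext_eq[OF mult_nat[OF S, of "\<theta> X" "fob T (fob S (fob T X))" "fob S (fob T X)"]]
    by (simp add: ST_mult \<theta>_def[of "fob S (fob T X)"])
  finally show "mult composite X \<cdot> far composite (mult composite X) = mult composite X \<cdot> mult composite (fob composite X)" .
qed

end

end

section \<open>Coequalisers of finitary monads computed by free algebras\<close>

context colim_cat
begin

text \<open>With \<open>M\<close> as the pointed functor, the algebras of the theory
  \<open>?E\<close> are the Eilenberg-Moore algebras of \<open>M\<close> on which \<open>l\<close>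
  and \<open>r\<close> agree. The hypothesis \<open>eq\<close> says that the free
  \<open>M\<close>-algebra on \<open>X\<close> is one of them, so the quotient changes nothing at
  \<open>X\<close>.\<close>

theorem coequaliser_iso:
  fixes G :: "('o, 'a, 'o, 'a) ftr" and M P Q :: "('o, 'a) monad"
  assumes M: "finitary_monad U C M" and G: "jointly_epi_preserving G"
    and P: "free_monad C G P \<iota>"
    and L: "induced_morphism C P \<iota> M l Lt" and R: "induced_morphism C P \<iota> M r Rt"
    and Q: "fin_monad_coequaliser U C P M Lt Rt Q q"
    and X [simp]: "X \<in> obs C" and eq: "mult M X \<cdot> l (fob M X) = mult M X \<cdot> r (fob M X)"
  shows "is_iso C (q X)"
proof -
  have Mm [simp]: "is_monad C M" using M by (simp add: finitary_monad_def)
  have Pm [simp]: "is_monad C P" and \<iota>: "nat_trans C C G P \<iota>" using P by (simp_all add: free_monad_def)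
  have [simp]: "endo G" using G by (simp add: jointly_epi_preserving_def)
  have Lm: "monad_morphism C P M Lt" and L\<iota>: "\<And>X. X \<in> obs C \<Longrightarrow> Lt X \<cdot> \<iota> X = l X"
    using L by (simp_all add: induced_morphism_def)
  have Rm: "monad_morphism C P M Rt" and R\<iota>: "\<And>X. X \<in> obs C \<Longrightarrow> Rt X \<cdot> \<iota> X = r X"
    using R by (simp_all add: induced_morphism_def)
  note nat_arr[OF \<iota>, simp] nat_arr[OF morphism_nat[OF Lm], simp] nat_arr[OF morphism_nat[OF Rm], simp]
  have comp_nat: "nat_trans C C G M b" if k: "monad_morphism C P M k" and b: "\<And>X. X \<in> obs C \<Longrightarrow> k X \<cdot> \<iota> X = b X" for b k
  proof -
    note nat_arr[OF morphism_nat[OF k], simp]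
    have [simp]: "b X \<in> arrs C" "src C (b X) = fob G X" "tgt C (b X) = fob M X" if "X \<in> obs C" for X
      using b[OF that, symmetric] that by simp_all
    show ?thesis
    proof (rule natI)
      fix f X Y assume f [simp]: "f \<in> arrs C" "src C f = X" "tgt C f = Y" "X \<in> obs C" "Y \<in> obs C"
      show "b Y \<cdot> far G f = far M f \<cdot> b X"
        using nat_eq[OF \<iota> f(1-3)] ext_eq[OF nat_eq[OF morphism_nat[OF k] f(1-3)], of "\<iota> X"]
        by (simp flip: b)
    qed simp_all
  qed
  have l: "nat_trans C C G M l" using Lm L\<iota> by (rule comp_nat)
  have r: "nat_trans C C G M r" using Rm R\<iota> by (rule comp_nat)
  note nat_arr[OF l, simp] nat_arr[OF r, simp]
  \<comment> \<open>The underlying functor of \<open>M\<close>, cut down to the record type that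
    \<open>equational_theory\<close> expects.\<close>
  define H :: "('o, 'a, 'o, 'a) ftr" where "H = \<lparr>fob = fob M, far = far M\<rparr>"
  have H_sel [simp]: "fob H = fob M" "far H = far M" by (simp_all add: H_def)
  have HD: "comp_ftr H D = comp_ftr M D" for D :: "('u, 'u, 'o, 'a) ftr"
    by (simp add: comp_ftr_def)
  have [simp]: "endo H" using monad_functor[OF Mm] unfolding is_functor_def H_sel .
  then have H: "finitary U C C H"
    using M unfolding finitary_monad_def finitary_def HD H_sel by blast
  \<comment> \<open>The first equation is the compulsory one. In the second,
    \<open>unit M (fob M X)\<close> brings \<open>mult M X\<close> to depth two, and evaluation
    gives associativity of the action. In the third, \<open>far M (unit M X)\<close> does the same
    for \<open>l\<close> and \<open>r\<close>.\<close>
  let ?E = "{(H, \<lambda>X. far M (unit M X), \<lambda>X. unit M (fob M X)),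
    (comp_ftr H H, \<lambda>X. idn C (fob M (fob M X)), \<lambda>X. unit M (fob M X) \<cdot> mult M X),
    (G, \<lambda>X. far M (unit M X) \<cdot> l X, \<lambda>X. far M (unit M X) \<cdot> r X)}"
  have nat_unit: "nat_trans C C id_ftr H (unit M)"
    by (rule natI) (simp_all add: id_ftr_def unit_nat)
  have Hunit: "far M (unit M Y) \<cdot> far M f = far M (far M f) \<cdot> far M (unit M X)"
    if [simp]: "f \<in> arrs C" "src C f = X" "tgt C f = Y" "X \<in> obs C" "Y \<in> obs C" for f X Y
    using arg_cong[OF unit_nat[OF Mm that(1-3)], of "far M"] by simp
  have n1: "nat_trans C C H (comp_ftr H H) (\<lambda>X. far H (unit M X))"
    by (rule natI) (simp_all add: comp_ftr_def Hunit)
  have n2: "nat_trans C C H (comp_ftr H H) (\<lambda>X. unit M (fob H X))"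
    by (rule natI) (simp_all add: comp_ftr_def unit_nat)
  have n3: "nat_trans C C (comp_ftr H H) (comp_ftr H H) (\<lambda>X. idn C (fob M (fob M X)))"
    by (rule natI) (simp_all add: comp_ftr_def)
  have n4: "nat_trans C C (comp_ftr H H) (comp_ftr H H) (\<lambda>X. unit M (fob M X) \<cdot> mult M X)"
  proof (rule natI)
    fix f X Y assume f [simp]: "f \<in> arrs C" "src C f = X" "tgt C f = Y" "X \<in> obs C" "Y \<in> obs C"
    show "(unit M (fob M Y) \<cdot> mult M Y) \<cdot> far (comp_ftr H H) f = far (comp_ftr H H) f \<cdot> unit M (fob M X) \<cdot> mult M X"
      using mult_nat[OF Mm f(1-3)] ext_eq[OF unit_nat[OF Mm, of "far M f" "fob M X" "fob M Y"], of "mult M X"]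
      by (simp add: comp_ftr_def)
  qed (simp_all add: comp_ftr_def)
  have n5: "nat_trans C C G (comp_ftr H H) (\<lambda>X. far M (unit M X) \<cdot> b X)" if b: "nat_trans C C G M b" for b
  proof (rule natI)
    note nat_arr[OF b, simp]
    fix f X Y assume f [simp]: "f \<in> arrs C" "src C f = X" "tgt C f = Y" "X \<in> obs C" "Y \<in> obs C"
    show "(far M (unit M Y) \<cdot> b Y) \<cdot> far G f = far (comp_ftr H H) f \<cdot> far M (unit M X) \<cdot> b X"
      using nat_eq[OF b f(1-3)] ext_eq[OF Hunit[OF f], of "b X"] by (simp add: comp_ftr_def)
  qed (use nat_arr[OF b] in \<open>simp_all add: comp_ftr_def\<close>)
  interpret T: equational_theory C U H "unit M" ?E
    by unfold_locales
      (use H nat_unit n1 n2 n3 n4 n5[OF l] n5[OF r] G finitary_jointly_epi[OF H] finitary_jointly_epi[OF finitary_comp[OF H H]] in auto)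
  obtain F \<zeta> where F: "finitary_monad U C F" and \<zeta>: "nat_trans C C H F \<zeta>"
    and \<zeta>u: "\<And>X. X \<in> obs C \<Longrightarrow> \<zeta> X \<cdot> unit M X = unit F X"
    and freeF: "\<And>X. X \<in> obs C \<Longrightarrow> T.free_alg X (fob F X) (unit F X) (mult F X \<cdot> \<zeta> (fob F X))"
    and univ: "\<And>N \<beta>. is_monad C N \<Longrightarrow> nat_trans C C H N \<beta> \<Longrightarrow> (\<And>X. X \<in> obs C \<Longrightarrow> \<beta> X \<cdot> unit M X = unit N X) \<Longrightarrow>
       (\<And>G l r X. (G, l, r) \<in> ?E \<Longrightarrow> X \<in> obs C \<Longrightarrow>
          mult N X \<cdot> far N (\<beta> X) \<cdot> \<beta> (fob H X) \<cdot> l X = mult N X \<cdot> far N (\<beta> X) \<cdot> \<beta> (fob H X) \<cdot> r X) \<Longrightarrow>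
       \<exists>k. monad_morphism C F N k \<and> (\<forall>X\<in>obs C. k X \<cdot> \<zeta> X = \<beta> X)"
    by (rule T.free_algebra_monad) blast
  have Fm [simp]: "is_monad C F" using F by (simp add: finitary_monad_def)
  have \<zeta>': "nat_trans C C M F \<zeta>" using \<zeta> by (simp add: nat_trans_def)
  note nat_arr[OF \<zeta>', simp]
  let ?a = "\<lambda>X. mult F X \<cdot> \<zeta> (fob F X)"
  have a_alg: "T.alg (fob F X) (?a X)" if "X \<in> obs C" for X using T.free_alg_alg[OF freeF[OF that]] .
  have a_unit: "?a X \<cdot> unit M (fob F X) = idn C (fob F X)" if "X \<in> obs C" for X
    using a_alg[OF that] unfolding T.alg_def by simp
  have a_mult: "?a X \<cdot> far M (?a X) = ?a X \<cdot> mult M (fob F X)" if X [simp]: "X \<in> obs C" for X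
  proof -
    have "?a X \<cdot> far M (?a X) = ?a X \<cdot> far M (?a X) \<cdot> unit M (fob M (fob F X)) \<cdot> mult M (fob F X)"
      using T.alg_eq[OF a_alg[OF X], of "comp_ftr H H" "\<lambda>X. idn C (fob M (fob M X))" "\<lambda>X. unit M (fob M X) \<cdot> mult M X"]
      by simp
    also have "\<dots> = ?a X \<cdot> unit M (fob F X) \<cdot> ?a X \<cdot> mult M (fob F X)"
      using ext_eq[OF unit_nat[OF Mm, of "?a X" "fob M (fob F X)" "fob F X"], of "mult M (fob F X)"] by simp
    also have "\<dots> = ?a X \<cdot> mult M (fob F X)"
      using ext_eq[OF a_unit[OF X], of "?a X \<cdot> mult M (fob F X)"] by simp
    finally show ?thesis .
  qed
  have a_\<zeta>: "?a X \<cdot> far M (unit F X) = \<zeta> X" if X [simp]: "X \<in> obs C" for X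
    using nat_eq[OF \<zeta>', of "unit F X" X "fob F X"] ext_eq[OF monad_laws(2)[OF Fm X], of "\<zeta> X"] by simp
  have \<zeta>m: "monad_morphism C M F \<zeta>"
    unfolding monad_morphism_def
  proof (intro conjI ballI \<zeta>')
    fix X assume X [simp]: "X \<in> obs C"
    show "\<zeta> X \<cdot> unit M X = unit F X" by (simp add: \<zeta>u)
    have "\<zeta> X \<cdot> mult M X = ?a X \<cdot> far M (unit F X) \<cdot> mult M X"
      using ext_eq[OF a_\<zeta>[OF X], of "mult M X"] by simp
    also have "\<dots> = (?a X \<cdot> far M (?a X)) \<cdot> far M (far M (unit F X))"
      unfolding a_mult[OF X] using mult_nat[OF Mm, of "unit F X" X "fob F X"] by simp
    also have "\<dots> = ?a X \<cdot> far M (?a X \<cdot> far M (unit F X))" by simp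
    also have "\<dots> = ?a X \<cdot> far M (\<zeta> X)" by (simp only: a_\<zeta>[OF X])
    also have "\<dots> = mult F X \<cdot> far F (\<zeta> X) \<cdot> \<zeta> (fob M X)"
      using nat_eq[OF \<zeta>', of "\<zeta> X" "fob M X" "fob F X"] by simp
    finally show "\<zeta> X \<cdot> mult M X = mult F X \<cdot> far F (\<zeta> X) \<cdot> \<zeta> (fob M X)" .
  qed
  \<comment> \<open>The third equation in the free algebra on \<open>X\<close>, pulled back along
    the generators \<open>unit F X\<close>.\<close>
  have \<zeta>lr: "\<zeta> X \<cdot> l X = \<zeta> X \<cdot> r X" if X [simp]: "X \<in> obs C" for X
  proof -
    have 1: "?a X \<cdot> far M (?a X) \<cdot> far M (unit M (fob F X)) \<cdot> z = ?a X \<cdot> z"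
      if [simp]: "z \<in> arrs C" "tgt C z = fob M (fob F X)" for z
    proof -
      have "far M (?a X) \<cdot> far M (unit M (fob F X)) = idn C (fob M (fob F X))"
        using arg_cong[OF a_unit[OF X], of "far M"] by simp
      from ext_eq[OF this, of z] show ?thesis by simp
    qed
    have "?a X \<cdot> l (fob F X) = ?a X \<cdot> r (fob F X)"
      using T.alg_eq[OF a_alg[OF X], of G "\<lambda>X. far M (unit M X) \<cdot> l X" "\<lambda>X. far M (unit M X) \<cdot> r X"] 1 by simp
    then have e: "(?a X \<cdot> l (fob F X)) \<cdot> far G (unit F X) = (?a X \<cdot> r (fob F X)) \<cdot> far G (unit F X)" by simp
    have *: "(?a X \<cdot> b (fob F X)) \<cdot> far G (unit F X) = \<zeta> X \<cdot> b X" if b: "nat_trans C C G M b" for b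
      using nat_arr[OF b] nat_eq[OF b, of "unit F X" X "fob F X"] ext_eq[OF a_\<zeta>[OF X], of "b X"] by simp
    show ?thesis using e unfolding *[OF l] *[OF r] .
  qed
  \<comment> \<open>For a monad morphism out of \<open>M\<close> the first two equations of
    \<open>?E\<close> hold by the monad laws, so agreement on \<open>l\<close> and \<open>r\<close>
    is the only condition left.\<close>
  have ex: "\<exists>k. monad_morphism C F N k \<and> (\<forall>X\<in>obs C. k X \<cdot> \<zeta> X = \<beta> X)"
    if N [simp]: "is_monad C N" and \<beta>: "monad_morphism C M N \<beta>" and \<beta>lr: "\<And>X. X \<in> obs C \<Longrightarrow> \<beta> X \<cdot> l X = \<beta> X \<cdot> r X" for N \<beta>
  proof (rule univ[OF N])
    note nat_arr[OF morphism_nat[OF \<beta>], simp]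
    show "nat_trans C C H N \<beta>" using morphism_nat[OF \<beta>] by (simp add: nat_trans_def)
    show "\<beta> X \<cdot> unit M X = unit N X" if "X \<in> obs C" for X using morphism_laws(1)[OF \<beta> that] .
    fix G' l' r' X assume e: "(G', l', r') \<in> ?E" and X [simp]: "X \<in> obs C"
    have *: "mult N X \<cdot> far N (\<beta> X) \<cdot> \<beta> (fob M X) \<cdot> z = \<beta> X \<cdot> mult M X \<cdot> z"
      if [simp]: "z \<in> arrs C" "tgt C z = fob M (fob M X)" for z
      using ext_eq[OF morphism_laws(2)[OF \<beta> X], of z] by simp
    show "mult N X \<cdot> far N (\<beta> X) \<cdot> \<beta> (fob H X) \<cdot> l' X = mult N X \<cdot> far N (\<beta> X) \<cdot> \<beta> (fob H X) \<cdot> r' X"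
      using e *[of "idn C (fob M (fob M X))"] monad_laws(1,2)[OF Mm X] ext_eq[OF monad_laws(1)[OF Mm X], of "mult M X"]
        ext_eq[OF monad_laws(2)[OF Mm X], of "l X"] ext_eq[OF monad_laws(2)[OF Mm X], of "r X"] \<beta>lr[OF X]
      by (auto simp: *)
  qed
  \<comment> \<open>\<open>Q\<close> is specified by \<open>Lt\<close> and \<open>Rt\<close>, the
    theory by \<open>l\<close> and \<open>r\<close>. Two monad morphisms out of the free monad
    \<open>P\<close> that agree after \<open>\<iota>\<close> are equal, which carries the agreement
    from \<open>l\<close> and \<open>r\<close> to \<open>Lt\<close> and \<open>Rt\<close>.\<close>
  have "\<zeta> X \<cdot> Lt X = \<zeta> X \<cdot> Rt X" if "X \<in> obs C" for X
  proof -
    have "induced_morphism C P \<iota> F (\<lambda>X. \<zeta> X \<cdot> l X) (\<lambda>X. \<zeta> X \<cdot> Lt X)"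
      "induced_morphism C P \<iota> F (\<lambda>X. \<zeta> X \<cdot> l X) (\<lambda>X. \<zeta> X \<cdot> Rt X)"
      using morphism_comp[OF Pm Mm Fm Lm \<zeta>m] morphism_comp[OF Pm Mm Fm Rm \<zeta>m]
      by (simp_all add: induced_morphism_def L\<iota> R\<iota> \<zeta>lr)
    moreover have "nat_trans C C G F (\<lambda>X. \<zeta> X \<cdot> l X)"
    proof (rule natI)
      fix f X Y assume f [simp]: "f \<in> arrs C" "src C f = X" "tgt C f = Y" "X \<in> obs C" "Y \<in> obs C"
      show "(\<zeta> Y \<cdot> l Y) \<cdot> far G f = far F f \<cdot> \<zeta> X \<cdot> l X"
        using nat_eq[OF l f(1-3)] ext_eq[OF nat_eq[OF \<zeta>' f(1-3)], of "l X"] by simp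
    qed simp_all
    ultimately show ?thesis using P Fm that unfolding free_monad_def by blast
  qed
  then obtain k where "induced_morphism C Q q F \<zeta> k"
    using Q F \<zeta>m unfolding fin_monad_coequaliser_def by blast
  then have k: "monad_morphism C Q F k" and kq: "\<And>X. X \<in> obs C \<Longrightarrow> k X \<cdot> q X = \<zeta> X"
    by (simp_all add: induced_morphism_def)
  have Qf: "finitary_monad U C Q" and q: "monad_morphism C M Q q"
    and qLR: "\<And>X. X \<in> obs C \<Longrightarrow> q X \<cdot> Lt X = q X \<cdot> Rt X"
    using Q by (simp_all add: fin_monad_coequaliser_def)
  have Qm [simp]: "is_monad C Q" using Qf by (simp add: finitary_monad_def)
  note nat_arr[OF morphism_nat[OF q], simp] nat_arr[OF morphism_nat[OF k], simp]
  have "q X \<cdot> l X = q X \<cdot> r X" if X [simp]: "X \<in> obs C" for X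
    using ext_eq[OF qLR[OF X], of "\<iota> X"] by (simp add: L\<iota> R\<iota>)
  from ex[OF Qm q this] obtain k' where k': "monad_morphism C F Q k'"
    and k'\<zeta>: "\<And>X. X \<in> obs C \<Longrightarrow> k' X \<cdot> \<zeta> X = q X" by blast
  note nat_arr[OF morphism_nat[OF k'], simp]
  have "induced_morphism C Q q Q q (\<lambda>X. k' X \<cdot> k X)"
    using morphism_comp[OF Qm Fm Qm k k'] by (simp add: induced_morphism_def kq k'\<zeta>)
  moreover have "induced_morphism C Q q Q q (\<lambda>X. idn C (fob Q X))"
    using morphism_idn[OF Qm] by (simp add: induced_morphism_def)
  ultimately have k'k: "k' X \<cdot> k X = idn C (fob Q X)" if "X \<in> obs C" for X
    using that Q Qf q qLR unfolding fin_monad_coequaliser_def by blast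
  \<comment> \<open>Only the third equation uses \<open>eq\<close>; the others hold in every free
    \<open>M\<close>-algebra.\<close>
  have M_alg: "T.alg (fob M X) (mult M X)"
  proof -
    have *: "mult M X \<cdot> far M (mult M X) \<cdot> far M (unit M (fob M X)) \<cdot> z = mult M X \<cdot> z"
      if [simp]: "z \<in> arrs C" "tgt C z = fob M (fob M X)" for z
    proof -
      have "far M (mult M X) \<cdot> far M (unit M (fob M X)) = idn C (fob M (fob M X))"
        using arg_cong[OF monad_laws(1)[OF Mm X], of "far M"] by simp
      from ext_eq[OF this, of z] show ?thesis by simp
    qed
    have **: "mult M X \<cdot> far M (mult M X) \<cdot> z = mult M X \<cdot> mult M (fob M X) \<cdot> z"
      if [simp]: "z \<in> arrs C" "tgt C z = fob M (fob M (fob M X))" for z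
      using ext_eq[OF monad_laws(3)[OF Mm X], of z] by simp
    have "mult M X \<cdot> far M (mult M X) \<cdot> l' (fob M X) = mult M X \<cdot> far M (mult M X) \<cdot> r' (fob M X)"
      if "(G', l', r') \<in> ?E" for G' l' r'
    proof -
      from that consider "l' = (\<lambda>X. far M (unit M X))" "r' = (\<lambda>X. unit M (fob M X))"
        | "l' = (\<lambda>X. idn C (fob M (fob M X)))" "r' = (\<lambda>X. unit M (fob M X) \<cdot> mult M X)"
        | "l' = (\<lambda>X. far M (unit M X) \<cdot> l X)" "r' = (\<lambda>X. far M (unit M X) \<cdot> r X)"
        by auto
      then show ?thesis
      proof cases
        case 1
        then show ?thesis
          using **[of "far M (unit M (fob M X))"] **[of "unit M (fob M (fob M X))"]
            monad_laws(1,2)[OF Mm, of "fob M X"] by simp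
      next
        case 2
        then show ?thesis
          using **[of "unit M (fob M (fob M X)) \<cdot> mult M (fob M X)"] monad_laws(3)[OF Mm X]
            ext_eq[OF monad_laws(1)[OF Mm, of "fob M X"], of "mult M (fob M X)"] by simp
      next
        case 3
        then show ?thesis using * eq by simp
      qed
    qed
    then have "\<forall>(G', l', r')\<in>?E. mult M X \<cdot> far H (mult M X) \<cdot> l' (fob M X) = mult M X \<cdot> far H (mult M X) \<cdot> r' (fob M X)"
      unfolding H_sel by blast
    then show ?thesis
      unfolding T.alg_def using monad_laws(1)[OF Mm X] by (intro conjI) simp_all
  qed
  obtain h where h: "T.alg_hom (fob F X) (?a X) (fob M X) (mult M X) h" "h \<cdot> unit F X = unit M X"
    using T.free_alg_ext[OF freeF[OF X] M_alg, of "unit M X"] by auto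
  then have ha [simp]: "h \<in> arrs C" "src C h = fob F X" "tgt C h = fob M X" and hm: "h \<cdot> ?a X = mult M X \<cdot> far M h"
    by (simp_all add: T.alg_hom_def)
  have "h \<cdot> \<zeta> X = (h \<cdot> ?a X) \<cdot> far M (unit F X)"
    using a_\<zeta>[OF X] by simp
  also have "\<dots> = mult M X \<cdot> far M (h \<cdot> unit F X)" unfolding hm by simp
  also have "\<dots> = idn C (fob M X)" unfolding h(2) by (rule monad_laws(2)[OF Mm X])
  finally have h\<zeta>: "h \<cdot> \<zeta> X = idn C (fob M X)" .
  have "\<zeta> X \<cdot> h = idn C (fob F X)"
  proof (rule T.free_alg_unique[OF freeF[OF X] a_alg[OF X]])
    have "T.alg_hom (fob M X) (mult M X) (fob F X) (?a X) (\<zeta> X)"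
      using morphism_laws(2)[OF \<zeta>m X] nat_eq[OF \<zeta>', of "\<zeta> X" "fob M X" "fob F X"] by (simp add: T.alg_hom_def)
    then show "T.alg_hom (fob F X) (?a X) (fob F X) (?a X) (\<zeta> X \<cdot> h)"
      by (rule T.alg_hom_comp[OF a_alg[OF X] M_alg a_alg[OF X] h(1)])
    show "T.alg_hom (fob F X) (?a X) (fob F X) (?a X) (idn C (fob F X))"
      by (rule T.alg_hom_idn[OF a_alg[OF X]])
    show "(\<zeta> X \<cdot> h) \<cdot> unit F X = idn C (fob F X) \<cdot> unit F X"
      using h(2) \<zeta>u[OF X] by simp
  qed
  \<comment> \<open>Now \<open>\<zeta> X\<close> and \<open>h\<close> are inverse to each other.
    Since \<open>q X\<close> is \<open>k' X \<cdot> \<zeta> X\<close> and \<open>k' X\<close>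
    retracts \<open>k X\<close>, the inverse of \<open>q X\<close> is
    \<open>h \<cdot> k X\<close>.\<close>
  then have "q X \<cdot> h \<cdot> k X = idn C (fob Q X)"
    using k'\<zeta>[OF X, symmetric] ext_eq[of "\<zeta> X" h "idn C (fob F X)" "k X"] k'k[OF X] by simp
  moreover have "(h \<cdot> k X) \<cdot> q X = idn C (fob M X)"
    using kq[OF X] h\<zeta> by simp
  ultimately show ?thesis
    unfolding is_iso_def by (intro conjI bexI[of _ "h \<cdot> k X"]) simp_all
qed

end

section \<open>Structural equational systems\<close>

context base_cat
begin

lemma bifunctor_arr:
  assumes "is_functor (prod_cat C C) C \<Theta>" "f \<in> arrs C" "g \<in> arrs C"
  shows "far \<Theta> (f, g) \<in> arrs C" "src C (far \<Theta> (f, g)) = fob \<Theta> (src C f, src C g)"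
    "tgt C (far \<Theta> (f, g)) = fob \<Theta> (tgt C f, tgt C g)"
  using assms by (auto simp: is_functor_def prod_cat_def)

lemma bifunctor_comp:
  assumes \<Theta>: "is_functor (prod_cat C C) C \<Theta>"
    and f: "f \<in> arrs C" "g \<in> arrs C" "tgt C f = src C g"
    and f': "f' \<in> arrs C" "g' \<in> arrs C" "tgt C f' = src C g'"
  shows "far \<Theta> (g, g') \<cdot> far \<Theta> (f, f') = far \<Theta> (g \<cdot> f, g' \<cdot> f')"
proof -
  have "(f, f') \<in> arrs (prod_cat C C)" "(g, g') \<in> arrs (prod_cat C C)"
    "tgt (prod_cat C C) (f, f') = src (prod_cat C C) (g, g')"
    using f f' by (simp_all add: prod_cat_def)
  then have "far \<Theta> (cmp (prod_cat C C) (g, g') (f, f')) = far \<Theta> (g, g') \<cdot> far \<Theta> (f, f')"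
    using \<Theta> unfolding is_functor_def by blast
  then show ?thesis by (simp add: prod_cat_def)
qed

lemma bifunctor_idn:
  assumes "is_functor (prod_cat C C) C \<Theta>" "X \<in> obs C" "Y \<in> obs C"
  shows "far \<Theta> (idn C X, idn C Y) = idn C (fob \<Theta> (X, Y))" "fob \<Theta> (X, Y) \<in> obs C"
  using assms by (auto simp: is_functor_def prod_cat_def)

lemma initial_iso:
  assumes Z: "initial_object C Z" and f: "is_iso C f" "src C f = Z"
  shows "initial_object C (tgt C f)"
proof -
  obtain g where g: "g \<in> arrs C" "src C g = tgt C f" "tgt C g = Z" "f \<cdot> g = idn C (tgt C f)" and fa: "f \<in> arrs C"
    using f by (auto simp: is_iso_def)
  have "\<exists>!h. h \<in> hom C (tgt C f) X" if X: "X \<in> obs C" for X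
  proof -
    have Z1: "\<exists>!h. h \<in> hom C Z X" using Z X by (simp add: initial_object_def)
    then obtain h where h: "h \<in> hom C Z X" by blast
    have "k = h \<cdot> g" if k: "k \<in> hom C (tgt C f) X" for k
    proof -
      have "k \<cdot> f = h" using Z1 h k fa f(2) by (metis cmp_arr in_hom)
      then have "h \<cdot> g = k \<cdot> f \<cdot> g" using k fa f g h by auto
      then show ?thesis using g k by simp
    qed
    moreover have "h \<cdot> g \<in> hom C (tgt C f) X" using h g by simp
    ultimately show ?thesis by blast
  qed
  then show ?thesis using fa by (simp add: initial_object_def)
qed

end

locale structural_setting = coprod_cat C U cp
  for C :: "('o, 'a) cat" (structure) and U :: "'u set" and cp :: "('o, 'a) coprods" +
  fixes \<Sigma> :: "('o, 'a, 'o, 'a) ftr" and S T :: "('o, 'a) monad" and \<eta>\<Sigma> \<delta> :: "'o \<Rightarrow> 'a"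
    and \<Theta> :: "('o, 'a) bifunctor" and d :: "'o \<times> 'o \<Rightarrow> 'a"
  assumes finitary_\<Sigma>: "finitary U C C \<Sigma>" and free_S: "free_monad C \<Sigma> S \<eta>\<Sigma>"
    and finitary_T: "finitary_monad U C T" and \<delta>: "distributive_law C S T \<delta>"
    and law: "incremental_structural_law U C cp \<Sigma> S T \<delta> \<Theta> d"
begin

abbreviation "ST \<equiv> composite_monad C S T \<delta>"

lemma S [simp]: "is_monad C S"
  using free_S by (simp add: free_monad_def)

lemma T [simp]: "is_monad C T"
  using finitary_T by (simp add: finitary_monad_def)

lemma functor_\<Sigma> [simp]: "endo \<Sigma>"
  using finitary_\<Sigma> by (rule finitary_functor)

lemma \<eta>\<Sigma>: "nat_trans C C \<Sigma> S \<eta>\<Sigma>"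
  using free_S by (simp add: free_monad_def)

lemmas \<eta>\<Sigma>_arr [simp] = nat_arr[OF \<eta>\<Sigma>]
lemmas ST_monad [simp] = is_monad_ST[OF S T \<delta>]
lemmas ST_sel = ST_simps[OF S T \<delta>]
lemmas \<delta>_arrs [simp] = \<delta>_arr[OF S T \<delta>]

lemma \<Theta>: "is_functor (prod_cat C C) C \<Theta>"
  using law by (simp add: incremental_structural_law_def)

lemmas \<Theta>_arr [simp] = bifunctor_arr[OF \<Theta>]
lemmas \<Theta>_comp [simp] = bifunctor_comp[OF \<Theta>]
lemmas \<Theta>_idn [simp] = bifunctor_idn[OF \<Theta>]

lemma \<Theta>_comp' [simp]:
  assumes "f \<in> arrs C" "g \<in> arrs C" "tgt C f = src C g" "f' \<in> arrs C" "g' \<in> arrs C" "tgt C f' = src C g'"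
    "x \<in> arrs C" "tgt C x = fob \<Theta> (src C f, src C f')"
  shows "far \<Theta> (g, g') \<cdot> far \<Theta> (f, f') \<cdot> x = far \<Theta> (g \<cdot> f, g' \<cdot> f') \<cdot> x"
  using assms by (intro ext_eq) simp_all

lemma cocontinuous_\<Theta>:
  "Y \<in> obs C \<Longrightarrow> cocontinuous U C C \<lparr>fob = (\<lambda>X. fob \<Theta> (X, Y)), far = (\<lambda>f. far \<Theta> (f, idn C Y))\<rparr>"
  using law by (simp add: incremental_structural_law_def)

lemma finitary_\<Theta>:
  "X \<in> obs C \<Longrightarrow> finitary U C C \<lparr>fob = (\<lambda>Y. fob \<Theta> (X, Y)), far = (\<lambda>g. far \<Theta> (idn C X, g))\<rparr>"
  using law by (simp add: incremental_structural_law_def)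

lemma finitary_S: "finitary U C C S"
  using finitary_\<Sigma> free_S by (rule finitary_free_monad)

lemma finitary_ST: "finitary_monad U C ST"
proof -
  have "finitary U C C (comp_ftr S T)"
    using finitary_comp[OF finitary_S, of T] finitary_T by (simp add: finitary_monad_def)
  moreover have "fob (comp_ftr S T) = fob ST" "far (comp_ftr S T) = far ST"
    by (simp_all add: comp_ftr_def composite_monad_def)
  moreover have "comp_ftr (comp_ftr S T) D = comp_ftr ST D" for D :: "('u, 'u, 'o, 'a) ftr"
    by (simp add: comp_ftr_def composite_monad_def)
  ultimately have "finitary U C C ST"
    using monad_functor[OF ST_monad] unfolding finitary_def by simp
  then show ?thesis by (simp add: finitary_monad_def)
qed

lemma d_nat:
  assumes "f \<in> arrs C" "g \<in> arrs C" "src C f = X" "tgt C f = X'" "src C g = Y" "tgt C g = Y'"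
  shows "d (X', Y') \<cdot> far \<Theta> (far \<Sigma> f, g) =
    far ST (sum_map C cp (far \<Theta> (f, far ST g)) (sum_map C cp f g)) \<cdot> d (X, Y)"
  using law assms by (auto simp: incremental_structural_law_def nat_trans_def prod_cat_def Let_def)

lemma d_arr [simp]:
  assumes "X \<in> obs C" "Y \<in> obs C"
  shows "d (X, Y) \<in> arrs C" "src C (d (X, Y)) = fob \<Theta> (fob \<Sigma> X, Y)"
    "tgt C (d (X, Y)) = fob ST (csum cp (fob \<Theta> (X, fob ST Y)) (csum cp X Y))"
  using law assms by (auto simp: incremental_structural_law_def nat_trans_def prod_cat_def Let_def)

text \<open>Agreement is given only on the diagonal arrows, with the same index in both arguments.
  Filteredness extends it to all pairs of indices. Then the legs are removed in the second argument,
  with the first one fixed, where \<open>\<Theta>\<close> is finitary, and finally in the first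
  argument, where it is cocontinuous.\<close>

lemma jointly_epi_theta: "jointly_epi_preserving (theta_ftr \<Theta> S)"
  unfolding jointly_epi_preserving_def
proof (intro conjI allI impI ballI)
  show "endo (theta_ftr \<Theta> S)"
    unfolding is_functor_def by (simp add: theta_ftr_def)
  fix J :: "('u, 'u) cat" and D A c u v
  assume *: "small_category U J \<and> filtered J \<and> is_colimit J C D A c"
    and uv [simp]: "u \<in> arrs C" "v \<in> arrs C"
    and **: "src C u = fob (theta_ftr \<Theta> S) A \<and> src C v = fob (theta_ftr \<Theta> S) A \<and> tgt C u = tgt C v \<and>
      (\<forall>i\<in>obs J. u \<cdot> far (theta_ftr \<Theta> S) (c i) = v \<cdot> far (theta_ftr \<Theta> S) (c i))"
  then have J: "small_category U J" "filtered J" and A: "is_colimit J C D A c"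
    and [simp]: "src C u = fob \<Theta> (A, fob S A)" "src C v = fob \<Theta> (A, fob S A)" "tgt C v = tgt C u"
    and eq: "\<And>i. i \<in> obs J \<Longrightarrow> u \<cdot> far \<Theta> (c i, far S (c i)) = v \<cdot> far \<Theta> (c i, far S (c i))"
    by (simp_all add: theta_ftr_def)
  have cJ: "category J" using J by (simp add: small_category_def)
  have D: "is_functor J C D" using A by (simp add: is_colimit_def cocone_def)
  note colimit_arr[OF A, simp] colimit_obs[OF A, simp]
  have Dobs [simp]: "fob D i \<in> obs C" if "i \<in> obs J" for i using D that by (simp add: is_functor_def)
  have SA: "is_colimit J C (comp_ftr S D) (fob S A) (\<lambda>i. far S (c i))"
    using finitary_S J A unfolding finitary_def by blast
  have ij: "u \<cdot> far \<Theta> (c i, far S (c j)) = v \<cdot> far \<Theta> (c i, far S (c j))"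
    if ij [simp]: "i \<in> obs J" "j \<in> obs J" for i j
  proof -
    obtain k w w' where k [simp]: "k \<in> obs J" and w: "w \<in> hom J i k" "w' \<in> hom J j k"
      using J(2) ij unfolding filtered_def by blast
    have cw: "c k \<cdot> far D w = c i" "c k \<cdot> far D w' = c j"
      using A w by (auto simp: is_colimit_def cocone_def)
    have [simp]: "far D w \<in> arrs C" "src C (far D w) = fob D i" "tgt C (far D w) = fob D k"
      "far D w' \<in> arrs C" "src C (far D w') = fob D j" "tgt C (far D w') = fob D k"
      using diagram_arr[OF D, of w] diagram_arr[OF D, of w'] w by simp_all
    have "far \<Theta> (c i, far S (c j)) = far \<Theta> (c k, far S (c k)) \<cdot> far \<Theta> (far D w, far S (far D w'))"
      by (simp flip: cw)
    then show ?thesis using ext_eq[OF eq[OF k], of "far \<Theta> (far D w, far S (far D w'))"] by simp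
  qed
  have "u \<cdot> far \<Theta> (c i, idn C (fob S A)) = v \<cdot> far \<Theta> (c i, idn C (fob S A))" if i [simp]: "i \<in> obs J" for i
  proof (rule jointly_epi_preserving_D[OF finitary_jointly_epi[OF finitary_\<Theta>[OF Dobs[OF i]]] J SA])
    fix j assume [simp]: "j \<in> obs J"
    show "(u \<cdot> far \<Theta> (c i, idn C (fob S A))) \<cdot> far \<lparr>fob = \<lambda>Y. fob \<Theta> (fob D i, Y), far = \<lambda>g. far \<Theta> (idn C (fob D i), g)\<rparr> (far S (c j)) =
        (v \<cdot> far \<Theta> (c i, idn C (fob S A))) \<cdot> far \<lparr>fob = \<lambda>Y. fob \<Theta> (fob D i, Y), far = \<lambda>g. far \<Theta> (idn C (fob D i), g)\<rparr> (far S (c j))"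
      using ij[of i j] by simp
  qed simp_all
  moreover have "is_colimit J C (comp_ftr \<lparr>fob = (\<lambda>X. fob \<Theta> (X, fob S A)), far = (\<lambda>f. far \<Theta> (f, idn C (fob S A)))\<rparr> D)
      (fob \<Theta> (A, fob S A)) (\<lambda>i. far \<Theta> (c i, idn C (fob S A)))"
    using cocontinuous_\<Theta>[of "fob S A"] J A unfolding cocontinuous_def by auto
  ultimately show "u = v"
    using colimit_epi[OF cJ] uv by simp
qed

section \<open>The recursion along the free algebra \<open>I\<close>\<close>

context
  fixes X :: 'o
  assumes X [simp]: "X \<in> obs C"
begin

abbreviation "I \<equiv> fob S (fob T X)"

definition act :: "'a" where "act = mult ST X"

definition interp :: "('o \<Rightarrow> 'a) \<Rightarrow> 'a" where "interp K = act \<cdot> K I"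

lemma act_arr [simp]: "act \<in> arrs C" "src C act = fob S (fob T I)" "tgt C act = I"
  using monad_arr(4-6)[OF ST_monad X] by (simp_all add: act_def ST_sel)

text \<open>By \<open>\<theta>_unit_T\<close>, forgetting the \<open>T\<close>-part of the action
  leaves the free \<open>S\<close>-algebra on \<open>fob T X\<close>. In \<open>act_\<delta>\<close>
  this trades \<open>mult S\<close> for \<open>act\<close>, to which associativity applies.\<close>

lemma act_S: "act \<cdot> far S (unit T I) = mult S (fob T X)"
proof -
  have "act \<cdot> far S (unit T I) = mult S (fob T X) \<cdot> far S (\<theta> S T \<delta> X \<cdot> unit T I)"
    using \<theta>_arr[OF S T \<delta> X] by (simp add: act_def ST_mult[OF S T \<delta>])
  then show ?thesis by (simp add: \<theta>_unit_T[OF S T \<delta> X])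
qed

lemma act_assoc: "act \<cdot> far S (far T act) = act \<cdot> mult ST I"
  using monad_laws(3)[OF ST_monad X] by (simp add: act_def ST_sel)

lemma act_unit: "act \<cdot> unit ST I = idn C I"
  using monad_laws(1)[OF ST_monad X] by (simp add: act_def ST_sel)

text \<open>The composite \<open>mult S (fob T I) \<cdot> far S (\<delta> I)\<close> occurs both in
  the defining equation of an interpretation and in \<open>theta_interp\<close>. After
  \<open>act\<close> it takes a form to which naturality of an interpretation applies, as
  \<open>act_\<delta>_K\<close> shows.\<close>

lemma act_\<delta>: "act \<cdot> mult S (fob T I) \<cdot> far S (\<delta> I) = act \<cdot> far S (far T (mult S (fob T X)))"
proof -
  have "act \<cdot> far S (far T (mult S (fob T X))) = act \<cdot> far S (far T act) \<cdot> far S (far T (far S (unit T I)))"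
    by (simp flip: act_S)
  also have "\<dots> = act \<cdot> mult ST I \<cdot> far S (far T (far S (unit T I)))"
    using ext_eq[OF act_assoc, of "far S (far T (far S (unit T I)))"] monad_arr(4-6)[OF ST_monad, of I] by (simp add: ST_sel)
  also have "\<dots> = act \<cdot> mult S (fob T I) \<cdot> far S (far S (mult T I)) \<cdot> far S (\<delta> (fob T I) \<cdot> far T (far S (unit T I)))"
    by (simp add: composite_monad_def)
  also have "\<dots> = act \<cdot> mult S (fob T I) \<cdot> far S (far S (mult T I \<cdot> far T (unit T I))) \<cdot> far S (\<delta> I)"
    by (simp add: \<delta>_nat[OF S T \<delta>, of "unit T I" I "fob T I"])
  also have "\<dots> = act \<cdot> mult S (fob T I) \<cdot> far S (\<delta> I)"
    by (simp add: monad_laws(2))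
  finally show ?thesis ..
qed

lemma mult_S_unit: "mult S (fob T X) \<cdot> unit S I = idn C I"
  by (simp add: monad_laws(1))

context
  fixes K :: "'o \<Rightarrow> 'a"
  assumes K: "structural_interpretation C cp S \<eta>\<Sigma> T \<delta> \<Theta> d K"
begin

lemma K_arr [simp]:
  assumes "Y \<in> obs C"
  shows "K Y \<in> arrs C" "src C (K Y) = fob \<Theta> (Y, Y)" "tgt C (K Y) = fob S (fob T Y)"
  using K assms by (auto simp: structural_interpretation_def Let_def nat_trans_def ST_sel)

lemma K_nat:
  assumes "f \<in> arrs C" "src C f = Y" "tgt C f = Y'"
  shows "far S (far T f) \<cdot> K Y = K Y' \<cdot> far \<Theta> (f, f)"
  using K assms by (auto simp: structural_interpretation_def Let_def nat_trans_def ST_sel)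

lemma interp_arr: "interp K \<in> arrs C" "src C (interp K) = fob \<Theta> (I, I)" "tgt C (interp K) = I"
  by (simp_all add: interp_def)

lemma act_\<delta>_K:
  "act \<cdot> mult S (fob T I) \<cdot> far S (\<delta> I) \<cdot> K (fob S I) = interp K \<cdot> far \<Theta> (mult S (fob T X), mult S (fob T X))"
  using ext_eq[OF act_\<delta>, of "K (fob S I)"] K_nat[of "mult S (fob T X)" "fob S I" I]
  by (simp add: interp_def)

text \<open>At \<open>I\<close> and after \<open>act\<close>, both sides of the defining equation of
  an interpretation depend on \<open>K\<close> through \<open>interp K\<close> alone: the left one
  by \<open>act_\<delta>_K\<close>, the right one by associativity of \<open>act\<close> and
  naturality of \<open>K\<close> along \<open>act\<close>.\<close>

lemma interp_step:
  "interp K \<cdot> far \<Theta> (mult S (fob T X) \<cdot> \<eta>\<Sigma> I, idn C I) =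
    act \<cdot> far ST (copair C cp (interp K \<cdot> far \<Theta> (idn C I, act)) (copair C cp (idn C I) (idn C I))) \<cdot> d (I, I)"
proof -
  let ?n = "copair C cp (idn C I) (idn C I)"
  note [simp] = interp_arr ST_sel(1,2)
  have U [simp]: "unit ST I \<in> arrs C" "src C (unit ST I) = I" "tgt C (unit ST I) = fob S (fob T I)"
    "mult ST I \<in> arrs C" "src C (mult ST I) = fob S (fob T (fob S (fob T I)))" "tgt C (mult ST I) = fob S (fob T I)"
    using monad_arr[OF ST_monad, of I] by simp_all
  have "interp K \<cdot> far \<Theta> (mult S (fob T X) \<cdot> \<eta>\<Sigma> I, idn C I) =
      interp K \<cdot> far \<Theta> (mult S (fob T X), mult S (fob T X)) \<cdot> far \<Theta> (\<eta>\<Sigma> I, unit S I)"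
    using mult_S_unit by simp
  also have "\<dots> = act \<cdot> mult S (fob T I) \<cdot> far S (\<delta> I) \<cdot> K (fob S I) \<cdot> far \<Theta> (\<eta>\<Sigma> I, unit S I)"
    using arg_cong[OF act_\<delta>_K, of "\<lambda>f. f \<cdot> far \<Theta> (\<eta>\<Sigma> I, unit S I)"] by simp
  also have "\<dots> = act \<cdot> mult ST I \<cdot> far ST (copair C cp (mult ST I) (unit ST I))
           \<cdot> far ST (sum_map C cp (K (fob ST I)) (idn C I))
           \<cdot> far ST (sum_map C cp (far \<Theta> (unit ST I, idn C (fob ST I))) ?n) \<cdot> d (I, I)"
    using K by (simp add: structural_interpretation_def Let_def del: ST_sel)
  also have "\<dots> = act \<cdot> far ST (act \<cdot> copair C cp (mult ST I) (unit ST I)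
      \<cdot> sum_map C cp (K (fob ST I)) (idn C I) \<cdot> sum_map C cp (far \<Theta> (unit ST I, idn C (fob ST I))) ?n) \<cdot> d (I, I)"
    using ext_eq[OF act_assoc] by simp
  also have "act \<cdot> copair C cp (mult ST I) (unit ST I)
      \<cdot> sum_map C cp (K (fob ST I)) (idn C I) \<cdot> sum_map C cp (far \<Theta> (unit ST I, idn C (fob ST I))) ?n =
      copair C cp (interp K \<cdot> far \<Theta> (idn C I, act)) ?n"
  proof -
    \<comment> \<open>Naturality puts \<open>act\<close> into both arguments of
      \<open>\<Theta>\<close>. In the first it cancels against \<open>unit ST I\<close>; in the
      second it remains and maps the enlarged argument back to \<open>I\<close>.\<close>
    have 1: "act \<cdot> mult ST I \<cdot> K (fob S (fob T I)) \<cdot> far \<Theta> (unit ST I, idn C (fob S (fob T I))) =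
        interp K \<cdot> far \<Theta> (idn C I, act)"
      using ext_eq[OF act_assoc, of "K (fob S (fob T I)) \<cdot> far \<Theta> (unit ST I, idn C (fob S (fob T I)))"]
        ext_eq[OF K_nat[of act "fob S (fob T I)" I], of "far \<Theta> (unit ST I, idn C (fob S (fob T I)))"] act_unit
      by (simp add: interp_def)
    have 2: "act \<cdot> unit ST I \<cdot> ?n = ?n" using ext_eq[OF act_unit, of ?n] by simp
    let ?t = "far \<Theta> (unit ST I, idn C (fob ST I))"
    have 3: "copair C cp (mult ST I) (unit ST I) \<cdot> sum_map C cp (K (fob ST I)) (idn C I) =
        copair C cp (mult ST I \<cdot> K (fob ST I)) (unit ST I)"
      by (simp add: copair_sum_map)
    have 4: "copair C cp (mult ST I \<cdot> K (fob ST I)) (unit ST I) \<cdot> sum_map C cp ?t ?n =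
        copair C cp (mult ST I \<cdot> K (fob ST I) \<cdot> ?t) (unit ST I \<cdot> ?n)"
      by (subst copair_sum_map) simp_all
    have "act \<cdot> copair C cp (mult ST I) (unit ST I) \<cdot> sum_map C cp (K (fob ST I)) (idn C I) \<cdot> sum_map C cp ?t ?n =
        act \<cdot> copair C cp (mult ST I \<cdot> K (fob ST I)) (unit ST I) \<cdot> sum_map C cp ?t ?n"
      using ext_eq[OF 3, of "sum_map C cp ?t ?n"] by simp
    also have "\<dots> = copair C cp (act \<cdot> mult ST I \<cdot> K (fob ST I) \<cdot> ?t) (act \<cdot> unit ST I \<cdot> ?n)"
      unfolding 4 by (rule comp_copair) simp_all
    finally show ?thesis using 1 2 unfolding ST_sel(1) by metis
  qed
  finally show ?thesis .
qed

text \<open>The left side is a side of the hypothesis \<open>eq\<close> in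
  \<open>coequaliser_iso\<close>, so that hypothesis follows once two interpretations have the same
  \<open>interp\<close>.\<close>

lemma interp_equation: "act \<cdot> theta_interp C S T \<delta> \<Theta> K I = interp K \<cdot> far \<Theta> (idn C I, mult S (fob T X))"
  using arg_cong[OF act_\<delta>_K, of "\<lambda>f. f \<cdot> far \<Theta> (unit S I, idn C (fob S I))"] mult_S_unit
  by (simp add: theta_interp_def interp_arr)

end

text \<open>Induction over \<open>S\<close> in the first argument of \<open>\<Theta>\<close>, with
  the second fixed at \<open>I\<close>. The base case concerns arrows out of the image of an initial
  object under a cocontinuous functor, any two of which with the same target are equal.\<close>

lemma interp_unique:
  assumes K: "structural_interpretation C cp S \<eta>\<Sigma> T \<delta> \<Theta> d K"
    and K': "structural_interpretation C cp S \<eta>\<Sigma> T \<delta> \<Theta> d K'"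
    and init: "initial_object C (fob T X)"
  shows "interp K = interp K'"
proof -
  let ?\<Phi> = "\<lparr>fob = (\<lambda>Y. fob \<Theta> (Y, I)), far = (\<lambda>f. far \<Theta> (f, idn C I))\<rparr>"
  have \<Phi>: "cocontinuous U C C ?\<Phi>" by (rule cocontinuous_\<Theta>) simp
  note interp_arr[OF K, simp] interp_arr[OF K', simp]
  show ?thesis
  proof (rule free_monad_induct[OF finitary_\<Sigma> free_S _ \<Phi>])
    show "interp K \<cdot> far ?\<Phi> (unit S (fob T X)) = interp K' \<cdot> far ?\<Phi> (unit S (fob T X))"
      by (rule cocontinuous_initial[OF \<Phi> init]) simp_all
  next
    fix p assume p [simp]: "p \<in> arrs C" "tgt C p = fob S (fob T X)"
      and eq: "interp K \<cdot> far ?\<Phi> p = interp K' \<cdot> far ?\<Phi> p"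
    let ?A = "src C p"
    let ?n = "copair C cp (idn C I) (idn C I)"
    \<comment> \<open>The recursive call has \<open>act\<close> in its second argument; precomposing
      the induction hypothesis with it gives agreement there.\<close>
    have eq': "interp K \<cdot> far \<Theta> (p, act) = interp K' \<cdot> far \<Theta> (p, act)"
      using arg_cong[OF eq, of "\<lambda>f. f \<cdot> far \<Theta> (idn C ?A, act)"] by simp
    \<comment> \<open>Naturality of \<open>d\<close> moves \<open>p\<close> into the recursive call,
      so the right side depends on \<open>L\<close> only through
      \<open>interp L \<cdot> far \<Theta> (p, act)\<close>, to which \<open>eq'\<close>
      applies.\<close>
    have "interp L \<cdot> far \<Theta> (mult S (fob T X) \<cdot> \<eta>\<Sigma> I \<cdot> far \<Sigma> p, idn C I) =
        act \<cdot> far ST (copair C cp (interp L \<cdot> far \<Theta> (p, act)) (?n \<cdot> sum_map C cp p (idn C I))) \<cdot> d (?A, I)"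
      if L: "structural_interpretation C cp S \<eta>\<Sigma> T \<delta> \<Theta> d L" for L
    proof -
      note [simp] = interp_arr[OF L] ST_sel(1,2)
      have "interp L \<cdot> far \<Theta> (mult S (fob T X) \<cdot> \<eta>\<Sigma> I \<cdot> far \<Sigma> p, idn C I) =
          (interp L \<cdot> far \<Theta> (mult S (fob T X) \<cdot> \<eta>\<Sigma> I, idn C I)) \<cdot> far \<Theta> (far \<Sigma> p, idn C I)"
        by simp
      also have "\<dots> = act \<cdot> far ST (copair C cp (interp L \<cdot> far \<Theta> (idn C I, act)) ?n) \<cdot> d (I, I) \<cdot> far \<Theta> (far \<Sigma> p, idn C I)"
        unfolding interp_step[OF L] by simp
      also have "\<dots> = act \<cdot> far ST (copair C cp (interp L \<cdot> far \<Theta> (idn C I, act)) ?n \<cdot>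
          sum_map C cp (far \<Theta> (p, far ST (idn C I))) (sum_map C cp p (idn C I))) \<cdot> d (?A, I)"
        using d_nat[of p "idn C I" ?A I I I] by simp
      also have "\<dots> = act \<cdot> far ST (copair C cp (interp L \<cdot> far \<Theta> (p, act)) (?n \<cdot> sum_map C cp p (idn C I))) \<cdot> d (?A, I)"
        by (simp add: copair_sum_map)
      finally show ?thesis .
    qed
    from this[OF K] this[OF K'] eq'
    show "interp K \<cdot> far ?\<Phi> (mult S (fob T X) \<cdot> \<eta>\<Sigma> (fob S (fob T X)) \<cdot> far \<Sigma> p) =
        interp K' \<cdot> far ?\<Phi> (mult S (fob T X) \<cdot> \<eta>\<Sigma> (fob S (fob T X)) \<cdot> far \<Sigma> p)"
      by simp
  qed simp_all
qed

end

end

theorem theorem5p12: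
  fixes U :: "'u set"
    and C :: "('o, 'a) cat"
    and Z :: 'o
    and cp :: "('o, 'a) coprods"
    and \<Sigma> :: "('o, 'a, 'o, 'a) ftr"
    and S T P Q :: "('o, 'a) monad"
    and \<eta>\<Sigma> \<delta> L R \<iota> Lt Rt q :: "'o \<Rightarrow> 'a"
    and \<Theta> :: "('o, 'a) bifunctor"
    and d :: "'o \<times> 'o \<Rightarrow> 'a"
  assumes "uncountable U"
    and "locally_finitely_presentable U C"
    and "initial_object C Z"
    and "binary_coproducts C cp"
    and "finitary U C C \<Sigma>"
    and "free_monad C \<Sigma> S \<eta>\<Sigma>"
    and "finitary_monad U C T"
    and "constant_free C Z T"
    and "distributive_law C S T \<delta>"
    and "structural_equational_system U C cp \<Sigma> S \<eta>\<Sigma> T \<delta> \<Theta> d L R"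
    and "induced_equational_system C S T \<delta> \<Theta> L R P \<iota> Lt Rt"
    and "fin_monad_coequaliser U C P (composite_monad C S T \<delta>) Lt Rt Q q"
  shows "admissible C Z q"
proof -
  interpret structural_setting C U cp \<Sigma> S T \<eta>\<Sigma> \<delta> \<Theta> d
    using assms by unfold_locales
      (simp_all add: locally_finitely_presentable_def structural_equational_system_def)
  have Z: "Z \<in> obs C" using assms(3) by (simp add: initial_object_def)
  have L: "structural_interpretation C cp S \<eta>\<Sigma> T \<delta> \<Theta> d L" and R: "structural_interpretation C cp S \<eta>\<Sigma> T \<delta> \<Theta> d R"
    using assms(10) by (simp_all add: structural_equational_system_def)
  have "initial_object C (fob T Z)"
    using initial_iso[OF assms(3), of "unit T Z"] assms(8) Z by (simp add: constant_free_def)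
  then have eq: "interp Z L = interp Z R"
    using interp_unique[OF Z L R] by blast
  have "is_iso C (q Z)"
  proof (rule coequaliser_iso[OF finitary_ST jointly_epi_theta])
    show "free_monad C (theta_ftr \<Theta> S) P \<iota>"
      "induced_morphism C P \<iota> ST (theta_interp C S T \<delta> \<Theta> L) Lt"
      "induced_morphism C P \<iota> ST (theta_interp C S T \<delta> \<Theta> R) Rt"
      using assms(11) by (simp_all add: induced_equational_system_def)
    show "mult ST Z \<cdot>\<^bsub>C\<^esub> theta_interp C S T \<delta> \<Theta> L (fob ST Z) = mult ST Z \<cdot>\<^bsub>C\<^esub> theta_interp C S T \<delta> \<Theta> R (fob ST Z)"
      using interp_equation[OF Z L] interp_equation[OF Z R] eq by (simp add: act_def[OF Z] ST_sel)
  qed (use assms(12) Z in simp_all)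
  then show ?thesis by (simp add: admissible_def)
qed

end
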